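(* Let $n\ge 1$, $N=2^n$, let $B\sim \mathrm{B}_s(N,\Sigma_S)$ be a Haar-butterfly matrix, and let $X_j\sim\mathrm{Cauchy}(1)$, $j\ge 1$, be iid. If GENP is used, let $Y_j=|X_j|$; if GEPP or GERP is used, let $Y_1,Y_2,\dots$ be iid, each having the conditional distribution of $|X_j|$ given $|X_j|\le 1$. Then almost surely $B$ has an $LU$ factorization using GENP; almost surely the factors $L$ and $U$ of the GEPP factorization $PB=LU$ are unique (i.e. invariant under row permutations of $B$), and this factorization is also the GERP factorization of $B$. Moreover, for each of GENP, GEPP and GERP (with the corresponding $Y_j$), the following equalities in distribution hold: $$\rho(B)\sim\prod_{j=1}^n(1+Y_j^2),\qquad \rho_o(B)\sim\prod_{j=1}^n\left(1+\frac{2Y_j^2}{1+Y_j}\right),\qquad \rho_\infty(B)\sim\prod_{j=1}^n\bigl(1+\max(Y_j,Y_j^2)\bigr).$$ Using GENP, $1\le\rho(B)\le\rho_\infty(B)$ and $1\le\rho_o(B)\le\rho_\infty(B)$ (almost surely); using GEPP or GERP, $1\le\rho(B)\le\rho_o(B)\le\rho_\infty(B)\le N$ (almost surely). Finally, the GEPP max-norm growth factor of $B$ is minimal among all GE pivoting strategies: if $P,Q$ are permutation matrices (allowed to depend on $B$) such that $PBQ$ has a GENP factorization almost surely, then $\rho^{\mathrm{GENP}}(PBQ)\ge\rho^{\mathrm{GEPP}}(B)$ almost surely.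
   Context: Butterfly matrices. For $\theta\in[0,2\pi)$ let $B(\theta)=\begin{bmatrix}\cos\theta&\sin\theta\\-\sin\theta&\cos\theta\end{bmatrix}$. For $N=2^n$ and $\boldsymbol\theta\in[0,2\pi)^n$ let $B(\boldsymbol\theta)=B(\theta_n)\otimes B(\theta_{n-1})\otimes\cdots\otimes B(\theta_1)$ (Kronecker product). The Haar-butterfly ensemble $\mathrm{B}_s(N,\Sigma_S)$ is the law of $B(\boldsymbol\theta)$ when $\theta_1,\dots,\theta_n$ are iid uniform on $[0,2\pi)$. $\mathrm{Cauchy}(1)$ is the standard Cauchy law with density $\frac1\pi\frac1{1+x^2}$ on $\mathbb R$. $X\sim Y$ between random variables denotes equality in distribution. Gaussian elimination (GE) on a nonsingular $A\in\mathbb R^{m\times m}$. GENP (no pivoting): $A^{(1)}=A$, and $A^{(k+1)}$ is obtained from $A^{(k)}$ by subtracting multiples of row $k$ from the rows $i>k$ so as to annihilate the entries $(i,k)$, $i>k$; so $A^{(k)}$ is the matrix before the $k$th step. When all pivots are nonzero this gives $A=LU$ with $U=A^{(m)}$ upper triangular and $L$ unit lower triangular, $L_{ij}=A^{(j)}_{ij}/A^{(j)}_{jj}$ for $i>j$. GEPP (partial pivoting): before step $k$ a row swap brings an entry of largest magnitude among the entries of column $k$ on or below the diagonal to position $(k,k)$; this yields $PA=LU$ with $P$ a permutation matrix (the GENP factorization of $PA$). GERP (rook pivoting): at step $k$, in the remaining block (rows and columns $\ge k$), first scan column $k$ for a largest-magnitude entry, then scan the row of that entry, then the column of the new candidate,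 and so on, stopping as soon as the candidate has maximal magnitude in both its row and its column of the block; it is then moved to position $(k,k)$ by a row and a column swap, yielding $PAQ=LU$ with $P,Q$ permutation matrices. Growth factors. If $PAQ=LU$ is the factorization produced by the chosen strategy ($P=Q=I$ for GENP, $Q=I$ for GEPP), then $$\rho(A)=\frac{\|L\|_{\max}\max_k\|(PAQ)^{(k)}\|_{\max}}{\|A\|_{\max}},\quad \rho_o(A)=\frac{\||L||U|\|_\infty}{\|A\|_\infty},\quad \rho_\infty(A)=\frac{\|L\|_\infty\|U\|_\infty}{\|A\|_\infty},$$ where $(PAQ)^{(k)}$ are the GENP intermediate matrices of $PAQ$, $\|M\|_{\max}=\max_{i,j}|M_{ij}|$, $|M|$ is the entrywise absolute value, and $\|\cdot\|_\infty$ is the matrix norm induced by $\ell_\infty$ (maximum absolute row sum). Superscripts as in $\rho^{\mathrm{GENP}}$, $\rho^{\mathrm{GEPP}}$ indicate the strategy used. *)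

theory Defs
  imports "HOL-Probability.Probability" "Jordan_Normal_Form.Column_Operations"
begin

hide_const (open) Finite_Cartesian_Product.mat

definition kron :: "real mat \<Rightarrow> real mat \<Rightarrow> real mat" where
  "kron A B = mat (dim_row A * dim_row B) (dim_col A * dim_col B)
     (\<lambda>(i, j). A $$ (i div dim_row B, j div dim_col B) * B $$ (i mod dim_row B, j mod dim_col B))"

definition rotation2 :: "real \<Rightarrow> real mat" where
  "rotation2 t = mat_of_rows_list 2 [[cos t, sin t], [- sin t, cos t]]"

text \<open>The angles are indexed by \<open>1..n\<close>, and the factor of the last angle stands on the left.\<close>

primrec butterfly :: "nat \<Rightarrow> (nat \<Rightarrow> real) \<Rightarrow> real mat" where
  "butterfly 0 \<theta> = 1\<^sub>m 1"
| "butterfly (Suc n) \<theta> = kron (rotation2 (\<theta> (Suc n))) (butterfly n \<theta>)"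

text \<open>The Borel sigma-algebra on the \<open>m \<times> m\<close> matrices, i.e. the one generated by the entries.\<close>

definition mat_borel :: "nat \<Rightarrow> real mat measure" where
  "mat_borel m = vimage_algebra (carrier_mat m m)
     (\<lambda>A. \<lambda>ij \<in> {..<m} \<times> {..<m}. A $$ ij) (PiM ({..<m} \<times> {..<m}) (\<lambda>_. borel))"

definition haar_butterfly :: "nat \<Rightarrow> real mat measure" where
  "haar_butterfly n =
     distr (PiM {1..n} (\<lambda>_. uniform_measure lborel {0..<2 * pi})) (mat_borel (2 ^ n)) (butterfly n)"

text \<open>Rows, columns and steps are counted from 0: \<open>genp_iter A k\<close> is the matrix that is
  usually written \<open>A\<close> with superscript \<open>(k+1)\<close>. A vanishing pivot makes the value meaningless;
  this is excluded by \<open>genp_ok\<close>.\<close>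

definition elim_step :: "nat \<Rightarrow> real mat \<Rightarrow> real mat" where
  "elim_step k A = mat (dim_row A) (dim_col A)
     (\<lambda>(i, j). if k < i then A $$ (i, j) - A $$ (i, k) / A $$ (k, k) * A $$ (k, j) else A $$ (i, j))"

primrec genp_iter :: "real mat \<Rightarrow> nat \<Rightarrow> real mat" where
  "genp_iter A 0 = A"
| "genp_iter A (Suc k) = elim_step k (genp_iter A k)"

definition genp_ok :: "real mat \<Rightarrow> bool" where
  "genp_ok A \<longleftrightarrow> (\<forall>k < dim_row A. genp_iter A k $$ (k, k) \<noteq> 0)"

definition genp_L :: "real mat \<Rightarrow> real mat" where
  "genp_L A = mat (dim_row A) (dim_row A)
     (\<lambda>(i, j). if i = j then 1
               else if j < i then genp_iter A j $$ (i, j) / genp_iter A j $$ (j, j) else 0)"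

definition genp_U :: "real mat \<Rightarrow> real mat" where
  "genp_U A = genp_iter A (dim_row A - 1)"

definition lu_factorization :: "real mat \<Rightarrow> real mat \<Rightarrow> real mat \<Rightarrow> bool" where
  "lu_factorization A L U \<longleftrightarrow>
     L \<in> carrier_mat (dim_row A) (dim_row A) \<and> U \<in> carrier_mat (dim_row A) (dim_row A) \<and>
     (\<forall>i < dim_row A. L $$ (i, i) = 1) \<and> (\<forall>i < dim_row A. \<forall>j < dim_row A. i < j \<longrightarrow> L $$ (i, j) = 0) \<and>
     upper_triangular U \<and> A = L * U"

definition permutation_mat :: "nat \<Rightarrow> real mat \<Rightarrow> bool" where
  "permutation_mat m P \<longleftrightarrow>
     (\<exists>\<pi>. \<pi> permutes {..<m} \<and> P = mat m m (\<lambda>(i, j). if j = \<pi> i then 1 else 0))"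

text \<open>\<open>col_max C k p q\<close>: entry \<open>(p, q)\<close> has maximal magnitude in its column within the block of
  rows and columns \<open>\<ge> k\<close>; \<open>row_max\<close> likewise for its row.\<close>

definition col_max :: "real mat \<Rightarrow> nat \<Rightarrow> nat \<Rightarrow> nat \<Rightarrow> bool" where
  "col_max C k p q \<longleftrightarrow> k \<le> p \<and> p < dim_row C \<and> k \<le> q \<and> q < dim_col C \<and>
     (\<forall>i. k \<le> i \<and> i < dim_row C \<longrightarrow> \<bar>C $$ (i, q)\<bar> \<le> \<bar>C $$ (p, q)\<bar>)"

definition row_max :: "real mat \<Rightarrow> nat \<Rightarrow> nat \<Rightarrow> nat \<Rightarrow> bool" where
  "row_max C k p q \<longleftrightarrow> k \<le> p \<and> p < dim_row C \<and> k \<le> q \<and> q < dim_col C \<and>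
     (\<forall>j. k \<le> j \<and> j < dim_col C \<longrightarrow> \<bar>C $$ (p, j)\<bar> \<le> \<bar>C $$ (p, q)\<bar>)"

text \<open>Pivoting is modelled by relations, so that ties are broken arbitrarily.
  \<open>gepp_run A k P C\<close>: some run of partial pivoting on \<open>A\<close> has reached, after \<open>k\<close> steps, the working
  matrix \<open>C\<close>, having accumulated the row swaps \<open>P\<close>.\<close>

inductive gepp_run :: "real mat \<Rightarrow> nat \<Rightarrow> real mat \<Rightarrow> real mat \<Rightarrow> bool" for A where
  init: "gepp_run A 0 (1\<^sub>m (dim_row A)) A"
| step: "gepp_run A k P C \<Longrightarrow> col_max C k p k \<Longrightarrow>
     gepp_run A (Suc k) (swaprows k p P) (elim_step k (swaprows k p C))"

definition gepp :: "real mat \<Rightarrow> real mat \<Rightarrow> bool" where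
  "gepp A P \<longleftrightarrow> (\<exists>C. gepp_run A (dim_row A) P C)"

text \<open>\<open>rook_cand C k d p q\<close>: the rook search at step \<open>k\<close> visits the candidate \<open>(p, q)\<close>;
  \<open>d\<close> says that it was found by scanning a column (and so its row is to be scanned next).\<close>

inductive rook_cand :: "real mat \<Rightarrow> nat \<Rightarrow> bool \<Rightarrow> nat \<Rightarrow> nat \<Rightarrow> bool" for C k where
  start: "col_max C k p k \<Longrightarrow> rook_cand C k True p k"
| scan_row: "rook_cand C k True p q \<Longrightarrow> \<not> (row_max C k p q \<and> col_max C k p q) \<Longrightarrow>
     row_max C k p q' \<Longrightarrow> rook_cand C k False p q'"
| scan_col: "rook_cand C k False p q \<Longrightarrow> \<not> (row_max C k p q \<and> col_max C k p q) \<Longrightarrow>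
     col_max C k p' q \<Longrightarrow> rook_cand C k True p' q"

definition rook_pivot :: "real mat \<Rightarrow> nat \<Rightarrow> nat \<Rightarrow> nat \<Rightarrow> bool" where
  "rook_pivot C k p q \<longleftrightarrow> (\<exists>d. rook_cand C k d p q) \<and> row_max C k p q \<and> col_max C k p q"

inductive gerp_run :: "real mat \<Rightarrow> nat \<Rightarrow> real mat \<Rightarrow> real mat \<Rightarrow> real mat \<Rightarrow> bool" for A where
  init: "gerp_run A 0 (1\<^sub>m (dim_row A)) (1\<^sub>m (dim_col A)) A"
| step: "gerp_run A k P Q C \<Longrightarrow> rook_pivot C k p q \<Longrightarrow>
     gerp_run A (Suc k) (swaprows k p P) (swapcols k q Q)
       (elim_step k (swapcols k q (swaprows k p C)))"

definition gerp :: "real mat \<Rightarrow> real mat \<Rightarrow> real mat \<Rightarrow> bool" where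
  "gerp A P Q \<longleftrightarrow> (\<exists>C. gerp_run A (dim_row A) P Q C)"

datatype strategy = GENP | GEPP | GERP

text \<open>\<open>ge_produces S A P Q\<close>: strategy \<open>S\<close> applied to \<open>A\<close> yields \<open>P A Q = L U\<close>, where \<open>L\<close> and \<open>U\<close>
  are \<open>genp_L (P * A * Q)\<close> and \<open>genp_U (P * A * Q)\<close>.\<close>

definition ge_produces :: "strategy \<Rightarrow> real mat \<Rightarrow> real mat \<Rightarrow> real mat \<Rightarrow> bool" where
  "ge_produces S A P Q =
     (case S of
        GENP \<Rightarrow> genp_ok A \<and> P = 1\<^sub>m (dim_row A) \<and> Q = 1\<^sub>m (dim_col A)
      | GEPP \<Rightarrow> gepp A P \<and> Q = 1\<^sub>m (dim_col A)
      | GERP \<Rightarrow> gerp A P Q)"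

definition max_norm :: "real mat \<Rightarrow> real" where
  "max_norm A = Max (abs ` elements_mat A)"

definition inf_norm :: "real mat \<Rightarrow> real" where
  "inf_norm A = Max ((\<lambda>i. \<Sum>j < dim_col A. \<bar>A $$ (i, j)\<bar>) ` {..<dim_row A})"

definition rho :: "real mat \<Rightarrow> real mat \<Rightarrow> real mat \<Rightarrow> real" where
  "rho A P Q = max_norm (genp_L (P * A * Q)) *
     Max ((\<lambda>k. max_norm (genp_iter (P * A * Q) k)) ` {..<dim_row A}) / max_norm A"

definition rho_o :: "real mat \<Rightarrow> real mat \<Rightarrow> real mat \<Rightarrow> real" where
  "rho_o A P Q = inf_norm (map_mat abs (genp_L (P * A * Q)) * map_mat abs (genp_U (P * A * Q))) / inf_norm A"

definition rho_inf :: "real mat \<Rightarrow> real mat \<Rightarrow> real mat \<Rightarrow> real" where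
  "rho_inf A P Q = inf_norm (genp_L (P * A * Q)) * inf_norm (genp_U (P * A * Q)) / inf_norm A"

definition cauchy_density :: "real \<Rightarrow> real" where
  "cauchy_density x = 1 / pi * (1 / (1 + x\<^sup>2))"

text \<open>Growth factors are determined only almost surely (ties, vanishing pivots), so their
  law is taken with respect to the completed measure.\<close>

definition eq_in_dist :: "'a measure \<Rightarrow> ('a \<Rightarrow> real) \<Rightarrow> 'b measure \<Rightarrow> ('b \<Rightarrow> real) \<Rightarrow> bool" where
  "eq_in_dist M R M' Z \<longleftrightarrow>
     R \<in> borel_measurable (completion M) \<and> Z \<in> borel_measurable M' \<and>
     distr (completion M) borel R = distr M' borel Z"

text \<open>\<open>P\<close> and \<open>Q\<close> range over all ways of breaking ties, possibly different at each \<open>\<omega>\<close>.\<close>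

definition growth_laws ::
  "strategy \<Rightarrow> nat \<Rightarrow> 'a measure \<Rightarrow> ('a \<Rightarrow> real mat) \<Rightarrow> 'b measure \<Rightarrow> (nat \<Rightarrow> 'b \<Rightarrow> real) \<Rightarrow> bool" where
  "growth_laws S n M B M' Y \<longleftrightarrow>
     (\<forall>P Q. (AE \<omega> in M. ge_produces S (B \<omega>) (P \<omega>) (Q \<omega>)) \<longrightarrow>
        eq_in_dist M (\<lambda>\<omega>. rho (B \<omega>) (P \<omega>) (Q \<omega>))
          M' (\<lambda>\<omega>. \<Prod>j = 1..n. 1 + (Y j \<omega>)\<^sup>2) \<and>
        eq_in_dist M (\<lambda>\<omega>. rho_o (B \<omega>) (P \<omega>) (Q \<omega>))
          M' (\<lambda>\<omega>. \<Prod>j = 1..n. 1 + 2 * (Y j \<omega>)\<^sup>2 / (1 + Y j \<omega>)) \<and>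
        eq_in_dist M (\<lambda>\<omega>. rho_inf (B \<omega>) (P \<omega>) (Q \<omega>))
          M' (\<lambda>\<omega>. \<Prod>j = 1..n. 1 + max (Y j \<omega>) ((Y j \<omega>)\<^sup>2)))"

lemma dim_kron [simp]: "dim_row (kron A B) = dim_row A * dim_row B" "dim_col (kron A B) = dim_col A * dim_col B"
  by (auto simp: kron_def)

lemma index_kron:
  "i < dim_row A * dim_row B \<Longrightarrow> j < dim_col A * dim_col B \<Longrightarrow> kron A B $$ (i, j) =
     A $$ (i div dim_row B, j div dim_col B) * B $$ (i mod dim_row B, j mod dim_col B)"
  by (simp add: kron_def)

lemma dim_rotation2 [simp]: "dim_row (rotation2 t) = 2" "dim_col (rotation2 t) = 2"
  by (auto simp: rotation2_def mat_of_rows_list_def)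

lemma butterfly_carrier [simp]: "butterfly n \<theta> \<in> carrier_mat (2 ^ n) (2 ^ n)"
proof (induction n)
  case (Suc n)
  note dims = carrier_matD[OF Suc.IH]
  show ?case by (rule carrier_matI) (simp_all add: dims)
qed simp

lemma rotation2_measurable:
  "i < 2 \<Longrightarrow> j < 2 \<Longrightarrow> (\<lambda>t. rotation2 t $$ (i, j)) \<in> borel_measurable borel"
  by (auto simp: rotation2_def mat_of_rows_list_def less_2_cases_iff)

lemma butterfly_entry_measurable:
  assumes "n \<le> m" "i < 2 ^ n" "j < 2 ^ n"
  shows "(\<lambda>\<theta>. butterfly n \<theta> $$ (i, j)) \<in> borel_measurable (PiM {1..m} (\<lambda>_. uniform_measure lborel S))"
  using assms
proof (induction n arbitrary: i j)
  case (Suc n)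
  have dims: "dim_row (butterfly n \<theta>) = 2 ^ n" "dim_col (butterfly n \<theta>) = 2 ^ n" for \<theta>
    by (rule carrier_matD[OF butterfly_carrier])+
  have eq: "butterfly (Suc n) \<theta> $$ (i, j) =
      rotation2 (\<theta> (Suc n)) $$ (i div 2 ^ n, j div 2 ^ n) * butterfly n \<theta> $$ (i mod 2 ^ n, j mod 2 ^ n)" for \<theta>
    using Suc.prems index_kron[of i "rotation2 (\<theta> (Suc n))" "butterfly n \<theta>" j] by (simp add: dims)
  have comp: "(\<lambda>\<theta>. \<theta> (Suc n)) \<in> borel_measurable (PiM {1..m} (\<lambda>_. uniform_measure lborel S))"
  proof -
    have "(\<lambda>\<theta>. \<theta> (Suc n)) \<in>
        measurable (PiM {1..m} (\<lambda>_. uniform_measure lborel S)) (uniform_measure lborel S)"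
      using Suc.prems by (intro measurable_component_singleton) auto
    also have "\<dots> = borel_measurable (PiM {1..m} (\<lambda>_. uniform_measure lborel S))"
      by (rule measurable_cong_sets) auto
    finally show ?thesis .
  qed
  have lt: "i div 2 ^ n < 2" "j div 2 ^ n < 2"
    using Suc.prems by (auto simp: less_mult_imp_div_less)
  show ?case
    unfolding eq using Suc.prems
    by (intro borel_measurable_times Suc.IH measurable_compose[OF comp rotation2_measurable[OF lt]]) auto
next
  case 0
  show ?case unfolding butterfly.simps by (rule borel_measurable_const)
qed

lemma measurable_mat_borelI:
  assumes "\<And>x. x \<in> space M \<Longrightarrow> f x \<in> carrier_mat m m"
    and "\<And>i j. i < m \<Longrightarrow> j < m \<Longrightarrow> (\<lambda>x. f x $$ (i, j)) \<in> borel_measurable M"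
  shows "f \<in> measurable M (mat_borel m)"
  unfolding mat_borel_def
  by (rule measurable_vimage_algebra2) (use assms in \<open>auto intro!: measurable_restrict\<close>)

lemma butterfly_measurable:
  "butterfly n \<in> measurable (PiM {1..n} (\<lambda>_. uniform_measure lborel S)) (mat_borel (2 ^ n))"
  by (rule measurable_mat_borelI) (rule butterfly_carrier, rule butterfly_entry_measurable[OF order_refl])

lemma prob_space_haar_butterfly: "prob_space (haar_butterfly n)"
proof -
  interpret U: prob_space "uniform_measure lborel {0..<2 * pi}"
    by (rule prob_space_uniform_measure) auto
  interpret P: product_prob_space "\<lambda>_::nat. uniform_measure lborel {0..<2 * pi}" "{1..n}"
    by unfold_locales
  show ?thesis
    unfolding haar_butterfly_def by (rule P.prob_space_distr) (rule butterfly_measurable)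
qed

lemma genp_iter_carrier [simp]: "dim_row (genp_iter A k) = dim_row A" "dim_col (genp_iter A k) = dim_col A"
  by (induction k) (auto simp: elim_step_def)

lemma genp_iter_frozen:
  assumes "A \<in> carrier_mat m m" "i < m" "j < m"
  shows "genp_iter A (i + d) $$ (i, j) = genp_iter A i $$ (i, j)"
proof (induction d)
  case (Suc d)
  have "i < dim_row (genp_iter A (i + d))" "j < dim_col (genp_iter A (i + d))"
    using assms by auto
  then show ?case using Suc.IH by (simp add: elim_step_def)
qed simp

lemma genp_iter_zero:
  assumes A: "A \<in> carrier_mat m m" and ok: "genp_ok A"
  shows "j < k \<Longrightarrow> j < i \<Longrightarrow> i < m \<Longrightarrow> genp_iter A k $$ (i, j) = 0"
proof (induction k arbitrary: i)
  case (Suc k)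
  have nz: "genp_iter A k $$ (k, k) \<noteq> 0" if "k < m"
    using that ok A by (auto simp: genp_ok_def)
  show ?case
  proof (cases "j = k")
    case True
    then show ?thesis using Suc.prems nz A by (auto simp: elim_step_def)
  next
    case False
    then show ?thesis using Suc A by (auto simp: elim_step_def)
  qed
qed simp

lemma genp_iter_sum:
  assumes A: "A \<in> carrier_mat m m" and ij: "i < m" "j < m"
  shows "k \<le> i \<Longrightarrow> A $$ (i, j) =
    genp_iter A k $$ (i, j) + (\<Sum>l < k. genp_L A $$ (i, l) * genp_iter A l $$ (l, j))"
proof (induction k)
  case (Suc k)
  then show ?case using A ij by (auto simp: elim_step_def genp_L_def)
qed simp

lemma genp_ok_imp_lu_factorization:
  assumes A: "A \<in> carrier_mat m m" and ok: "genp_ok A"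
  shows "lu_factorization A (genp_L A) (genp_U A)"
proof -
  have U: "genp_U A $$ (l, j) = genp_iter A l $$ (l, j)" if "l < m" "j < m" for l j
    using genp_iter_frozen[OF A that, of "m - 1 - l"] that A by (simp add: genp_U_def)
  have dims: "genp_L A \<in> carrier_mat m m" "genp_U A \<in> carrier_mat m m"
    using A by (auto simp: genp_L_def genp_U_def)
  have "A = genp_L A * genp_U A"
  proof (rule eq_matI)
    fix i j assume "i < dim_row (genp_L A * genp_U A)" "j < dim_col (genp_L A * genp_U A)"
    then have ij: "i < m" "j < m" using dims by auto
    have "(genp_L A * genp_U A) $$ (i, j) = (\<Sum>l < m. genp_L A $$ (i, l) * genp_U A $$ (l, j))"
      using dims ij by (auto simp: scalar_prod_def atLeast0LessThan intro!: sum.cong)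
    also have "\<dots> = (\<Sum>l < Suc i. genp_L A $$ (i, l) * genp_U A $$ (l, j))"
      using ij A by (intro sum.mono_neutral_right) (auto simp: genp_L_def)
    also have "\<dots> = (\<Sum>l < Suc i. genp_L A $$ (i, l) * genp_iter A l $$ (l, j))"
      using ij by (intro sum.cong) (auto simp: U)
    also have "\<dots> = A $$ (i, j)"
      using genp_iter_sum[OF A ij, of i] ij A by (simp add: genp_L_def)
    finally show "A $$ (i, j) = (genp_L A * genp_U A) $$ (i, j)" ..
  qed (use A dims in auto)
  moreover have "upper_triangular (genp_U A)"
    using dims genp_iter_zero[OF A ok] A by (auto simp: genp_U_def)
  ultimately show ?thesis
    using dims A by (auto simp: lu_factorization_def genp_L_def)
qed

end

theory Submission
  imports Defs
begin

text \<open>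
  A butterfly matrix is a Kronecker product of rotations, and the LU factors of a Kronecker product
  are the Kronecker products of the LU factors. After interchanging the two rows of every
  rotation with \<open>\<bar>sin \<theta>\<bar> > \<bar>cos \<theta>\<bar>\<close>, all entries of \<open>L\<close> below the diagonal are smaller than 1 in
  magnitude and the rows of \<open>U\<close> are dominated by their diagonal entries: the pivot of every column is
  unique, so partial pivoting must produce this factorization from any order of the rows, and rook
  pivoting never leaves the first candidate. The norms are multiplicative over Kronecker products,
  so the growth factors are products of \<open>2 \<times> 2\<close> expressions in \<open>\<bar>tan \<theta>\<^sub>j\<bar>\<close>, respectively
  \<open>min \<bar>tan \<theta>\<^sub>j\<bar> \<bar>cot \<theta>\<^sub>j\<bar>\<close>, whose laws are those of \<open>\<bar>X\<^sub>j\<bar>\<close> and of \<open>\<bar>X\<^sub>j\<bar>\<close> given \<open>\<bar>X\<^sub>j\<bar> \<le> 1\<close>. Only the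
  intermediate matrices of the elimination are not Kronecker products and need a bound of their own.

  Minimality: if an orthogonal \<open>A = L U\<close> has order \<open>m\<close>, then \<open>U\<^sub>m\<^sub>m A\<^sub>m\<^sub>m = 1\<close>, so the last pivot is at
  least \<open>1 / \<parallel>A\<parallel>\<^sub>m\<^sub>a\<^sub>x\<close>, and the growth factor is at least \<open>1 / \<parallel>A\<parallel>\<^sub>m\<^sub>a\<^sub>x\<^sup>2\<close>, which partial pivoting attains.
\<close>

subsection \<open>LU factors and pivoting\<close>

text \<open>The intermediate matrices have an explicit form: entry (i, j) of the k-th iterate is the
  tail of the sum of L_il U_lj over l that starts at \<open>min i k\<close>. Such tails do not
  factor over a Kronecker product, because the cut falls inside one half of the index range; the
  other half then contributes nothing or a full sum, which is built from an entry of an orthogonal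
  matrix. With a_j the leading entry of block j, this leads to the bound \<Prod> 1 / |a_j|, and the
  last pivot attains it. Since 1 / a_j^2 = 1 + t_j^2, one formula serves all strategies.

  On the probability side, two foldings of the circle bring |tan| to (0, pi / 2), where substitution
  by arctan produces the density of |X_j|. A third folding, about pi / 4, exchanges x with 1 / x and
  doubles the mass on (0, 1); conditioning on an event of probability 1 / 2 does the same. The
  random matrix is known only through its law, and the permutations are arbitrary functions of
  \<omega>, so the growth factors are first identified almost surely with a measurable function of
  the matrix.\<close>

locale lu_factors =
  fixes m :: nat and L U :: "real mat"
  assumes L_carrier: "L \<in> carrier_mat m m" and U_carrier: "U \<in> carrier_mat m m"
    and L_diag: "i < m \<Longrightarrow> L $$ (i, i) = 1"
    and L_lower: "i < j \<Longrightarrow> j < m \<Longrightarrow> L $$ (i, j) = 0"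
    and U_upper: "j < i \<Longrightarrow> i < m \<Longrightarrow> U $$ (i, j) = 0"
    and U_diag: "i < m \<Longrightarrow> U $$ (i, i) \<noteq> 0"
begin

lemma LU_carrier: "L * U \<in> carrier_mat m m"
  using L_carrier U_carrier by auto

lemma LU_index: "i < m \<Longrightarrow> j < m \<Longrightarrow> (L * U) $$ (i, j) = (\<Sum>l<m. L $$ (i, l) * U $$ (l, j))"
  using L_carrier U_carrier by (auto simp: scalar_prod_def atLeast0LessThan intro!: sum.cong)

lemma LU_tail_row:
  assumes "i < m" "j < m"
  shows "(\<Sum>l\<in>{i..<m}. L $$ (i, l) * U $$ (l, j)) = U $$ (i, j)"
proof -
  have "(\<Sum>l\<in>{i..<m}. L $$ (i, l) * U $$ (l, j)) = (\<Sum>l\<in>{i}. L $$ (i, l) * U $$ (l, j))"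
    using assms by (intro sum.mono_neutral_right) (auto simp: L_lower)
  then show ?thesis using assms by (simp add: L_diag)
qed

lemma LU_tail_col:
  assumes "i < m" "k < m"
  shows "(\<Sum>l\<in>{k..<m}. L $$ (i, l) * U $$ (l, k)) = L $$ (i, k) * U $$ (k, k)"
proof -
  have "(\<Sum>l\<in>{k..<m}. L $$ (i, l) * U $$ (l, k)) = (\<Sum>l\<in>{k}. L $$ (i, l) * U $$ (l, k))"
    using assms by (intro sum.mono_neutral_right) (auto simp: U_upper)
  then show ?thesis by simp
qed

text \<open>Each step removes one rank-one term of the expansion of \<open>L * U\<close> from the
  rows below the pivot. Row i is frozen once it becomes the pivot row, so among the first k steps
  exactly \<open>min i k\<close> act on it.\<close>

lemma genp_iter_LU:
  assumes "i < m" "j < m" "k \<le> m"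
  shows "genp_iter (L * U) k $$ (i, j) = (\<Sum>l\<in>{min i k..<m}. L $$ (i, l) * U $$ (l, j))"
  using assms
proof (induction k arbitrary: i j)
  case 0
  then show ?case by (simp add: LU_index atLeast0LessThan)
next
  case (Suc k)
  have k: "k < m" using Suc.prems by simp
  show ?case
  proof (cases "k < i")
    case False
    then show ?thesis using Suc L_carrier U_carrier by (simp add: elim_step_def min_def)
  next
    case True
    let ?G = "genp_iter (L * U) k"
    have e: "?G $$ (i, j) = (\<Sum>l\<in>{k..<m}. L $$ (i, l) * U $$ (l, j))"
      "?G $$ (i, k) = L $$ (i, k) * U $$ (k, k)" "?G $$ (k, k) = U $$ (k, k)"
      "?G $$ (k, j) = U $$ (k, j)"
      using Suc True k LU_tail_row[OF k] LU_tail_col[OF _ k] by (auto simp: min_def)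
    \<comment> \<open>The nonzero pivot cancels, so the multiplier is \<open>L $$ (i, k)\<close> and
      the step subtracts exactly the summand l = k.\<close>
    have "genp_iter (L * U) (Suc k) $$ (i, j) = ?G $$ (i, j) - L $$ (i, k) * U $$ (k, j)"
      using True Suc.prems k L_carrier U_carrier U_diag[OF k] by (simp add: elim_step_def e(2-4))
    also have "\<dots> = (\<Sum>l\<in>{Suc k..<m}. L $$ (i, l) * U $$ (l, j))"
      unfolding e(1) using k by (simp add: sum.atLeast_Suc_lessThan)
    finally show ?thesis using True by (simp add: min_absorb2)
  qed
qed

lemma genp_iter_LU_upper:
  "i < m \<Longrightarrow> j < m \<Longrightarrow> k \<le> m \<Longrightarrow> i \<le> k \<Longrightarrow> genp_iter (L * U) k $$ (i, j) = U $$ (i, j)"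
  by (simp add: genp_iter_LU LU_tail_row min_def)

lemma genp_iter_LU_col:
  "i < m \<Longrightarrow> k < m \<Longrightarrow> k \<le> i \<Longrightarrow> genp_iter (L * U) k $$ (i, k) = L $$ (i, k) * U $$ (k, k)"
  by (simp add: genp_iter_LU LU_tail_col min_def)

lemma genp_ok_LU: "genp_ok (L * U)"
  using L_carrier U_diag by (auto simp: genp_ok_def genp_iter_LU_upper)

text \<open>Uniqueness of the factorization: elimination returns whatever triangular pair the matrix
  was built from. Factors therefore only have to be exhibited.\<close>

lemma genp_L_LU: "genp_L (L * U) = L"
  using L_carrier U_carrier
  by (intro eq_matI) (auto simp: genp_L_def L_diag L_lower genp_iter_LU_col genp_iter_LU_upper U_diag)

lemma genp_U_LU: "genp_U (L * U) = U"
proof (rule eq_matI)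
  fix i j assume "i < dim_row U" "j < dim_col U"
  then show "genp_U (L * U) $$ (i, j) = U $$ (i, j)"
    using L_carrier U_carrier by (simp add: genp_U_def genp_iter_LU_upper)
qed (use L_carrier U_carrier in \<open>auto simp: genp_U_def\<close>)

lemma lu_factorization_LU: "lu_factorization (L * U) L U"
  using genp_ok_imp_lu_factorization[OF LU_carrier genp_ok_LU] by (simp add: genp_L_LU genp_U_LU)

end

section \<open>Permutation matrices\<close>

definition perm_mat :: "nat \<Rightarrow> (nat \<Rightarrow> nat) \<Rightarrow> real mat" where
  "perm_mat m \<pi> = mat m m (\<lambda>(i, j). if j = \<pi> i then 1 else 0)"

lemma perm_mat_carrier [simp]: "perm_mat m \<pi> \<in> carrier_mat m m"
  "dim_row (perm_mat m \<pi>) = m" "dim_col (perm_mat m \<pi>) = m"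
  by (auto simp: perm_mat_def)

lemma perm_mat_index: "i < m \<Longrightarrow> j < m \<Longrightarrow> perm_mat m \<pi> $$ (i, j) = (if j = \<pi> i then 1 else 0)"
  by (simp add: perm_mat_def)

lemma permutation_mat_perm_mat: "\<pi> permutes {..<m} \<Longrightarrow> permutation_mat m (perm_mat m \<pi>)"
  by (auto simp: permutation_mat_def perm_mat_def)

lemma permutation_matE:
  assumes "permutation_mat m P"
  obtains \<pi> where "\<pi> permutes {..<m}" "P = perm_mat m \<pi>"
  using assms by (auto simp: permutation_mat_def perm_mat_def)

lemma permutes_less: "\<pi> permutes {..<m} \<Longrightarrow> i < m \<Longrightarrow> \<pi> i < (m::nat)"
  using permutes_in_image[of \<pi> "{..<m}" i] by simp

lemma perm_mat_mult:
  assumes "\<pi> permutes {..<m}" "A \<in> carrier_mat m c"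
  shows "perm_mat m \<pi> * A = mat m c (\<lambda>(i, j). A $$ (\<pi> i, j))"
proof (rule eq_matI)
  fix i j assume "i < dim_row (mat m c (\<lambda>(i, j). A $$ (\<pi> i, j)))"
    "j < dim_col (mat m c (\<lambda>(i, j). A $$ (\<pi> i, j)))"
  then have ij: "i < m" "j < c" by auto
  have "(perm_mat m \<pi> * A) $$ (i, j) = (\<Sum>l<m. (if l = \<pi> i then 1 else 0) * A $$ (l, j))"
    using ij assms by (auto simp: scalar_prod_def perm_mat_index atLeast0LessThan intro!: sum.cong)
  also have "\<dots> = (\<Sum>l<m. if l = \<pi> i then A $$ (l, j) else 0)"
    by (intro sum.cong) auto
  also have "\<dots> = A $$ (\<pi> i, j)"
    using permutes_less[OF assms(1) ij(1)] by simp
  finally show "(perm_mat m \<pi> * A) $$ (i, j) = mat m c (\<lambda>(i, j). A $$ (\<pi> i, j)) $$ (i, j)"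
    using ij by simp
qed (use assms in auto)

lemma perm_mat_id: "perm_mat m id = 1\<^sub>m m"
  by (rule eq_matI) (auto simp: perm_mat_index)

lemma swaprows_perm_mat:
  assumes "k < m" "p < m"
  shows "swaprows k p (perm_mat m \<sigma>) = perm_mat m (\<sigma> \<circ> Transposition.transpose k p)"
  using assms by (intro eq_matI) (auto simp: perm_mat_index transpose_def)

section \<open>Partial pivoting on a row permutation of \<open>L * U\<close>\<close>

locale pivoted_lu = lu_factors +
  fixes \<rho> :: "nat \<Rightarrow> nat" and B :: "real mat"
  assumes L_less: "j < i \<Longrightarrow> i < m \<Longrightarrow> \<bar>L $$ (i, j)\<bar> < 1"
    and \<rho>: "\<rho> permutes {..<m}"
    and B_def: "B = mat m m (\<lambda>(i, j). (L * U) $$ (\<rho> i, j))"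
begin

lemma B_dim: "dim_row B = m" "dim_col B = m"
  by (auto simp: B_def)

text \<open>Row i of the working matrix started as row \<open>\<sigma> i\<close> of
  \<open>B\<close>, that is, as row \<open>\<rho> (\<sigma> i)\<close> of \<open>L * U\<close>. A
  run with swaps is thus GENP on \<open>L * U\<close> with displaced rows, the rows of index less
  than k being in their final place.\<close>

definition run_inv :: "nat \<Rightarrow> real mat \<Rightarrow> real mat \<Rightarrow> (nat \<Rightarrow> nat) \<Rightarrow> bool" where
  "run_inv k P C \<sigma> \<longleftrightarrow> \<sigma> permutes {..<m} \<and> P = perm_mat m \<sigma> \<and> (\<forall>i<k. \<rho> (\<sigma> i) = i) \<and>
     C = mat m m (\<lambda>(i, j). genp_iter (L * U) k $$ (\<rho> (\<sigma> i), j))"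

text \<open>The composition of \<rho> and \<sigma> is a bijection that fixes all indices below k, so
  it maps the remaining ones among themselves.\<close>

lemma run_inv_ge:
  assumes "run_inv k P C \<sigma>" "k \<le> i" "i < m"
  shows "k \<le> \<rho> (\<sigma> i)" "\<rho> (\<sigma> i) < m"
proof -
  have p: "(\<rho> \<circ> \<sigma>) permutes {..<m}"
    using assms \<rho> by (auto simp: run_inv_def intro: permutes_compose)
  show "\<rho> (\<sigma> i) < m" using permutes_less[OF p assms(3)] by simp
  show "k \<le> \<rho> (\<sigma> i)"
  proof (rule ccontr)
    assume less: "\<not> ?thesis"
    then have "(\<rho> \<circ> \<sigma>) (\<rho> (\<sigma> i)) = (\<rho> \<circ> \<sigma>) i"
      using assms by (auto simp: run_inv_def)
    then have "\<rho> (\<sigma> i) = i" using permutes_inj[OF p] by (metis injD)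
    then show False using less assms by simp
  qed
qed

lemma run_inv_pivot:
  assumes I: "run_inv k P C \<sigma>" and k: "k < m"
  obtains i where "k \<le> i" "i < m" "\<rho> (\<sigma> i) = k"
proof -
  have p: "(\<rho> \<circ> \<sigma>) permutes {..<m}"
    using I \<rho> by (auto simp: run_inv_def intro: permutes_compose)
  obtain i where i: "i < m" "\<rho> (\<sigma> i) = k"
    using permutes_image[OF p] k by (metis (no_types, lifting) comp_apply imageE lessThan_iff)
  moreover have "k \<le> i"
  proof (rule ccontr)
    assume "\<not> k \<le> i"
    then have "\<rho> (\<sigma> i) = i" using I by (auto simp: run_inv_def)
    then show False using i \<open>\<not> k \<le> i\<close> by simp
  qed
  ultimately show ?thesis using that by blast
qed

text \<open>In the active block, column k is \<open>U $$ (k, k)\<close> times column k of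
  \<open>L\<close>, up to the order of the rows. \<open>L\<close> has 1 on the diagonal and strictly
  smaller entries below, so the row that stems from row k of \<open>L * U\<close> is the only
  maximum and the run has no choice.\<close>

lemma run_inv_col_max:
  assumes I: "run_inv k P C \<sigma>" and k: "k < m"
  shows "col_max C k p k \<longleftrightarrow> k \<le> p \<and> p < m \<and> \<rho> (\<sigma> p) = k"
proof -
  have C: "\<bar>C $$ (i, k)\<bar> = \<bar>L $$ (\<rho> (\<sigma> i), k)\<bar> * \<bar>U $$ (k, k)\<bar>" if "k \<le> i" "i < m" for i
    using that I k run_inv_ge[OF I that] by (simp add: run_inv_def genp_iter_LU_col abs_mult)
  have d: "dim_row C = m" "dim_col C = m" using I by (auto simp: run_inv_def)
  have L1: "\<bar>L $$ (i, k)\<bar> \<le> 1" if "k \<le> i" "i < m" for i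
    using that L_less[of k i] L_diag[of i] by (cases "i = k") auto
  have U: "\<bar>U $$ (k, k)\<bar> > 0" using U_diag[OF k] by simp
  show ?thesis
  proof
    assume c: "col_max C k p k"
    then have kp: "k \<le> p" "p < m" using d by (auto simp: col_max_def)
    obtain i where i: "k \<le> i" "i < m" "\<rho> (\<sigma> i) = k" using run_inv_pivot[OF I k] .
    then have "\<bar>C $$ (i, k)\<bar> \<le> \<bar>C $$ (p, k)\<bar>" using c i d by (auto simp: col_max_def)
    then have "1 * \<bar>U $$ (k, k)\<bar> \<le> \<bar>L $$ (\<rho> (\<sigma> p), k)\<bar> * \<bar>U $$ (k, k)\<bar>"
      using C[OF i(1,2)] C[OF kp] i k L_diag[OF k] by simp
    then have "1 \<le> \<bar>L $$ (\<rho> (\<sigma> p), k)\<bar>" using U by (simp add: mult_le_cancel_right)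
    then have "\<not> k < \<rho> (\<sigma> p)" using L_less[of k "\<rho> (\<sigma> p)"] run_inv_ge[OF I kp] by linarith
    then show "k \<le> p \<and> p < m \<and> \<rho> (\<sigma> p) = k" using kp run_inv_ge(1)[OF I kp] by linarith
  next
    assume a: "k \<le> p \<and> p < m \<and> \<rho> (\<sigma> p) = k"
    have "\<bar>C $$ (i, k)\<bar> \<le> \<bar>C $$ (p, k)\<bar>" if "k \<le> i" "i < m" for i
      using C[OF that] C[of p] a L_diag[OF k] L1 run_inv_ge[OF I that]
        mult_right_mono[OF L1[of "\<rho> (\<sigma> i)"], of "\<bar>U $$ (k, k)\<bar>"] by simp
    then show "col_max C k p k" using a d k by (auto simp: col_max_def)
  qed
qed

lemma run_inv_step:
  assumes I: "run_inv k P C \<sigma>" and k: "k < m" and c: "col_max C k p k"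
  shows "run_inv (Suc k) (swaprows k p P) (elim_step k (swaprows k p C)) (\<sigma> \<circ> Transposition.transpose k p)"
proof -
  let ?s = "\<sigma> \<circ> Transposition.transpose k p"
  have p: "k \<le> p" "p < m" "\<rho> (\<sigma> p) = k" using run_inv_col_max[OF I k] c by auto
  have sp: "?s permutes {..<m}"
    using I k p by (auto simp: run_inv_def intro!: permutes_compose permutes_swap_id)
  have fix_less: "\<rho> (?s i) = i" if "i < Suc k" for i
    using that I p by (auto simp: run_inv_def transpose_def less_Suc_eq)
  have C': "swaprows k p C = mat m m (\<lambda>(i, j). genp_iter (L * U) k $$ (\<rho> (?s i), j))"
    using I k p by (intro eq_matI) (auto simp: run_inv_def transpose_def)
  \<comment> \<open>Elimination acts on the rows numbered above k. It commutes with the displacement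
    of rows because the displacement preserves this set.\<close>
  have ge: "k < \<rho> (?s i) \<longleftrightarrow> k < i" "\<rho> (?s i) < m" if "i < m" for i
  proof -
    have q: "(\<rho> \<circ> ?s) permutes {..<m}" using sp \<rho> by (auto intro: permutes_compose)
    show "\<rho> (?s i) < m" using permutes_less[OF q that] by simp
    show "k < \<rho> (?s i) \<longleftrightarrow> k < i"
    proof
      assume "k < i"
      show "k < \<rho> (?s i)"
      proof (rule ccontr)
        assume "\<not> ?thesis"
        then have "(\<rho> \<circ> ?s) (\<rho> (?s i)) = (\<rho> \<circ> ?s) i" using fix_less[of "\<rho> (?s i)"] by simp
        then have "\<rho> (?s i) = i" using permutes_inj[OF q] by (metis injD)
        then show False using \<open>\<not> k < \<rho> (?s i)\<close> \<open>k < i\<close> by simp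
      qed
    next
      assume "k < \<rho> (?s i)"
      then show "k < i" using fix_less[of i] by (cases "k < i") auto
    qed
  qed
  have "elim_step k (swaprows k p C) = mat m m (\<lambda>(i, j). genp_iter (L * U) (Suc k) $$ (\<rho> (?s i), j))"
    unfolding C' using L_carrier U_carrier k ge fix_less[of k]
    by (intro eq_matI) (auto simp: elim_step_def)
  moreover have "swaprows k p P = perm_mat m ?s"
    using I k p by (simp add: run_inv_def swaprows_perm_mat)
  ultimately show ?thesis using sp fix_less by (auto simp: run_inv_def)
qed

lemma run_inv_init: "run_inv 0 (1\<^sub>m (dim_row B)) B id"
  by (auto simp: run_inv_def perm_mat_id[symmetric] B_def permutes_id)

lemma gepp_run_inv:
  assumes "gepp_run B k P C" "k \<le> m"
  shows "\<exists>\<sigma>. run_inv k P C \<sigma>"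
  using assms
proof (induction rule: gepp_run.induct)
  case init
  then show ?case using run_inv_init by blast
next
  case (step k P C p)
  then show ?case using run_inv_step[of k P C _ p] by (metis Suc_leD Suc_le_lessD)
qed

text \<open>Row k of \<open>L * U\<close> always lies in the active block at step k, so a run never
  gets stuck; this keeps statements about all runs from being vacuous.\<close>

lemma gepp_run_exists: "k \<le> m \<Longrightarrow> \<exists>P C. gepp_run B k P C"
proof (induction k)
  case 0
  then show ?case using gepp_run.init by blast
next
  case (Suc k)
  then obtain P C where r: "gepp_run B k P C" by auto
  obtain \<sigma> where I: "run_inv k P C \<sigma>" using gepp_run_inv[OF r] Suc.prems by auto
  have k: "k < m" using Suc.prems by simp
  obtain i where i: "k \<le> i" "i < m" "\<rho> (\<sigma> i) = k" using run_inv_pivot[OF I k] .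
  then have "col_max C k i k" using run_inv_col_max[OF I k] i by simp
  then show ?case using gepp_run.step[OF r] by blast
qed

text \<open>After m steps the invariant reads \<open>\<rho> (\<sigma> i) = i\<close> for every row,
  which pins \<sigma> to the inverse of \<rho>. The converse follows from the existence of a
  run.\<close>

lemma gepp_iff: "gepp B P \<longleftrightarrow> P = perm_mat m (Hilbert_Choice.inv \<rho>)"
proof -
  have "P = perm_mat m (Hilbert_Choice.inv \<rho>)" if P: "gepp B P" for P
  proof -
    obtain \<sigma> where I: "run_inv m P (mat m m (\<lambda>(i, j). genp_iter (L * U) m $$ (\<rho> (\<sigma> i), j))) \<sigma>"
      using P B_dim gepp_run_inv[of m P] by (auto simp: gepp_def run_inv_def)
    have "\<sigma> i = Hilbert_Choice.inv \<rho> i" if "i < m" for i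
      using I that permutes_inv_eq[OF \<rho>, of i "\<sigma> i"] by (auto simp: run_inv_def)
    then show ?thesis using I by (intro eq_matI) (auto simp: run_inv_def perm_mat_index)
  qed
  then show ?thesis using gepp_run_exists[of m] B_dim by (auto simp: gepp_def)
qed

lemma perm_mat_inv_mult: "perm_mat m (Hilbert_Choice.inv \<rho>) * B = L * U"
proof -
  have "perm_mat m (Hilbert_Choice.inv \<rho>) * B = mat m m (\<lambda>(i, j). B $$ (Hilbert_Choice.inv \<rho> i, j))"
    by (rule perm_mat_mult) (auto simp: B_def intro: permutes_inv[OF \<rho>])
  also have "\<dots> = L * U"
    using L_carrier U_carrier permutes_less[OF permutes_inv[OF \<rho>]]
    by (intro eq_matI) (auto simp: B_def permutes_inverses[OF \<rho>] simp del: index_mult_mat(1))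
  finally show ?thesis .
qed

end

lemma swapcols_same: "swapcols k k A = A"
  by (intro eq_matI) auto

section \<open>Rook pivoting\<close>

locale rook_lu = pivoted_lu +
  assumes U_le: "i < m \<Longrightarrow> j < m \<Longrightarrow> \<bar>U $$ (i, j)\<bar> \<le> \<bar>U $$ (i, i)\<bar>"
begin

text \<open>The row of the first candidate is row k of \<open>U\<close>, which is dominated by its
  diagonal entry. The candidate is maximal in its row and column, and the search ends there even
  when the row has several maxima.\<close>

lemma rook_pivot_iff:
  assumes I: "run_inv k P C \<sigma>" and k: "k < m"
  shows "rook_pivot C k p q \<longleftrightarrow> col_max C k p k \<and> q = k"
proof -
  have d: "dim_row C = m" "dim_col C = m" using I by (auto simp: run_inv_def)
  have rm: "row_max C k p k" if "col_max C k p k" for p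
  proof -
    have p: "k \<le> p" "p < m" "\<rho> (\<sigma> p) = k" using run_inv_col_max[OF I k] that by auto
    have "C $$ (p, j) = U $$ (k, j)" if "j < m" for j
      using that I p k by (simp add: run_inv_def genp_iter_LU_upper)
    then show ?thesis using p k d U_le[OF k] by (auto simp: row_max_def)
  qed
  have "col_max C k p k \<and> d \<and> q = k" if "rook_cand C k d p q" for d p q
    using that by induction (auto dest: rm)
  then show ?thesis using rm by (auto simp: rook_pivot_def intro: rook_cand.start)
qed

lemma gerp_run_imp:
  assumes "gerp_run B k P Q C" "k \<le> m"
  shows "gepp_run B k P C \<and> Q = 1\<^sub>m m"
  using assms
proof (induction rule: gerp_run.induct)
  case init
  then show ?case using gepp_run.init[of B] by (simp add: B_dim)
next
  case (step k P Q C p q)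
  then have r: "gepp_run B k P C" and Q: "Q = 1\<^sub>m m" and k: "k < m" by auto
  obtain \<sigma> where I: "run_inv k P C \<sigma>" using gepp_run_inv[OF r] k by auto
  have c: "col_max C k p k" "q = k" using rook_pivot_iff[OF I k] step by auto
  then show ?case using gepp_run.step[OF r c(1)] Q by (simp add: swapcols_same)
qed

lemma gepp_run_imp:
  assumes "gepp_run B k P C" "k \<le> m"
  shows "gerp_run B k P (1\<^sub>m m) C"
  using assms
proof (induction rule: gepp_run.induct)
  case init
  then show ?case using gerp_run.init[of B] by (simp add: B_dim)
next
  case (step k P C p)
  then have k: "k < m" and g: "gerp_run B k P (1\<^sub>m m) C" by auto
  obtain \<sigma> where I: "run_inv k P C \<sigma>" using gepp_run_inv[OF step.hyps(1)] k by auto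
  have "rook_pivot C k p k" using rook_pivot_iff[OF I k] step.hyps by auto
  then show ?case using gerp_run.step[OF g, of p k] by (simp add: swapcols_same)
qed

lemma gerp_iff: "gerp B P Q \<longleftrightarrow> gepp B P \<and> Q = 1\<^sub>m m"
  unfolding gerp_def gepp_def B_dim using gerp_run_imp[of m] gepp_run_imp[of m] by blast

end

subsection \<open>Kronecker products\<close>

lemma sum_lessThan_mult:
  fixes f :: "nat \<Rightarrow> 'a::comm_monoid_add"
  shows "(\<Sum>l<p * q. f l) = (\<Sum>x<p. \<Sum>y<q. f (x * q + y))"
proof -
  have "(\<Sum>l<p * q. f l) = (\<Sum>x<p. sum f {x * q..<x * q + q})"
    by (rule sum.nat_group[symmetric])
  also have "\<dots> = (\<Sum>x<p. \<Sum>y<q. f (x * q + y))"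
  proof (rule sum.cong[OF refl])
    fix x
    show "sum f {x * q..<x * q + q} = (\<Sum>y<q. f (x * q + y))"
      using sum.shift_bounds_nat_ivl[of f 0 "x * q" q] by (simp add: atLeast0LessThan add.commute)
  qed
  finally show ?thesis .
qed

lemma div_less_mult: "i < p * q \<Longrightarrow> i div q < (p::nat)"
  by (simp add: less_mult_imp_div_less)

lemma mod_less_mult: "i < p * q \<Longrightarrow> i mod q < (q::nat)"
  by (cases "q = 0") auto

lemma mult_add_less:
  assumes "x < p" "y < q"
  shows "x * q + y < p * (q::nat)"
proof -
  have "x * q + y < Suc x * q" using assms by simp
  also have "\<dots> \<le> p * q" using assms by (intro mult_right_mono) auto
  finally show ?thesis .
qed

text \<open>Quotient and remainder order the indices lexicographically; this is what carries
  triangular shape over to a Kronecker product.\<close>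

lemma div_mod_less:
  assumes "i < (j::nat)"
  shows "i div q < j div q \<or> i div q = j div q \<and> i mod q < j mod q"
proof -
  have "i div q \<le> j div q" using assms by (simp add: div_le_mono)
  moreover have "i mod q < j mod q" if "i div q = j div q"
    using assms that by (metis div_mult_mod_eq nat_add_left_cancel_less)
  ultimately show ?thesis by linarith
qed

lemma kron_carrier: "A \<in> carrier_mat p p \<Longrightarrow> B \<in> carrier_mat q q \<Longrightarrow> kron A B \<in> carrier_mat (p * q) (p * q)"
  by (auto simp: kron_def)

lemma kron_index:
  assumes "A \<in> carrier_mat p p" "B \<in> carrier_mat q q" "i < p * q" "j < p * q"
  shows "kron A B $$ (i, j) = A $$ (i div q, j div q) * B $$ (i mod q, j mod q)"
  using assms index_kron[of i A B j] by auto

lemma mult_index: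
  assumes "A \<in> carrier_mat m m" "B \<in> carrier_mat m m" "i < m" "j < m"
  shows "(A * B) $$ (i, j) = (\<Sum>l<m. A $$ (i, l) * B $$ (l, j))"
  using assms by (auto simp: scalar_prod_def atLeast0LessThan intro!: sum.cong)

text \<open>The mixed-product rule: the summation index splits into quotient and remainder by q, and
  the resulting double sum factors.\<close>

lemma kron_mult:
  assumes A: "A \<in> carrier_mat p p" "C \<in> carrier_mat p p" and B: "B \<in> carrier_mat q q" "D \<in> carrier_mat q q"
  shows "kron (A * C) (B * D) = kron A B * kron C D"
proof (rule eq_matI)
  fix i j assume "i < dim_row (kron A B * kron C D)" "j < dim_col (kron A B * kron C D)"
  then have ij: "i < p * q" "j < p * q" using A B by auto
  note lt = div_less_mult[OF ij(1)] div_less_mult[OF ij(2)] mod_less_mult[OF ij(1)] mod_less_mult[OF ij(2)]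
  note xy = mult_add_less[of _ p _ q]
  have "(kron A B * kron C D) $$ (i, j) = (\<Sum>l<p * q. kron A B $$ (i, l) * kron C D $$ (l, j))"
    using ij by (intro mult_index kron_carrier A B)
  also have "\<dots> = (\<Sum>x<p. \<Sum>y<q. kron A B $$ (i, x * q + y) * kron C D $$ (x * q + y, j))"
    by (rule sum_lessThan_mult)
  also have "\<dots> = (\<Sum>x<p. \<Sum>y<q. (A $$ (i div q, x) * C $$ (x, j div q)) * (B $$ (i mod q, y) * D $$ (y, j mod q)))"
    using ij xy by (intro sum.cong refl) (simp add: kron_index[OF A(1) B(1)] kron_index[OF A(2) B(2)])
  also have "\<dots> = (A * C) $$ (i div q, j div q) * (B * D) $$ (i mod q, j mod q)"
    by (simp only: mult_index[OF A lt(1,2)] mult_index[OF B lt(3,4)] sum_product)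
  also have "\<dots> = kron (A * C) (B * D) $$ (i, j)"
    using ij A B by (intro kron_index[symmetric]) auto
  finally show "kron (A * C) (B * D) $$ (i, j) = (kron A B * kron C D) $$ (i, j)" ..
qed (use A B in auto)

lemma kron_abs:
  assumes "A \<in> carrier_mat p p" "B \<in> carrier_mat q q"
  shows "map_mat abs (kron A B) = kron (map_mat abs A) (map_mat abs B)"
proof (rule eq_matI)
  fix i j assume "i < dim_row (kron (map_mat abs A) (map_mat abs B))"
    "j < dim_col (kron (map_mat abs A) (map_mat abs B))"
  then have ij: "i < p * q" "j < p * q" using assms by auto
  then show "map_mat abs (kron A B) $$ (i, j) = kron (map_mat abs A) (map_mat abs B) $$ (i, j)"
    using assms div_less_mult[of i] div_less_mult[of j] mod_less_mult[of i] mod_less_mult[of j]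
    by (auto simp: kron_index[of _ p _ q] abs_mult)
qed (use assms in auto)

section \<open>Norms of Kronecker products\<close>

lemma finite_elements_mat: "finite (elements_mat A)"
  by (simp add: elements_mat_def)

lemma abs_index_le_max_norm:
  "A \<in> carrier_mat r c \<Longrightarrow> i < r \<Longrightarrow> j < c \<Longrightarrow> \<bar>A $$ (i, j)\<bar> \<le> max_norm A"
  unfolding max_norm_def by (intro Max_ge) (auto simp: finite_elements_mat)

lemma max_norm_eqI:
  assumes A: "A \<in> carrier_mat r c" and "\<And>i j. i < r \<Longrightarrow> j < c \<Longrightarrow> \<bar>A $$ (i, j)\<bar> \<le> x"
    and "i < r" "j < c" "\<bar>A $$ (i, j)\<bar> = x"
  shows "max_norm A = x"
  unfolding max_norm_def
proof (rule Max_eqI)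
  show "finite (abs ` elements_mat A)" by (simp add: finite_elements_mat)
  show "y \<le> x" if "y \<in> abs ` elements_mat A" for y
    using that assms by fastforce
  show "x \<in> abs ` elements_mat A" using assms by blast
qed

lemma max_norm_attained:
  assumes "A \<in> carrier_mat r c" "r > 0" "c > 0"
  obtains i j where "i < r" "j < c" "\<bar>A $$ (i, j)\<bar> = max_norm A"
proof -
  have "A $$ (0, 0) \<in> elements_mat A" using assms by blast
  then have "max_norm A \<in> abs ` elements_mat A"
    unfolding max_norm_def by (intro Max_in) (auto simp: finite_elements_mat)
  then show ?thesis using that assms by fastforce
qed

lemma max_norm_nonneg: "A \<in> carrier_mat r c \<Longrightarrow> r > 0 \<Longrightarrow> c > 0 \<Longrightarrow> 0 \<le> max_norm A"
  using abs_index_le_max_norm[of A r c 0 0] by linarith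

lemma max_norm_kron:
  assumes A: "A \<in> carrier_mat p p" "p > 0" and B: "B \<in> carrier_mat q q" "q > 0"
  shows "max_norm (kron A B) = max_norm A * max_norm B"
proof -
  obtain i j where ij: "i < p" "j < p" "\<bar>A $$ (i, j)\<bar> = max_norm A"
    using max_norm_attained A by blast
  obtain k l where kl: "k < q" "l < q" "\<bar>B $$ (k, l)\<bar> = max_norm B"
    using max_norm_attained B by blast
  note xy = mult_add_less[of _ p _ q]
  show ?thesis
  proof (rule max_norm_eqI[OF kron_carrier[OF A(1) B(1)]])
    fix i j assume "i < p * q" "j < p * q"
    then show "\<bar>kron A B $$ (i, j)\<bar> \<le> max_norm A * max_norm B"
      using div_less_mult[of i] div_less_mult[of j] mod_less_mult[of i] mod_less_mult[of j] max_norm_nonneg[OF A(1)] A(2)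
      by (auto simp: kron_index[OF A(1) B(1)] abs_mult intro!: mult_mono abs_index_le_max_norm[OF A(1)] abs_index_le_max_norm[OF B(1)])
  next
    show "i * q + k < p * q" "j * q + l < p * q" using xy ij kl by auto
    then show "\<bar>kron A B $$ (i * q + k, j * q + l)\<bar> = max_norm A * max_norm B"
      using ij kl by (simp add: kron_index[OF A(1) B(1)] abs_mult)
  qed
qed

definition row_sum :: "real mat \<Rightarrow> nat \<Rightarrow> real" where
  "row_sum A i = (\<Sum>j < dim_col A. \<bar>A $$ (i, j)\<bar>)"

lemma inf_norm_row_sum: "inf_norm A = Max (row_sum A ` {..<dim_row A})"
  by (simp add: inf_norm_def row_sum_def)

lemma row_sum_nonneg: "0 \<le> row_sum A i"
  by (simp add: row_sum_def sum_nonneg)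

lemma row_sum_kron:
  assumes A: "A \<in> carrier_mat p p" and B: "B \<in> carrier_mat q q" and i: "i < p * q"
  shows "row_sum (kron A B) i = row_sum A (i div q) * row_sum B (i mod q)"
proof -
  note xy = mult_add_less[of _ p _ q]
  have "row_sum (kron A B) i = (\<Sum>x<p. \<Sum>y<q. \<bar>kron A B $$ (i, x * q + y)\<bar>)"
    using A B by (simp add: row_sum_def sum_lessThan_mult)
  also have "\<dots> = (\<Sum>x<p. \<Sum>y<q. \<bar>A $$ (i div q, x)\<bar> * \<bar>B $$ (i mod q, y)\<bar>)"
    using xy i by (intro sum.cong refl) (simp add: kron_index[OF A B] abs_mult)
  also have "\<dots> = row_sum A (i div q) * row_sum B (i mod q)"
    using A B by (simp add: row_sum_def sum_product)
  finally show ?thesis .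
qed

lemma inf_norm_eqI:
  assumes "A \<in> carrier_mat r c" "\<And>i. i < r \<Longrightarrow> row_sum A i \<le> x" "i < r" "row_sum A i = x"
  shows "inf_norm A = x"
  unfolding inf_norm_row_sum using assms by (intro Max_eqI) auto

lemma row_sum_le_inf_norm: "A \<in> carrier_mat r c \<Longrightarrow> i < r \<Longrightarrow> row_sum A i \<le> inf_norm A"
  unfolding inf_norm_row_sum by (intro Max_ge) auto

lemma inf_norm_attained:
  assumes "A \<in> carrier_mat r c" "r > 0"
  obtains i where "i < r" "row_sum A i = inf_norm A"
proof -
  have "inf_norm A \<in> row_sum A ` {..<dim_row A}"
    unfolding inf_norm_row_sum using assms by (intro Max_in) auto
  then show ?thesis using that assms by auto
qed

text \<open>Absolute row sums factor, and the quotient and the remainder of a row number range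
  independently, so the maxima multiply.\<close>

lemma inf_norm_kron:
  assumes A: "A \<in> carrier_mat p p" "p > 0" and B: "B \<in> carrier_mat q q" "q > 0"
  shows "inf_norm (kron A B) = inf_norm A * inf_norm B"
proof -
  obtain i where i: "i < p" "row_sum A i = inf_norm A" using inf_norm_attained A by blast
  obtain k where k: "k < q" "row_sum B k = inf_norm B" using inf_norm_attained B by blast
  show ?thesis
  proof (rule inf_norm_eqI[OF kron_carrier[OF A(1) B(1)]])
    fix l assume "l < p * q"
    then show "row_sum (kron A B) l \<le> inf_norm A * inf_norm B"
      using div_less_mult[of l] mod_less_mult[of l] row_sum_nonneg[of A i] i(2)
      by (auto simp: row_sum_kron[OF A(1) B(1)] row_sum_nonneg
          intro!: mult_mono row_sum_le_inf_norm[OF A(1)] row_sum_le_inf_norm[OF B(1)])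
  next
    show lt: "i * q + k < p * q" using i k by (simp add: mult_add_less)
    show "row_sum (kron A B) (i * q + k) = inf_norm A * inf_norm B"
      using i k by (simp add: row_sum_kron[OF A(1) B(1) lt])
  qed
qed

section \<open>Iterated Kronecker products of 2 by 2 matrices\<close>

primrec kron_prod :: "(nat \<Rightarrow> real mat) \<Rightarrow> nat \<Rightarrow> real mat" where
  "kron_prod F 0 = 1\<^sub>m 1"
| "kron_prod F (Suc n) = kron (F (Suc n)) (kron_prod F n)"

lemma butterfly_kron_prod: "butterfly n \<theta> = kron_prod (\<lambda>j. rotation2 (\<theta> j)) n"
  by (induction n) auto

lemma kron_prod_cong: "(\<And>j. 1 \<le> j \<Longrightarrow> j \<le> n \<Longrightarrow> F j = G j) \<Longrightarrow> kron_prod F n = kron_prod G n"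
  by (induction n) auto

lemma kron_prod_carrier:
  assumes "\<And>j. 1 \<le> j \<Longrightarrow> j \<le> n \<Longrightarrow> F j \<in> carrier_mat 2 2"
  shows "kron_prod F n \<in> carrier_mat (2 ^ n) (2 ^ n)"
  using assms
proof (induction n)
  case (Suc n)
  then show ?case using kron_carrier[of "F (Suc n)" 2 "kron_prod F n" "2 ^ n"] by simp
qed simp

lemma kron_prod_mult:
  assumes "\<And>j. 1 \<le> j \<Longrightarrow> j \<le> n \<Longrightarrow> F j \<in> carrier_mat 2 2" "\<And>j. 1 \<le> j \<Longrightarrow> j \<le> n \<Longrightarrow> G j \<in> carrier_mat 2 2"
  shows "kron_prod (\<lambda>j. F j * G j) n = kron_prod F n * kron_prod G n"
  using assms
proof (induction n)
  case (Suc n)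
  then show ?case
    using kron_mult[of "F (Suc n)" 2 "G (Suc n)" "kron_prod F n" "2 ^ n" "kron_prod G n"]
    by (simp add: kron_prod_carrier)
qed simp

lemma kron_prod_abs:
  assumes "\<And>j. 1 \<le> j \<Longrightarrow> j \<le> n \<Longrightarrow> F j \<in> carrier_mat 2 2"
  shows "map_mat abs (kron_prod F n) = kron_prod (\<lambda>j. map_mat abs (F j)) n"
  using assms
proof (induction n)
  case 0
  show ?case by (rule eq_matI) auto
next
  case (Suc n)
  then show ?case
    using kron_abs[of "F (Suc n)" 2 "kron_prod F n" "2 ^ n"] by (simp add: kron_prod_carrier)
qed

lemma max_norm_kron_prod:
  assumes "\<And>j. 1 \<le> j \<Longrightarrow> j \<le> n \<Longrightarrow> F j \<in> carrier_mat 2 2"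
  shows "max_norm (kron_prod F n) = (\<Prod>j=1..n. max_norm (F j))"
  using assms
proof (induction n)
  case 0
  have "max_norm (1\<^sub>m 1 :: real mat) = 1"
    by (rule max_norm_eqI[where r = 1 and c = 1 and i = 0 and j = 0]) auto
  then show ?case by simp
next
  case (Suc n)
  then show ?case
    using max_norm_kron[of "F (Suc n)" 2 "kron_prod F n" "2 ^ n"] by (simp add: kron_prod_carrier mult.commute)
qed

lemma inf_norm_kron_prod:
  assumes "\<And>j. 1 \<le> j \<Longrightarrow> j \<le> n \<Longrightarrow> F j \<in> carrier_mat 2 2"
  shows "inf_norm (kron_prod F n) = (\<Prod>j=1..n. inf_norm (F j))"
  using assms
proof (induction n)
  case 0
  have "inf_norm (1\<^sub>m 1 :: real mat) = 1"
    by (rule inf_norm_eqI[where r = 1 and c = 1 and i = 0]) (auto simp: row_sum_def)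
  then show ?case by simp
next
  case (Suc n)
  then show ?case
    using inf_norm_kron[of "F (Suc n)" 2 "kron_prod F n" "2 ^ n"] by (simp add: kron_prod_carrier mult.commute)
qed

text \<open>Interchanging the rows of one factor flips one binary digit of the row number;
  independent choices in all factors combine to a single permutation of the rows.\<close>

lemma kron_prod_row_permute:
  assumes F: "\<And>j. 1 \<le> j \<Longrightarrow> j \<le> n \<Longrightarrow> F j \<in> carrier_mat 2 2" "\<And>j. 1 \<le> j \<Longrightarrow> j \<le> n \<Longrightarrow> G j \<in> carrier_mat 2 2"
    and \<sigma>: "\<And>j. 1 \<le> j \<Longrightarrow> j \<le> n \<Longrightarrow> \<sigma> j permutes {..<2}"
    and "\<And>j p q. 1 \<le> j \<Longrightarrow> j \<le> n \<Longrightarrow> p < 2 \<Longrightarrow> q < 2 \<Longrightarrow> F j $$ (p, q) = G j $$ (\<sigma> j p, q)"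
  shows "\<exists>\<rho>. \<rho> permutes {..<2 ^ n} \<and> kron_prod F n = mat (2 ^ n) (2 ^ n) (\<lambda>(i, j). kron_prod G n $$ (\<rho> i, j))"
  using assms
proof (induction n)
  case 0
  show ?case by (intro exI[of _ id] conjI permutes_id eq_matI) auto
next
  case (Suc n)
  let ?q = "2 ^ n :: nat"
  obtain \<rho> where \<rho>: "\<rho> permutes {..<?q}"
    and eq: "kron_prod F n = mat ?q ?q (\<lambda>(i, j). kron_prod G n $$ (\<rho> i, j))"
    using Suc by force
  have s: "\<sigma> (Suc n) permutes {..<2}" using Suc.prems by simp
  \<comment> \<open>The leading digit and the remainder are moved separately. Off the index range
    the map has to be the identity, as \<open>permutes\<close> demands.\<close>
  define \<tau> where "\<tau> = (\<lambda>i. if i < 2 * ?q then \<sigma> (Suc n) (i div ?q) * ?q + \<rho> (i mod ?q) else i)"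
  have lt: "\<sigma> (Suc n) (i div ?q) < 2" "\<rho> (i mod ?q) < ?q" if "i < 2 * ?q" for i
    using permutes_less[OF s div_less_mult[OF that]] permutes_less[OF \<rho> mod_less_mult[OF that]] by auto
  have \<tau>_div: "\<tau> i div ?q = \<sigma> (Suc n) (i div ?q)" "\<tau> i mod ?q = \<rho> (i mod ?q)" if "i < 2 * ?q" for i
    using that lt[OF that] by (auto simp: \<tau>_def)
  have \<tau>_less: "\<tau> i < 2 * ?q" if "i < 2 * ?q" for i
    using mult_add_less[OF lt[OF that]] that by (simp add: \<tau>_def)
  have inj: "inj_on \<tau> {..<2 * ?q}"
  proof (rule inj_onI)
    fix i j assume ij: "i \<in> {..<2 * ?q}" "j \<in> {..<2 * ?q}" "\<tau> i = \<tau> j"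
    then have "\<sigma> (Suc n) (i div ?q) = \<sigma> (Suc n) (j div ?q)" "\<rho> (i mod ?q) = \<rho> (j mod ?q)"
      using \<tau>_div[of i] \<tau>_div[of j] by auto
    then have "i div ?q = j div ?q" "i mod ?q = j mod ?q"
      using permutes_inj[OF s] permutes_inj[OF \<rho>] by (auto dest: injD)
    then show "i = j" by (metis div_mult_mod_eq)
  qed
  have "bij_betw \<tau> {..<2 * ?q} {..<2 * ?q}"
    using endo_inj_surj[OF _ _ inj] \<tau>_less inj by (auto simp: bij_betw_def)
  then have "\<tau> permutes {..<2 ^ Suc n}"
    by (intro bij_imp_permutes) (auto simp: \<tau>_def)
  moreover have "kron_prod F (Suc n) = mat (2 ^ Suc n) (2 ^ Suc n) (\<lambda>(i, j). kron_prod G (Suc n) $$ (\<tau> i, j))"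
  proof (rule eq_matI)
    fix i j assume "i < dim_row (mat (2 ^ Suc n) (2 ^ Suc n) (\<lambda>(i, j). kron_prod G (Suc n) $$ (\<tau> i, j)))"
      "j < dim_col (mat (2 ^ Suc n) (2 ^ Suc n) (\<lambda>(i, j). kron_prod G (Suc n) $$ (\<tau> i, j)))"
    then have ij: "i < 2 * ?q" "j < 2 * ?q" by auto
    note c = kron_prod_carrier[of n F] kron_prod_carrier[of n G]
    have "kron_prod F (Suc n) $$ (i, j) = F (Suc n) $$ (i div ?q, j div ?q) * kron_prod F n $$ (i mod ?q, j mod ?q)"
      using kron_index[of "F (Suc n)" 2 "kron_prod F n" ?q i j] Suc.prems c ij by simp
    also have "\<dots> = G (Suc n) $$ (\<tau> i div ?q, j div ?q) * kron_prod G n $$ (\<tau> i mod ?q, j mod ?q)"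
      using ij div_less_mult[of i] div_less_mult[of j] mod_less_mult[of i] mod_less_mult[of j]
      by (simp add: eq Suc.prems(4) \<tau>_div)
    also have "\<dots> = kron_prod G (Suc n) $$ (\<tau> i, j)"
      using kron_index[of "G (Suc n)" 2 "kron_prod G n" ?q "\<tau> i" j] Suc.prems c ij \<tau>_less by simp
    finally show "kron_prod F (Suc n) $$ (i, j) = mat (2 ^ Suc n) (2 ^ Suc n) (\<lambda>(i, j). kron_prod G (Suc n) $$ (\<tau> i, j)) $$ (i, j)"
      using ij by simp
  next
    have "kron_prod F (Suc n) \<in> carrier_mat (2 ^ Suc n) (2 ^ Suc n)"
      by (rule kron_prod_carrier) (rule Suc.prems(1))
    then show "dim_row (kron_prod F (Suc n)) = dim_row (mat (2 ^ Suc n) (2 ^ Suc n) (\<lambda>(i, j). kron_prod G (Suc n) $$ (\<tau> i, j)))"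
      "dim_col (kron_prod F (Suc n)) = dim_col (mat (2 ^ Suc n) (2 ^ Suc n) (\<lambda>(i, j). kron_prod G (Suc n) $$ (\<tau> i, j)))"
      by (simp_all del: kron_prod.simps)
  qed
  ultimately show ?case by blast
qed

subsection \<open>Rotation blocks\<close>

lemma lu_factors_kron:
  assumes "lu_factors p L1 U1" "lu_factors q L2 U2"
  shows "lu_factors (p * q) (kron L1 L2) (kron U1 U2)"
proof -
  interpret F: lu_factors p L1 U1 by fact
  interpret G: lu_factors q L2 U2 by fact
  note dm = div_less_mult[of _ p q] mod_less_mult[of _ p q]
  show ?thesis
  proof
    show "kron L1 L2 \<in> carrier_mat (p * q) (p * q)" "kron U1 U2 \<in> carrier_mat (p * q) (p * q)"
      by (auto intro!: kron_carrier F.L_carrier G.L_carrier F.U_carrier G.U_carrier)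
    fix i assume i: "i < p * q"
    then show "kron L1 L2 $$ (i, i) = 1" "kron U1 U2 $$ (i, i) \<noteq> 0"
      using dm by (auto simp: kron_index[OF F.L_carrier G.L_carrier] kron_index[OF F.U_carrier G.U_carrier]
          F.L_diag G.L_diag F.U_diag G.U_diag)
  next
    fix i j assume ij: "i < j" "j < p * q"
    then show "kron L1 L2 $$ (i, j) = 0"
      using dm[of i] dm[of j] div_mod_less[of i j q]
      by (auto simp: kron_index[OF F.L_carrier G.L_carrier] F.L_lower G.L_lower)
  next
    fix i j assume ij: "j < i" "i < p * q"
    then show "kron U1 U2 $$ (i, j) = 0"
      using dm[of i] dm[of j] div_mod_less[of j i q]
      by (auto simp: kron_index[OF F.U_carrier G.U_carrier] F.U_upper G.U_upper)
  qed
qed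

lemma lu_factors_kron_prod:
  assumes "\<And>j. 1 \<le> j \<Longrightarrow> j \<le> n \<Longrightarrow> lu_factors 2 (F j) (G j)"
  shows "lu_factors (2 ^ n) (kron_prod F n) (kron_prod G n)"
  using assms
proof (induction n)
  case 0
  show ?case by unfold_locales auto
next
  case (Suc n)
  then show ?case using lu_factors_kron[of 2 "F (Suc n)" "G (Suc n)" "2 ^ n" "kron_prod F n" "kron_prod G n"] by simp
qed

text \<open>Two distinct indices differ in some binary digit, where the factor is smaller than 1,
  while all other factors are at most 1. The weak bound is part of the claim because the induction
  multiplies it with a strict one.\<close>

lemma kron_prod_offdiag_less:
  assumes "\<And>j. 1 \<le> j \<Longrightarrow> j \<le> n \<Longrightarrow> F j \<in> carrier_mat 2 2"
    and "\<And>j p. 1 \<le> j \<Longrightarrow> j \<le> n \<Longrightarrow> p < 2 \<Longrightarrow> F j $$ (p, p) = 1"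
    and "\<And>j p q. 1 \<le> j \<Longrightarrow> j \<le> n \<Longrightarrow> p < 2 \<Longrightarrow> q < 2 \<Longrightarrow> p \<noteq> q \<Longrightarrow> \<bar>F j $$ (p, q)\<bar> < 1"
    and "p < 2 ^ n" "q < 2 ^ n"
  shows "\<bar>kron_prod F n $$ (p, q)\<bar> \<le> 1 \<and> (p \<noteq> q \<longrightarrow> \<bar>kron_prod F n $$ (p, q)\<bar> < 1)"
  using assms
proof (induction n arbitrary: p q)
  case 0
  then show ?case by simp
next
  case (Suc n)
  let ?m = "2 ^ n :: nat"
  have pq: "p < 2 * ?m" "q < 2 * ?m" using Suc.prems by auto
  note lt = div_less_mult[OF pq(1)] div_less_mult[OF pq(2)] mod_less_mult[OF pq(1)] mod_less_mult[OF pq(2)]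
  have c: "F (Suc n) \<in> carrier_mat 2 2" "kron_prod F n \<in> carrier_mat ?m ?m"
    using Suc.prems(1) by (auto intro!: kron_prod_carrier)
  have eq: "\<bar>kron_prod F (Suc n) $$ (p, q)\<bar> =
      \<bar>F (Suc n) $$ (p div ?m, q div ?m)\<bar> * \<bar>kron_prod F n $$ (p mod ?m, q mod ?m)\<bar>"
    using kron_index[OF c pq] by (simp add: abs_mult)
  have IH: "\<bar>kron_prod F n $$ (p mod ?m, q mod ?m)\<bar> \<le> 1"
    "p mod ?m \<noteq> q mod ?m \<Longrightarrow> \<bar>kron_prod F n $$ (p mod ?m, q mod ?m)\<bar> < 1"
    using Suc.IH[of "p mod ?m" "q mod ?m"] Suc.prems(1-3) lt by auto
  have le: "\<bar>F (Suc n) $$ (p div ?m, q div ?m)\<bar> \<le> 1"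
    and less: "p div ?m \<noteq> q div ?m \<Longrightarrow> \<bar>F (Suc n) $$ (p div ?m, q div ?m)\<bar> < 1"
    using Suc.prems(2,3)[of "Suc n" "p div ?m"] lt by (cases "p div ?m = q div ?m", auto intro: less_imp_le)
  have "\<bar>F (Suc n) $$ (p div ?m, q div ?m)\<bar> * \<bar>kron_prod F n $$ (p mod ?m, q mod ?m)\<bar> < 1" if "p \<noteq> q"
  proof (cases "p div ?m = q div ?m")
    case True
    then have "p mod ?m \<noteq> q mod ?m" using that by (metis div_mult_mod_eq)
    then show ?thesis using IH(2) mult_right_mono[OF le, of "\<bar>kron_prod F n $$ (p mod ?m, q mod ?m)\<bar>"] by simp
  next
    case False
    then show ?thesis using less mult_left_mono[OF IH(1), of "\<bar>F (Suc n) $$ (p div ?m, q div ?m)\<bar>"] by simp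
  qed
  then show ?case unfolding eq using mult_le_one[OF le _ IH(1)] by simp
qed

lemma kron_prod_row_dominant:
  assumes "\<And>j. 1 \<le> j \<Longrightarrow> j \<le> n \<Longrightarrow> F j \<in> carrier_mat 2 2"
    and "\<And>j p q. 1 \<le> j \<Longrightarrow> j \<le> n \<Longrightarrow> p < 2 \<Longrightarrow> q < 2 \<Longrightarrow> \<bar>F j $$ (p, q)\<bar> \<le> \<bar>F j $$ (p, p)\<bar>"
    and "p < 2 ^ n" "q < 2 ^ n"
  shows "\<bar>kron_prod F n $$ (p, q)\<bar> \<le> \<bar>kron_prod F n $$ (p, p)\<bar>"
  using assms
proof (induction n arbitrary: p q)
  case 0
  then show ?case by simp
next
  case (Suc n)
  let ?m = "2 ^ n :: nat"
  have pq: "p < 2 * ?m" "q < 2 * ?m" using Suc.prems by auto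
  note lt = div_less_mult[OF pq(1)] div_less_mult[OF pq(2)] mod_less_mult[OF pq(1)] mod_less_mult[OF pq(2)]
  have c: "F (Suc n) \<in> carrier_mat 2 2" "kron_prod F n \<in> carrier_mat ?m ?m"
    using Suc.prems(1) by (auto intro!: kron_prod_carrier)
  show ?case
    using lt Suc.IH[of "p mod ?m" "q mod ?m"] Suc.prems(1,2)
    by (auto simp: kron_index[OF c pq] kron_index[OF c pq(1) pq(1)] abs_mult intro!: mult_mono)
qed

text \<open>The \<open>2 \<times> 2\<close> blocks that occur are the rotations (\<open>e = 1\<close>) and the rotations with
  interchanged rows (\<open>e = -1\<close>), so that one computation covers both kinds of elimination.\<close>

definition block :: "real \<Rightarrow> real \<Rightarrow> real \<Rightarrow> real mat" where
  "block a b e = mat 2 2 (\<lambda>(i, j). if i = 0 then (if j = 0 then a else b) else (if j = 0 then - (e * b) else e * a))"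

definition block_L :: "real \<Rightarrow> real \<Rightarrow> real \<Rightarrow> real mat" where
  "block_L a b e = mat 2 2 (\<lambda>(i, j). if i = j then 1 else if j = 0 then - (e * b / a) else 0)"

text \<open>The second pivot is e a + e b^2 / a, which equals e / a when a^2 + b^2 = 1.\<close>

definition block_U :: "real \<Rightarrow> real \<Rightarrow> real \<Rightarrow> real mat" where
  "block_U a b e = mat 2 2 (\<lambda>(i, j). if i = 0 then (if j = 0 then a else b) else (if j = 0 then 0 else e / a))"

lemma block_carrier [simp]:
  "block a b e \<in> carrier_mat 2 2" "block_L a b e \<in> carrier_mat 2 2" "block_U a b e \<in> carrier_mat 2 2"
  by (auto simp: block_def block_L_def block_U_def)

lemma block_index [simp]:
  "block a b e $$ (0, 0) = a" "block a b e $$ (0, Suc 0) = b"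
  "block a b e $$ (Suc 0, 0) = - (e * b)" "block a b e $$ (Suc 0, Suc 0) = e * a"
  "block_L a b e $$ (0, 0) = 1" "block_L a b e $$ (0, Suc 0) = 0"
  "block_L a b e $$ (Suc 0, 0) = - (e * b / a)" "block_L a b e $$ (Suc 0, Suc 0) = 1"
  "block_U a b e $$ (0, 0) = a" "block_U a b e $$ (0, Suc 0) = b"
  "block_U a b e $$ (Suc 0, 0) = 0" "block_U a b e $$ (Suc 0, Suc 0) = e / a"
  by (auto simp: block_def block_L_def block_U_def)

lemma rotation2_block: "rotation2 t = block (cos t) (sin t) 1"
  by (rule eq_matI) (auto simp: rotation2_def block_def mat_of_rows_list_def less_2_cases_iff)

lemma less_2E: assumes "(i::nat) < 2" obtains "i = 0" | "i = Suc 0"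
  using assms by linarith

lemma mult_index_2:
  assumes "A \<in> carrier_mat 2 2" "B \<in> carrier_mat 2 2" "i < 2" "j < 2"
  shows "(A * B) $$ (i, j) = A $$ (i, 0) * B $$ (0, j) + A $$ (i, Suc 0) * B $$ (Suc 0, j)"
  using mult_index[OF assms] by (simp add: numeral_2_eq_2)

lemma row_sum_2: "A \<in> carrier_mat 2 2 \<Longrightarrow> row_sum A i = \<bar>A $$ (i, 0)\<bar> + \<bar>A $$ (i, Suc 0)\<bar>"
  by (auto simp: row_sum_def numeral_2_eq_2)

lemma inf_norm_2:
  assumes "A \<in> carrier_mat 2 2"
  shows "inf_norm A = max (\<bar>A $$ (0, 0)\<bar> + \<bar>A $$ (0, Suc 0)\<bar>) (\<bar>A $$ (Suc 0, 0)\<bar> + \<bar>A $$ (Suc 0, Suc 0)\<bar>)"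
proof -
  have "{..<2::nat} = {0, 1}" by auto
  then show ?thesis using assms by (auto simp: inf_norm_row_sum row_sum_2)
qed

section \<open>Norms and partial sums for one block\<close>

locale block_params =
  fixes a b e :: real
  assumes a: "a \<noteq> 0" and ab: "a\<^sup>2 + b\<^sup>2 = 1" and e: "\<bar>e\<bar> = 1"
begin

lemma block_LU: "block a b e = block_L a b e * block_U a b e"
proof (rule eq_matI)
  have "a * a = 1 - b * b" using ab by (simp add: power2_eq_square)
  then have "e * a * a = e * (1 - b * b)" by simp
  then have "e * a = e * (1 - b * b) / a" using a by (simp add: field_simps)
  then have *: "e * a = e / a - e * b * b / a" by (simp add: diff_divide_distrib algebra_simps)
  fix i j assume "i < dim_row (block_L a b e * block_U a b e)" "j < dim_col (block_L a b e * block_U a b e)"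
  then have "i < 2" "j < 2" by (auto simp: block_L_def block_U_def)
  then show "block a b e $$ (i, j) = (block_L a b e * block_U a b e) $$ (i, j)"
    using a by (elim less_2E) (simp_all add: mult_index_2 * del: index_mult_mat(1))
qed (auto simp: block_def block_L_def block_U_def)

lemma lu_factors_block: "lu_factors 2 (block_L a b e) (block_U a b e)"
  using a e by unfold_locales (auto elim!: less_2E)

lemma abs_a: "\<bar>a\<bar> > 0" "\<bar>a\<bar> \<le> 1"
  using a ab zero_le_power2[of b] abs_square_le_1[of a] by (simp, linarith)

lemma abs_b: "\<bar>b\<bar> \<le> 1"
  using ab zero_le_power2[of a] abs_square_le_1[of b] by linarith

text \<open>The tangent or cotangent of the angle, in magnitude. The norms below are functions of t,
  up to a factor |a| that cancels or disappears through a^2 (1 + t^2) = 1.\<close>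

definition t :: real where "t = \<bar>b / a\<bar>"

lemma t_nonneg: "t \<ge> 0" by (simp add: t_def)

lemma b_t: "\<bar>b\<bar> = \<bar>a\<bar> * t"
  using a by (simp add: t_def field_simps)

lemma a_t: "\<bar>a\<bar> * \<bar>a\<bar> * (1 + t\<^sup>2) = 1"
proof -
  have "\<bar>a\<bar> * \<bar>a\<bar> * (1 + t\<^sup>2) = a\<^sup>2 + b\<^sup>2"
    using a by (simp add: t_def power_divide power2_eq_square field_simps)
  then show ?thesis using ab by simp
qed

lemma one_t: "1 + t\<^sup>2 = 1 / (\<bar>a\<bar> * \<bar>a\<bar>)"
  using a_t abs_a by (simp add: field_simps)

lemma max_norm_block: "max_norm (block a b e) = \<bar>a\<bar> * max 1 t"
proof -
  have "max_norm (block a b e) = max \<bar>a\<bar> \<bar>b\<bar>"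
  proof (cases "\<bar>b\<bar> \<le> \<bar>a\<bar>")
    case True
    then show ?thesis using e
      by (intro max_norm_eqI[of _ 2 2 _ 0 0]) (auto elim!: less_2E simp: abs_mult)
  next
    case False
    then show ?thesis using e
      by (intro max_norm_eqI[of _ 2 2 _ 0 1]) (auto elim!: less_2E simp: abs_mult)
  qed
  then show ?thesis by (simp add: b_t max_mult_distrib_left)
qed

lemma max_norm_block_L: "max_norm (block_L a b e) = max 1 t"
proof (cases "t \<le> 1")
  case True
  then show ?thesis using e
    by (intro max_norm_eqI[of _ 2 2 _ 0 0]) (auto elim!: less_2E simp: abs_mult t_def)
next
  case False
  then show ?thesis using e
    by (intro max_norm_eqI[of _ 2 2 _ 1 0]) (auto elim!: less_2E simp: abs_mult t_def)
qed

lemma inf_norm_block: "inf_norm (block a b e) = \<bar>a\<bar> * (1 + t)"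
  using e by (simp add: inf_norm_2 abs_mult b_t algebra_simps)

lemma inf_norm_block_L: "inf_norm (block_L a b e) = 1 + t"
  using e by (simp add: inf_norm_2 abs_mult t_def)

lemma inf_norm_block_U: "inf_norm (block_U a b e) = \<bar>a\<bar> * (1 + max t (t\<^sup>2))"
proof -
  have "1 / \<bar>a\<bar> = \<bar>a\<bar> * (1 + t\<^sup>2)" using one_t abs_a by (simp add: field_simps)
  then have "inf_norm (block_U a b e) = max (\<bar>a\<bar> * (1 + t)) (\<bar>a\<bar> * (1 + t\<^sup>2))"
    using e by (simp add: inf_norm_2 b_t algebra_simps)
  also have "\<dots> = \<bar>a\<bar> * max (1 + t) (1 + t\<^sup>2)"
    by (simp add: max_mult_distrib_left)
  also have "max (1 + t) (1 + t\<^sup>2) = 1 + max t (t\<^sup>2)" by (simp add: max_def)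
  finally show ?thesis .
qed

text \<open>With absolute values the two terms of the last entry add up instead of cancelling: |a|
  t^2 from the off-diagonal entries and 1 / |a| = |a| (1 + t^2) from the second pivot. Hence the 2
  in \<open>rho_o\<close>.\<close>

lemma inf_norm_block_abs:
  "inf_norm (map_mat abs (block_L a b e) * map_mat abs (block_U a b e)) = \<bar>a\<bar> * (1 + t + 2 * t\<^sup>2)"
proof -
  let ?M = "map_mat abs (block_L a b e) * map_mat abs (block_U a b e)"
  have c: "map_mat abs (block_L a b e) \<in> carrier_mat 2 2" "map_mat abs (block_U a b e) \<in> carrier_mat 2 2" by auto
  have d: "dim_row (block_L a b e) = 2" "dim_col (block_L a b e) = 2" "dim_row (block_U a b e) = 2" "dim_col (block_U a b e) = 2"
    by (auto simp: block_L_def block_U_def)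
  have inv: "1 / \<bar>a\<bar> = \<bar>a\<bar> * (1 + t\<^sup>2)" using one_t abs_a by (simp add: field_simps)
  have ix: "\<bar>?M $$ (0, 0)\<bar> = \<bar>a\<bar>" "\<bar>?M $$ (0, Suc 0)\<bar> = \<bar>a\<bar> * t"
      "\<bar>?M $$ (Suc 0, 0)\<bar> = \<bar>a\<bar> * t" "\<bar>?M $$ (Suc 0, Suc 0)\<bar> = \<bar>a\<bar> * (1 + 2 * t\<^sup>2)"
    using e inv t_nonneg b_t
    by (auto simp del: index_mult_mat(1) simp: mult_index_2[OF c] d abs_mult t_def[symmetric] power2_eq_square algebra_simps)
  have "inf_norm ?M = max (\<bar>a\<bar> + \<bar>a\<bar> * t) (\<bar>a\<bar> * t + \<bar>a\<bar> * (1 + 2 * t\<^sup>2))"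
    using c by (simp only: inf_norm_2[OF mult_carrier_mat[OF c]] ix)
  also have "\<dots> = \<bar>a\<bar> * t + \<bar>a\<bar> * (1 + 2 * t\<^sup>2)"
    by (intro max_absorb2) (simp add: algebra_simps)
  finally show ?thesis by (simp add: algebra_simps)
qed

text \<open>Here x and y are the two terms in the expansion of the block entry (p, q), and S and D a
  head and the complementary tail of the expansion for the smaller product. A cut in the first half
  of the range gives the head x S and the tail x D + y (S + D); a cut in the second half gives x (S
  + D) + y S and y D. Estimating the summands of the mixed expressions separately is too crude, so
  the cancellation between x and y is used.\<close>

lemma block_sum_bounds:
  assumes "p < 2" "q < 2" and S: "\<bar>S\<bar> \<le> M" "\<bar>D\<bar> \<le> M" "\<bar>S + D\<bar> \<le> 1" "1 \<le> M"
  defines "x \<equiv> block_L a b e $$ (p, 0) * block_U a b e $$ (0, q)"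
    and "y \<equiv> block_L a b e $$ (p, Suc 0) * block_U a b e $$ (Suc 0, q)"
  shows "\<bar>x * S\<bar> \<le> M / \<bar>a\<bar>" "\<bar>x * D + y * (S + D)\<bar> \<le> M / \<bar>a\<bar>"
    "\<bar>x * (S + D) + y * S\<bar> \<le> M / \<bar>a\<bar>" "\<bar>y * D\<bar> \<le> M / \<bar>a\<bar>"
proof -
  have M: "0 \<le> M" using S by simp
  have aa: "1 \<le> 1 / \<bar>a\<bar>" using abs_a by (simp add: field_simps)
  have small: "\<bar>z * w\<bar> \<le> M / \<bar>a\<bar>" if "\<bar>z\<bar> \<le> 1 / \<bar>a\<bar>" "\<bar>w\<bar> \<le> M" for z w
    using mult_mono[OF that] M abs_a by (simp add: abs_mult)
  have b2: "\<bar>e * b / a * b\<bar> \<le> 1 / \<bar>a\<bar>"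
  proof -
    have "b\<^sup>2 \<le> 1" using ab zero_le_power2[of a] by linarith
    then show ?thesis using e abs_a by (simp add: abs_mult power2_eq_square divide_right_mono)
  qed
  have ba: "\<bar>e * b / a * a\<bar> \<le> 1 / \<bar>a\<bar>" using e a order_trans[OF abs_b aa] by (simp add: abs_mult)
  have xs: "\<bar>x\<bar> \<le> 1 / \<bar>a\<bar>" "\<bar>y\<bar> \<le> 1 / \<bar>a\<bar>"
    using assms(1,2) abs_a abs_b aa b2 ba e order_trans[OF abs_a(2) aa] order_trans[OF abs_b aa] unfolding x_def y_def by (auto elim!: less_2E simp: abs_mult)
  show "\<bar>x * S\<bar> \<le> M / \<bar>a\<bar>" "\<bar>y * D\<bar> \<le> M / \<bar>a\<bar>" using small xs S by auto
  have SD: "\<bar>S + D\<bar> \<le> M" using S by simp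
  have ab': "b * b = 1 - a * a" using ab by (simp add: power2_eq_square algebra_simps)
  have a2: "0 \<le> a * a" "a * a \<le> 1" using ab' zero_le_square[of a] zero_le_square[of b] by linarith+
  define z where "z = e / a"
  have xy11: "x = - (e / a * (1 - a * a))" "y = e / a" if "p = Suc 0 \<and> q = Suc 0"
    using that by (simp_all add: x_def y_def ab'[symmetric])
  show "\<bar>x * D + y * (S + D)\<bar> \<le> M / \<bar>a\<bar>"
  proof (cases "p = Suc 0 \<and> q = Suc 0")
    case True
    \<comment> \<open>With x = - (e / a) (1 - a^2) and y = e / a, the bracket is a convex
      combination of S + D and S with weights a^2 and 1 - a^2.\<close>
    then have "x * D + y * (S + D) = e / a * (a * a * (S + D) + (1 - a * a) * S)"
      unfolding xy11[OF True] z_def[symmetric] by (simp add: algebra_simps)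
    moreover have "\<bar>a * a * (S + D) + (1 - a * a) * S\<bar> \<le> a * a * M + (1 - a * a) * M"
      using a2 S SD by (intro order_trans[OF abs_triangle_ineq] add_mono) (auto simp: abs_mult intro!: mult_mono)
    ultimately show ?thesis using small[of "e / a" "a * a * (S + D) + (1 - a * a) * S"] e by (simp add: algebra_simps)
  next
    case False
    then have "y = 0" using assms(1,2) by (auto elim!: less_2E simp: y_def)
    then show ?thesis using small xs S by simp
  qed
  show "\<bar>x * (S + D) + y * S\<bar> \<le> M / \<bar>a\<bar>"
  proof (cases "p = Suc 0 \<and> q = Suc 0")
    case True
    \<comment> \<open>The same weights, now on S and - D.\<close>
    then have "x * (S + D) + y * S = e / a * (a * a * S - (1 - a * a) * D)"
      unfolding xy11[OF True] z_def[symmetric] by (simp add: algebra_simps)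
    moreover have "\<bar>a * a * S - (1 - a * a) * D\<bar> \<le> a * a * M + (1 - a * a) * M"
      using a2 S by (intro order_trans[OF abs_triangle_ineq4] add_mono) (auto simp: abs_mult intro!: mult_mono)
    ultimately show ?thesis using small[of "e / a" "a * a * S - (1 - a * a) * D"] e by (simp add: algebra_simps)
  next
    case False
    then have "y = 0" using assms(1,2) by (auto elim!: less_2E simp: y_def)
    then show ?thesis using small xs SD by simp
  qed
qed

end


text \<open>Both partial sums of the \<open>L U\<close> expansion have to be bounded together: neither bound
  is inductive on its own.\<close>

lemma kron_prod_partial_sums_le:
  assumes "\<And>j. 1 \<le> j \<Longrightarrow> j \<le> n \<Longrightarrow> block_params (a j) (b j) (e j)"
    and "i < 2 ^ n" "j < 2 ^ n" "k \<le> 2 ^ n"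
  defines "L \<equiv> kron_prod (\<lambda>j. block_L (a j) (b j) (e j))"
    and "U \<equiv> kron_prod (\<lambda>j. block_U (a j) (b j) (e j))"
  shows "\<bar>\<Sum>l<k. L n $$ (i, l) * U n $$ (l, j)\<bar> \<le> (\<Prod>j=1..n. 1 / \<bar>a j\<bar>) \<and>
    \<bar>\<Sum>l\<in>{k..<2 ^ n}. L n $$ (i, l) * U n $$ (l, j)\<bar> \<le> (\<Prod>j=1..n. 1 / \<bar>a j\<bar>) \<and>
    \<bar>\<Sum>l<2 ^ n. L n $$ (i, l) * U n $$ (l, j)\<bar> \<le> 1"
  using assms(1-4)
proof (induction n arbitrary: i j k)
  case 0
  then have "k = 0 \<or> k = 1" by auto
  then show ?case using 0 by (auto simp: L_def U_def)
next
  case (Suc n)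
  let ?q = "2 ^ n :: nat" and ?M = "\<Prod>j=1..n. 1 / \<bar>a j\<bar>"
  interpret B: block_params "a (Suc n)" "b (Suc n)" "e (Suc n)" using Suc.prems by simp
  have ij: "i < 2 * ?q" "j < 2 * ?q" using Suc.prems by auto
  note lt = div_less_mult[OF ij(1)] div_less_mult[OF ij(2)] mod_less_mult[OF ij(1)] mod_less_mult[OF ij(2)]
  have c: "L n \<in> carrier_mat ?q ?q" "U n \<in> carrier_mat ?q ?q"
    by (auto simp: L_def U_def intro!: kron_prod_carrier)
  define w where "w x = block_L (a (Suc n)) (b (Suc n)) (e (Suc n)) $$ (i div ?q, x) *
      block_U (a (Suc n)) (b (Suc n)) (e (Suc n)) $$ (x, j div ?q)" for x
  define v where "v y = L n $$ (i mod ?q, y) * U n $$ (y, j mod ?q)" for y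
  define f where "f l = L (Suc n) $$ (i, l) * U (Suc n) $$ (l, j)" for l
  have f: "f l = w (l div ?q) * v (l mod ?q)" if "l < 2 * ?q" for l
    using that ij kron_index[OF block_carrier(2) c(1) ij(1), of l] kron_index[OF block_carrier(3) c(2) _ ij(2), of l]
    by (simp add: f_def w_def v_def L_def U_def)
  have lo: "sum f {c..<d} = w 0 * sum v {c..<d}" if "d \<le> ?q" for c d
    using that by (simp add: sum_distrib_left f)
  have hi: "sum f {?q + c..<?q + d} = w 1 * sum v {c..<d}" if "d \<le> ?q" for c d
  proof -
    have "sum f {?q + c..<?q + d} = (\<Sum>l\<in>{c..<d}. f (l + ?q))"
      using sum.shift_bounds_nat_ivl[of f c ?q d] by (simp add: add.commute)
    also have "\<dots> = (\<Sum>l\<in>{c..<d}. w 1 * v l)"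
      using that by (intro sum.cong refl) (simp add: f)
    finally show ?thesis by (simp add: sum_distrib_left)
  qed
  have M: "1 \<le> ?M"
  proof (rule prod_ge_1)
    fix j assume "j \<in> {1..n}"
    then interpret block_params "a j" "b j" "e j" using Suc.prems by simp
    show "1 \<le> 1 / \<bar>a j\<bar>" using abs_a by (simp add: field_simps)
  qed
  have prod: "(\<Prod>j=1..Suc n. 1 / \<bar>a j\<bar>) = ?M / \<bar>a (Suc n)\<bar>" by simp
  have IH: "\<bar>sum v {0..<k}\<bar> \<le> ?M" "\<bar>sum v {k..<?q}\<bar> \<le> ?M" "\<bar>sum v {0..<?q}\<bar> \<le> 1" if "k \<le> ?q" for k
    using Suc.IH[OF _ lt(3,4) that] Suc.prems(1) by (auto simp: v_def atLeast0LessThan)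
  have split: "sum v {0..<k} + sum v {k..<?q} = sum v {0..<?q}" if "k \<le> ?q" for k
    using that by (simp add: sum.atLeastLessThan_concat)
  have total: "sum f {0..<2 * ?q} = (w 0 + w 1) * sum v {0..<?q}"
    using lo[of ?q 0] hi[of ?q 0] sum.atLeastLessThan_concat[of 0 ?q "?q + ?q" f]
    by (simp add: algebra_simps mult_2)
  \<comment> \<open>The full sum is an entry of a block times a full sum for the smaller product,
    both at most 1 in magnitude. It has to be controlled because a cut in one half can leave the
    other half with its full sum.\<close>
  have "w 0 + w 1 = block (a (Suc n)) (b (Suc n)) (e (Suc n)) $$ (i div ?q, j div ?q)"
    unfolding B.block_LU w_def using mult_index_2[OF block_carrier(2,3) lt(1,2)] by simp
  then have "\<bar>w 0 + w 1\<bar> \<le> 1"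
    using lt(1,2) B.abs_a B.abs_b B.e by (auto elim!: less_2E simp: abs_mult)
  then have 3: "\<bar>sum f {0..<2 * ?q}\<bar> \<le> 1"
    unfolding total using IH(3)[of 0] by (simp add: abs_mult mult_le_one)
  have 12: "\<bar>sum f {0..<k}\<bar> \<le> ?M / \<bar>a (Suc n)\<bar> \<and> \<bar>sum f {k..<2 * ?q}\<bar> \<le> ?M / \<bar>a (Suc n)\<bar>"
  \<comment> \<open>The leading binary digit splits the range at \<open>?q\<close>. The position of
    the cut inside its half is the cut for the smaller product.\<close>
  proof (cases "k \<le> ?q")
    case True
    have "sum f {k..<2 * ?q} = w 0 * sum v {k..<?q} + w 1 * (sum v {0..<k} + sum v {k..<?q})"
      using lo[of ?q k] hi[of ?q 0] True sum.atLeastLessThan_concat[of k ?q "?q + ?q" f]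
      by (simp add: split mult_2)
    then show ?thesis
      using B.block_sum_bounds(1,2)[OF lt(1,2) IH(1,2)[OF True] _ M] IH(3)[OF True] lo[OF True, of 0]
      by (simp add: split[OF True] w_def)
  next
    case False
    then obtain k' where k: "k = ?q + k'" using le_Suc_ex[of ?q k] by auto
    then have k': "k' \<le> ?q" using Suc.prems by simp
    have "sum f {0..<k} = w 0 * (sum v {0..<k'} + sum v {k'..<?q}) + w 1 * sum v {0..<k'}"
      using lo[of ?q 0] hi[OF k', of 0] sum.atLeastLessThan_concat[of 0 ?q k f]
      by (simp add: split[OF k'] k)
    moreover have "sum f {k..<2 * ?q} = w 1 * sum v {k'..<?q}"
      using hi[of ?q k'] by (simp add: k mult_2)
    ultimately show ?thesis
      using B.block_sum_bounds(3,4)[OF lt(1,2) IH(1,2)[OF k'] _ M] IH(3)[OF k']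
      by (simp add: split[OF k'] w_def)
  qed
  show ?case
    using 12 3 unfolding prod f_def by (simp add: atLeast0LessThan)
qed

section \<open>Growth factors of a Kronecker product of blocks\<close>

locale kron_blocks =
  fixes n :: nat and a b e :: "nat \<Rightarrow> real"
  assumes params: "1 \<le> j \<Longrightarrow> j \<le> n \<Longrightarrow> block_params (a j) (b j) (e j)"
begin

definition A :: "real mat" where "A = kron_prod (\<lambda>j. block (a j) (b j) (e j)) n"
definition L :: "real mat" where "L = kron_prod (\<lambda>j. block_L (a j) (b j) (e j)) n"
definition U :: "real mat" where "U = kron_prod (\<lambda>j. block_U (a j) (b j) (e j)) n"
definition t :: "nat \<Rightarrow> real" where "t j = \<bar>b j / a j\<bar>"

lemma A_carrier: "A \<in> carrier_mat (2 ^ n) (2 ^ n)"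
  by (simp add: A_def kron_prod_carrier)

sublocale lu_factors "2 ^ n" L U
  unfolding L_def U_def by (rule lu_factors_kron_prod) (simp add: block_params.lu_factors_block[OF params])

lemma A_LU: "A = L * U"
  unfolding A_def L_def U_def kron_prod_mult[OF block_carrier(2,3), symmetric]
  by (rule kron_prod_cong) (rule block_params.block_LU[OF params])

text \<open>All binary digits of the last index are 1, so this entry collects the second pivots
  \<open>e j / a j\<close> of all blocks.\<close>

lemma abs_U_last: "\<bar>U $$ (2 ^ n - 1, 2 ^ n - 1)\<bar> = (\<Prod>j=1..n. 1 / \<bar>a j\<bar>)"
proof -
  have "\<bar>kron_prod (\<lambda>j. block_U (a j) (b j) (e j)) k $$ (2 ^ k - 1, 2 ^ k - 1)\<bar> = (\<Prod>j=1..k. 1 / \<bar>a j\<bar>)"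
    if "k \<le> n" for k
    using that
  proof (induction k)
    case (Suc k)
    let ?q = "2 ^ k :: nat"
    interpret C: block_params "a (Suc k)" "b (Suc k)" "e (Suc k)" using params Suc.prems by simp
    have q: "2 * ?q - 1 = 1 * ?q + (?q - 1)" "?q - 1 < ?q" by auto
    then have "(2 * ?q - 1) div ?q = 1" "(2 * ?q - 1) mod ?q = ?q - 1"
      by (metis div_mult_self3 div_less add_0_right power_not_zero zero_neq_numeral, metis mod_mult_self3 mod_less)
    then show ?case
      using Suc kron_index[OF block_carrier(3) kron_prod_carrier[OF block_carrier(3)], of "2 * ?q - 1" k "2 * ?q - 1"] C.e
      by (simp add: abs_mult)
  qed simp
  then show ?thesis by (simp add: U_def)
qed

lemma Max_iter: "Max ((\<lambda>k. max_norm (genp_iter A k)) ` {..<2 ^ n}) = (\<Prod>j=1..n. 1 / \<bar>a j\<bar>)"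
proof (rule Max_eqI)
  have c: "genp_iter A k \<in> carrier_mat (2 ^ n) (2 ^ n)" for k
    using A_carrier by auto
  have le: "\<bar>genp_iter A k $$ (i, j)\<bar> \<le> (\<Prod>j=1..n. 1 / \<bar>a j\<bar>)" if "k < 2 ^ n" "i < 2 ^ n" "j < 2 ^ n" for i j k
    using kron_prod_partial_sums_le[of n a b e i j "min i k"] that params
    by (simp add: A_LU genp_iter_LU L_def[symmetric] U_def[symmetric])
  {
    fix y assume "y \<in> (\<lambda>k. max_norm (genp_iter A k)) ` {..<2 ^ n}"
    then obtain k where k: "k < 2 ^ n" "y = max_norm (genp_iter A k)" by auto
    then show "y \<le> (\<Prod>j=1..n. 1 / \<bar>a j\<bar>)"
      using le[OF k(1)] max_norm_attained[OF c[of k]] by (metis zero_less_numeral zero_less_power)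
  }
  have "max_norm (genp_iter A (2 ^ n - 1)) = (\<Prod>j=1..n. 1 / \<bar>a j\<bar>)"
  proof (rule max_norm_eqI[OF c])
    show "\<bar>genp_iter A (2 ^ n - 1) $$ (2 ^ n - 1, 2 ^ n - 1)\<bar> = (\<Prod>j=1..n. 1 / \<bar>a j\<bar>)"
      using abs_U_last by (simp add: A_LU genp_iter_LU_upper)
    show "\<bar>genp_iter A (2 ^ n - 1) $$ (i, j)\<bar> \<le> (\<Prod>j=1..n. 1 / \<bar>a j\<bar>)" if "i < 2 ^ n" "j < 2 ^ n" for i j
      using that by (intro le) auto
  qed auto
  then show "(\<Prod>j=1..n. 1 / \<bar>a j\<bar>) \<in> (\<lambda>k. max_norm (genp_iter A k)) ` {..<2 ^ n}"
    by (intro image_eqI[of _ _ "2 ^ n - 1"]) auto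
qed simp

text \<open>One calculation serves every strategy: \<open>B\<close> is \<open>A\<close> itself
  without pivoting and a row permutation of \<open>A\<close> with partial pivoting. The growth
  factors see \<open>B\<close> only through its size, the product \<open>P * B * Q\<close> and two
  norms that row permutations preserve.\<close>

context
  fixes B P Q :: "real mat"
  assumes PBQ: "P * B * Q = A" and dim: "dim_row B = 2 ^ n"
    and mnorm: "max_norm B = max_norm A" and inorm: "inf_norm B = inf_norm A"
begin

text \<open>The factor \<open>max 1 t\<close> occurs in the max-norm of the block and of its
  \<open>L\<close> alike and cancels; 1 / a^2 = 1 + t^2 remains, whether or not t exceeds 1.\<close>

lemma rho_blocks: "rho B P Q = (\<Prod>j=1..n. 1 + (t j)\<^sup>2)"
proof -
  have "rho B P Q = max_norm L * (\<Prod>j=1..n. 1 / \<bar>a j\<bar>) / max_norm A"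
    by (simp add: rho_def PBQ dim mnorm Max_iter) (simp add: A_LU genp_L_LU)
  also have "\<dots> = (\<Prod>j=1..n. max_norm (block_L (a j) (b j) (e j)) * (1 / \<bar>a j\<bar>) / max_norm (block (a j) (b j) (e j)))"
    by (simp only: L_def A_def max_norm_kron_prod[OF block_carrier(1)] max_norm_kron_prod[OF block_carrier(2)]
        prod.distrib prod_dividef)
  also have "\<dots> = (\<Prod>j=1..n. 1 + (t j)\<^sup>2)"
  proof (rule prod.cong[OF refl])
    fix j assume "j \<in> {1..n}"
    then interpret B: block_params "a j" "b j" "e j" using params by simp
    show "max_norm (block_L (a j) (b j) (e j)) * (1 / \<bar>a j\<bar>) / max_norm (block (a j) (b j) (e j)) = 1 + (t j)\<^sup>2"
    proof -
      have "max 1 B.t \<noteq> 0" by simp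
      then have "max 1 B.t * (1 / \<bar>a j\<bar>) / (\<bar>a j\<bar> * max 1 B.t) = 1 / (\<bar>a j\<bar> * \<bar>a j\<bar>)"
        using B.a by (simp add: field_simps)
      then show ?thesis
        unfolding B.max_norm_block B.max_norm_block_L t_def B.t_def[symmetric] B.one_t .
    qed
  qed
  finally show ?thesis .
qed

lemma rho_inf_blocks: "rho_inf B P Q = (\<Prod>j=1..n. 1 + max (t j) ((t j)\<^sup>2))"
proof -
  have "rho_inf B P Q = inf_norm L * inf_norm U / inf_norm A"
    by (simp add: rho_inf_def PBQ inorm) (simp add: A_LU genp_L_LU genp_U_LU)
  also have "\<dots> = (\<Prod>j=1..n. inf_norm (block_L (a j) (b j) (e j)) * inf_norm (block_U (a j) (b j) (e j)) / inf_norm (block (a j) (b j) (e j)))"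
    by (simp only: L_def A_def U_def inf_norm_kron_prod[OF block_carrier(1)] inf_norm_kron_prod[OF block_carrier(2)]
        inf_norm_kron_prod[OF block_carrier(3)] prod.distrib prod_dividef)
  also have "\<dots> = (\<Prod>j=1..n. 1 + max (t j) ((t j)\<^sup>2))"
  proof (rule prod.cong[OF refl])
    fix j assume "j \<in> {1..n}"
    then interpret B: block_params "a j" "b j" "e j" using params by simp
    have "B.t = t j" by (simp add: B.t_def t_def)
    then show "inf_norm (block_L (a j) (b j) (e j)) * inf_norm (block_U (a j) (b j) (e j)) / inf_norm (block (a j) (b j) (e j))
      = 1 + max (t j) ((t j)\<^sup>2)"
      using B.a B.t_nonneg by (simp add: B.inf_norm_block B.inf_norm_block_L B.inf_norm_block_U)
  qed
  finally show ?thesis .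
qed

lemma rho_o_blocks: "rho_o B P Q = (\<Prod>j=1..n. 1 + 2 * (t j)\<^sup>2 / (1 + t j))"
proof -
  have c: "map_mat abs (block_L x y z) \<in> carrier_mat 2 2" "map_mat abs (block_U x y z) \<in> carrier_mat 2 2" for x y z
    by auto
  have "rho_o B P Q = inf_norm (map_mat abs L * map_mat abs U) / inf_norm A"
    by (simp add: rho_o_def PBQ inorm) (simp add: A_LU genp_L_LU genp_U_LU)
  also have "map_mat abs L * map_mat abs U =
      kron_prod (\<lambda>j. map_mat abs (block_L (a j) (b j) (e j)) * map_mat abs (block_U (a j) (b j) (e j))) n"
    unfolding L_def U_def by (simp only: kron_prod_abs[OF block_carrier(2)] kron_prod_abs[OF block_carrier(3)] kron_prod_mult[OF c])
  also have "inf_norm \<dots> / inf_norm A = (\<Prod>j=1..n. inf_norm (map_mat abs (block_L (a j) (b j) (e j)) *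
      map_mat abs (block_U (a j) (b j) (e j))) / inf_norm (block (a j) (b j) (e j)))"
    by (simp only: A_def inf_norm_kron_prod[OF block_carrier(1)] inf_norm_kron_prod[OF mult_carrier_mat[OF c]] prod_dividef)
  also have "\<dots> = (\<Prod>j=1..n. 1 + 2 * (t j)\<^sup>2 / (1 + t j))"
  proof (rule prod.cong[OF refl])
    fix j assume "j \<in> {1..n}"
    then interpret B: block_params "a j" "b j" "e j" using params by simp
    have "B.t = t j" by (simp add: B.t_def t_def)
    then show "inf_norm (map_mat abs (block_L (a j) (b j) (e j)) * map_mat abs (block_U (a j) (b j) (e j))) /
        inf_norm (block (a j) (b j) (e j)) = 1 + 2 * (t j)\<^sup>2 / (1 + t j)"
      using B.a B.t_nonneg by (simp add: B.inf_norm_block B.inf_norm_block_abs add_divide_eq_iff add_ac)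
  qed
  finally show ?thesis .
qed

end

end

subsection \<open>Butterfly matrices\<close>

lemma mult_perm_mat:
  assumes "\<pi> permutes {..<m}" "A \<in> carrier_mat m m"
  shows "A * perm_mat m \<pi> = mat m m (\<lambda>(i, j). A $$ (i, Hilbert_Choice.inv \<pi> j))"
proof (rule eq_matI)
  fix i j assume "i < dim_row (mat m m (\<lambda>(i, j). A $$ (i, Hilbert_Choice.inv \<pi> j)))"
    "j < dim_col (mat m m (\<lambda>(i, j). A $$ (i, Hilbert_Choice.inv \<pi> j)))"
  then have ij: "i < m" "j < m" by auto
  have inv: "Hilbert_Choice.inv \<pi> j < m" by (rule permutes_less[OF permutes_inv[OF assms(1)] ij(2)])
  have "(A * perm_mat m \<pi>) $$ (i, j) = (\<Sum>l<m. A $$ (i, l) * (if j = \<pi> l then 1 else 0))"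
    using ij assms by (simp add: mult_index[of _ m] perm_mat_index del: index_mult_mat(1))
  also have "\<dots> = (\<Sum>l<m. if l = Hilbert_Choice.inv \<pi> j then A $$ (i, l) else 0)"
    using permutes_inverses[OF assms(1)] by (intro sum.cong) auto
  also have "\<dots> = A $$ (i, Hilbert_Choice.inv \<pi> j)" using inv by simp
  finally show "(A * perm_mat m \<pi>) $$ (i, j) = mat m m (\<lambda>(i, j). A $$ (i, Hilbert_Choice.inv \<pi> j)) $$ (i, j)"
    using ij by simp
qed (use assms in auto)

lemma max_norm_permute:
  assumes A: "A \<in> carrier_mat m m" and "\<rho> permutes {..<m}" "\<sigma> permutes {..<m}"
  shows "max_norm (mat m m (\<lambda>(i, j). A $$ (\<rho> i, \<sigma> j))) = max_norm A"
proof -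
  have "elements_mat (mat m m (\<lambda>(i, j). A $$ (\<rho> i, \<sigma> j))) = (\<lambda>(i, j). A $$ (i, j)) ` (\<rho> ` {..<m} \<times> \<sigma> ` {..<m})"
    by (force simp: elements_mat_def)
  also have "\<dots> = elements_mat A"
    using A by (force simp: elements_mat_def permutes_image[OF assms(2)] permutes_image[OF assms(3)])
  finally show ?thesis by (simp add: max_norm_def)
qed

lemma inf_norm_permute:
  assumes A: "A \<in> carrier_mat m m" and "\<rho> permutes {..<m}"
  shows "inf_norm (mat m m (\<lambda>(i, j). A $$ (\<rho> i, j))) = inf_norm A"
proof -
  have "row_sum (mat m m (\<lambda>(i, j). A $$ (\<rho> i, j))) ` {..<m} = row_sum A ` (\<rho> ` {..<m})"
    using A by (force simp: row_sum_def image_image)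
  then show ?thesis using A by (simp add: inf_norm_row_sum permutes_image[OF assms(2)])
qed

text \<open>The product of \<open>A\<close> with its transpose is the identity. The entrywise form
  passes to Kronecker products and to permuted rows and columns by reindexing a sum.\<close>

definition orthonormal_rows :: "nat \<Rightarrow> real mat \<Rightarrow> bool" where
  "orthonormal_rows m A \<longleftrightarrow>
     (\<forall>i<m. \<forall>j<m. (\<Sum>l<m. A $$ (i, l) * A $$ (j, l)) = (if i = j then 1 else 0))"

lemma orthonormal_rows_kron:
  assumes A: "A \<in> carrier_mat p p" "orthonormal_rows p A" and B: "B \<in> carrier_mat q q" "orthonormal_rows q B"
  shows "orthonormal_rows (p * q) (kron A B)"
  unfolding orthonormal_rows_def
proof (intro allI impI)
  fix i j assume ij: "i < p * q" "j < p * q"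
  note lt = div_less_mult[OF ij(1)] div_less_mult[OF ij(2)] mod_less_mult[OF ij(1)] mod_less_mult[OF ij(2)]
  have "(\<Sum>l<p * q. kron A B $$ (i, l) * kron A B $$ (j, l)) =
      (\<Sum>x<p. \<Sum>y<q. (A $$ (i div q, x) * A $$ (j div q, x)) * (B $$ (i mod q, y) * B $$ (j mod q, y)))"
    unfolding sum_lessThan_mult using ij mult_add_less[of _ p _ q]
    by (intro sum.cong refl) (simp add: kron_index[OF A(1) B(1)])
  also have "\<dots> = (\<Sum>x<p. A $$ (i div q, x) * A $$ (j div q, x)) * (\<Sum>y<q. B $$ (i mod q, y) * B $$ (j mod q, y))"
    by (simp add: sum_product)
  also have "\<dots> = (if i div q = j div q \<and> i mod q = j mod q then 1 else 0)"
    using A(2) B(2) lt by (simp add: orthonormal_rows_def)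
  also have "\<dots> = (if i = j then 1 else 0)" by (metis div_mult_mod_eq)
  finally show "(\<Sum>l<p * q. kron A B $$ (i, l) * kron A B $$ (j, l)) = (if i = j then 1 else 0)" .
qed

lemma orthonormal_rows_butterfly: "orthonormal_rows (2 ^ n) (butterfly n \<theta>)"
proof (induction n)
  case 0
  show ?case by (simp add: orthonormal_rows_def)
next
  case (Suc n)
  have c: "{..<2::nat} = {0, Suc 0}" by auto
  have s: "sin x * sin x + cos x * cos x = 1" "cos x * cos x + sin x * sin x = 1" for x :: real
    using sin_cos_squared_add[of x] by (simp_all add: power2_eq_square add.commute)
  have "orthonormal_rows 2 (rotation2 (\<theta> (Suc n)))"
    unfolding orthonormal_rows_def by (auto elim!: less_2E simp: rotation2_block c s)
  then show ?case
    using orthonormal_rows_kron[OF _ _ butterfly_carrier Suc] by (simp add: rotation2_block)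
qed

lemma orthonormal_rows_permute:
  assumes "orthonormal_rows m A" "\<rho> permutes {..<m}" "\<sigma> permutes {..<m}"
  shows "orthonormal_rows m (mat m m (\<lambda>(i, j). A $$ (\<rho> i, \<sigma> j)))"
  unfolding orthonormal_rows_def
proof (intro allI impI)
  fix i j assume ij: "i < m" "j < m"
  have "(\<Sum>l<m. mat m m (\<lambda>(i, j). A $$ (\<rho> i, \<sigma> j)) $$ (i, l) * mat m m (\<lambda>(i, j). A $$ (\<rho> i, \<sigma> j)) $$ (j, l))
      = (\<Sum>l<m. A $$ (\<rho> i, \<sigma> l) * A $$ (\<rho> j, \<sigma> l))"
    using ij by (intro sum.cong) auto
  also have "\<dots> = (\<Sum>l<m. A $$ (\<rho> i, l) * A $$ (\<rho> j, l))"
    using sum.permute[OF assms(3), of "\<lambda>l. A $$ (\<rho> i, l) * A $$ (\<rho> j, l)"] by (simp add: comp_def)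
  also have "\<dots> = (if i = j then 1 else 0)"
    using assms(1) permutes_less[OF assms(2)] ij permutes_inj[OF assms(2)]
    by (auto simp: orthonormal_rows_def dest: injD)
  finally show "(\<Sum>l<m. mat m m (\<lambda>(i, j). A $$ (\<rho> i, \<sigma> j)) $$ (i, l) * mat m m (\<lambda>(i, j). A $$ (\<rho> i, \<sigma> j)) $$ (j, l))
      = (if i = j then 1 else 0)" .
qed

text \<open>The last column \<open>v\<close> of \<open>U A\<^sup>T\<close> solves \<open>L v = e\<^sub>m\<close>, so that \<open>v = e\<^sub>m\<close>.\<close>

lemma last_pivot_orthonormal:
  assumes A: "A \<in> carrier_mat m m" and lu: "lu_factorization A L U" and o: "orthonormal_rows m A" and m: "m > 0"
  shows "U $$ (m - 1, m - 1) * A $$ (m - 1, m - 1) = 1"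
proof -
  note lu' = lu[unfolded lu_factorization_def carrier_matD(1)[OF A]]
  have L: "L \<in> carrier_mat m m" and U: "U \<in> carrier_mat m m" and ALU: "A = L * U"
    and L1: "\<And>i. i < m \<Longrightarrow> L $$ (i, i) = 1" and L0: "\<And>i j. i < m \<Longrightarrow> j < m \<Longrightarrow> i < j \<Longrightarrow> L $$ (i, j) = 0"
    and Ut: "upper_triangular U"
    using lu' by blast+
  have U0: "U $$ (i, j) = 0" if "i < m" "j < i" for i j using Ut U that by auto
  have Aij: "A $$ (i, j) = (\<Sum>l<m. L $$ (i, l) * U $$ (l, j))" if "i < m" "j < m" for i j
    by (subst ALU) (rule mult_index[OF L U that])
  define v where "v i = (\<Sum>j<m. U $$ (i, j) * A $$ (m - 1, j))" for i
  have Lv: "(\<Sum>l<m. L $$ (i, l) * v l) = (if i = m - 1 then 1 else 0)" if "i < m" for i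
  proof -
    have "(\<Sum>l<m. L $$ (i, l) * v l) = (\<Sum>l<m. \<Sum>j<m. L $$ (i, l) * U $$ (l, j) * A $$ (m - 1, j))"
      by (simp add: v_def sum_distrib_left mult.assoc)
    also have "\<dots> = (\<Sum>j<m. \<Sum>l<m. L $$ (i, l) * U $$ (l, j) * A $$ (m - 1, j))" by (rule sum.swap)
    also have "\<dots> = (\<Sum>j<m. A $$ (i, j) * A $$ (m - 1, j))"
      unfolding sum_distrib_right[symmetric] using Aij[OF that] by simp
    also have "\<dots> = (if i = m - 1 then 1 else 0)" using o that m by (simp add: orthonormal_rows_def)
    finally show ?thesis .
  qed
  \<comment> \<open>Forward substitution: once the earlier components vanish, row i of
    \<open>L\<close> applied to \<open>v\<close> is just \<open>v i\<close>.\<close>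
  have step: "(\<Sum>l<m. L $$ (i, l) * v l) = v i" if "i < m" "\<And>l. l < i \<Longrightarrow> v l = 0" for i
  proof -
    have "(\<Sum>l<m. L $$ (i, l) * v l) = (\<Sum>l\<in>{i}. L $$ (i, l) * v l)"
      using that L0[of i] by (intro sum.mono_neutral_right) (auto, metis linorder_neqE_nat)
    then show ?thesis using that L1 by simp
  qed
  have "v i = 0" if "i < m - 1" for i
    using that
  proof (induction i rule: less_induct)
    case (less i)
    then show ?case using step[of i] Lv[of i] by simp
  qed
  then have "v (m - 1) = 1" using step[of "m - 1"] Lv[of "m - 1"] m by simp
  moreover have "v (m - 1) = (\<Sum>j\<in>{m - 1}. U $$ (m - 1, j) * A $$ (m - 1, j))"
    unfolding v_def using m U0[of "m - 1"] by (intro sum.mono_neutral_right) auto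
  ultimately show ?thesis by simp
qed

lemma rho_genp_orthonormal_ge:
  assumes A: "A \<in> carrier_mat m m" and ok: "genp_ok A" and o: "orthonormal_rows m A" and m: "m > 0"
  shows "rho A (1\<^sub>m m) (1\<^sub>m m) \<ge> 1 / (max_norm A)\<^sup>2"
proof -
  let ?M = "Max ((\<lambda>k. max_norm (genp_iter A k)) ` {..<m})"
  have p: "genp_U A $$ (m - 1, m - 1) * A $$ (m - 1, m - 1) = 1"
    by (rule last_pivot_orthonormal[OF A genp_ok_imp_lu_factorization[OF A ok] o m])
  have Ale: "\<bar>A $$ (m - 1, m - 1)\<bar> \<le> max_norm A" using m by (intro abs_index_le_max_norm[OF A]) auto
  have A0: "\<bar>A $$ (m - 1, m - 1)\<bar> > 0" using p by auto
  have "1 / max_norm A \<le> 1 / \<bar>A $$ (m - 1, m - 1)\<bar>" using Ale A0 by (intro divide_left_mono) auto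
  also have "\<dots> = \<bar>genp_U A $$ (m - 1, m - 1)\<bar>"
    using p A0 by (metis abs_mult abs_one nonzero_eq_divide_eq less_irrefl)
  also have "\<dots> \<le> max_norm (genp_U A)"
    using m A by (intro abs_index_le_max_norm[of _ m m]) (auto simp: genp_U_def)
  \<comment> \<open>\<open>genp_U\<close> is the last of the iterates over which the maximum is
    taken.\<close>
  also have "\<dots> \<le> ?M" using m A by (intro Max_ge) (auto simp: genp_U_def)
  finally have M: "1 / max_norm A \<le> ?M" .
  have "genp_L A $$ (0, 0) = 1" using m A by (simp add: genp_L_def)
  then have L: "1 \<le> max_norm (genp_L A)"
    using abs_index_le_max_norm[of "genp_L A" m m 0 0] m A by (auto simp: genp_L_def)
  have pos: "0 < max_norm A" using Ale A0 by linarith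
  have "1 * (1 / max_norm A) \<le> max_norm (genp_L A) * ?M"
    using L M pos by (intro mult_mono) auto
  then have "1 * (1 / max_norm A) / max_norm A \<le> max_norm (genp_L A) * ?M / max_norm A"
    using pos by (intro divide_right_mono) auto
  then show ?thesis using A by (simp add: rho_def power2_eq_square)
qed

section \<open>Elimination of butterfly matrices with generic angles\<close>

lemma butterfly_genp:
  assumes "\<And>j. 1 \<le> j \<Longrightarrow> j \<le> n \<Longrightarrow> cos (\<theta> j) \<noteq> 0"
  shows "genp_ok (butterfly n \<theta>)"
    and "rho (butterfly n \<theta>) (1\<^sub>m (2 ^ n)) (1\<^sub>m (2 ^ n)) = (\<Prod>j=1..n. 1 + \<bar>tan (\<theta> j)\<bar>\<^sup>2)"
    and "rho_o (butterfly n \<theta>) (1\<^sub>m (2 ^ n)) (1\<^sub>m (2 ^ n)) = (\<Prod>j=1..n. 1 + 2 * \<bar>tan (\<theta> j)\<bar>\<^sup>2 / (1 + \<bar>tan (\<theta> j)\<bar>))"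
    and "rho_inf (butterfly n \<theta>) (1\<^sub>m (2 ^ n)) (1\<^sub>m (2 ^ n)) = (\<Prod>j=1..n. 1 + max \<bar>tan (\<theta> j)\<bar> (\<bar>tan (\<theta> j)\<bar>\<^sup>2))"
proof -
  interpret kron_blocks n "\<lambda>j. cos (\<theta> j)" "\<lambda>j. sin (\<theta> j)" "\<lambda>_. 1"
    by unfold_locales (auto simp: assms)
  have A: "butterfly n \<theta> = A"
    by (simp add: butterfly_kron_prod A_def rotation2_block)
  have t: "t j = \<bar>tan (\<theta> j)\<bar>" for j by (simp add: t_def tan_def)
  show "genp_ok (butterfly n \<theta>)" using genp_ok_LU by (simp add: A A_LU)
  have "1\<^sub>m (2 ^ n) * A * 1\<^sub>m (2 ^ n) = A" "dim_row A = 2 ^ n" using A_carrier by auto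
  note * = rho_blocks[OF this refl refl] rho_o_blocks[OF this refl refl] rho_inf_blocks[OF this refl refl]
  show "rho (butterfly n \<theta>) (1\<^sub>m (2 ^ n)) (1\<^sub>m (2 ^ n)) = (\<Prod>j=1..n. 1 + \<bar>tan (\<theta> j)\<bar>\<^sup>2)"
    "rho_o (butterfly n \<theta>) (1\<^sub>m (2 ^ n)) (1\<^sub>m (2 ^ n)) = (\<Prod>j=1..n. 1 + 2 * \<bar>tan (\<theta> j)\<bar>\<^sup>2 / (1 + \<bar>tan (\<theta> j)\<bar>))"
    "rho_inf (butterfly n \<theta>) (1\<^sub>m (2 ^ n)) (1\<^sub>m (2 ^ n)) = (\<Prod>j=1..n. 1 + max \<bar>tan (\<theta> j)\<bar> (\<bar>tan (\<theta> j)\<bar>\<^sup>2))"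
    using * unfolding A t by blast+
qed

text \<open>At |tan x| this is the smaller one of |tan x| and |cot x|; for tan x = 0 the convention
  1 / 0 = 0 gives the intended value 0.\<close>

definition fold_ratio :: "real \<Rightarrow> real" where
  "fold_ratio x = min x (1 / x)"

lemma butterfly_rook_lu:
  assumes c: "\<And>j. 1 \<le> j \<Longrightarrow> j \<le> n \<Longrightarrow> cos (\<theta> j) \<noteq> 0" "\<And>j. 1 \<le> j \<Longrightarrow> j \<le> n \<Longrightarrow> \<bar>sin (\<theta> j)\<bar> \<noteq> \<bar>cos (\<theta> j)\<bar>"
  defines "t \<equiv> \<lambda>j. fold_ratio \<bar>tan (\<theta> j)\<bar>"
  obtains L U \<rho> where "rook_lu (2 ^ n) L U \<rho> (butterfly n \<theta>)"
    "\<And>P Q. P * butterfly n \<theta> * Q = L * U \<Longrightarrow>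
      rho (butterfly n \<theta>) P Q = (\<Prod>j=1..n. 1 + (t j)\<^sup>2) \<and>
      rho_o (butterfly n \<theta>) P Q = (\<Prod>j=1..n. 1 + 2 * (t j)\<^sup>2 / (1 + t j)) \<and>
      rho_inf (butterfly n \<theta>) P Q = (\<Prod>j=1..n. 1 + max (t j) ((t j)\<^sup>2)) \<and>
      rho (butterfly n \<theta>) P Q = 1 / (max_norm (butterfly n \<theta>))\<^sup>2"
    "\<And>j. 1 \<le> j \<Longrightarrow> j \<le> n \<Longrightarrow> 0 \<le> t j \<and> t j \<le> 1"
proof -
  define s where "s j \<longleftrightarrow> \<bar>sin (\<theta> j)\<bar> < \<bar>cos (\<theta> j)\<bar>" for j
  \<comment> \<open>With its rows interchanged, the rotation has the rows (- sin, cos) and (cos,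
    sin), which is the block for a = - sin, b = cos and e = -1.\<close>
  define a where "a j = (if s j then cos (\<theta> j) else - sin (\<theta> j))" for j
  define b where "b j = (if s j then sin (\<theta> j) else cos (\<theta> j))" for j
  define e :: "nat \<Rightarrow> real" where "e j = (if s j then 1 else - 1)" for j
  have ba: "\<bar>b j\<bar> < \<bar>a j\<bar>" if "1 \<le> j" "j \<le> n" for j
    using c[OF that] by (auto simp: a_def b_def s_def)
  interpret K: kron_blocks n a b e
  proof
    fix j assume j: "1 \<le> j" "j \<le> n"
    show "a j \<noteq> 0" using ba[OF j] by auto
    show "(a j)\<^sup>2 + (b j)\<^sup>2 = 1" "\<bar>e j\<bar> = 1"
      by (auto simp: a_def b_def e_def)
  qed
  have t: "K.t j = t j" "0 \<le> t j" "t j < 1" if j: "1 \<le> j" "j \<le> n" for j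
  proof -
    have 1: "K.t j < 1" using ba[OF j] by (simp add: K.t_def)
    have tan: "\<bar>tan (\<theta> j)\<bar> = (if s j then K.t j else 1 / K.t j)"
      by (simp add: tan_def K.t_def a_def b_def)
    \<comment> \<open>Of the two candidates \<open>K.t j\<close> and its reciprocal, one is the
      tangent; folding selects \<open>K.t j\<close> in either case.\<close>
    have 2: "K.t j < 1 / K.t j" if "K.t j \<noteq> 0"
    proof -
      have "K.t j * K.t j < 1 * 1" using 1 by (intro mult_strict_mono') (auto simp: K.t_def)
      moreover have "K.t j > 0" using that by (simp add: K.t_def)
      ultimately show ?thesis by (simp add: field_simps)
    qed
    show "K.t j = t j" using 2 unfolding t_def fold_ratio_def tan
      by (cases "K.t j = 0") (auto simp: min_def)
    then show "0 \<le> t j" "t j < 1" using 1 abs_ge_zero[of "b j / a j"] unfolding K.t_def by simp_all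
  qed
  define \<sigma> :: "nat \<Rightarrow> nat \<Rightarrow> nat" where "\<sigma> j = (if s j then id else Transposition.transpose 0 1)" for j
  have sp: "\<sigma> j permutes {..<2}" for j
    unfolding \<sigma>_def by (auto intro!: permutes_id permutes_swap_id)
  have idx: "rotation2 (\<theta> j) $$ (p, q) = block (a j) (b j) (e j) $$ (\<sigma> j p, q)" if "p < 2" "q < 2" for j p q
    using that by (auto elim!: less_2E simp: rotation2_block \<sigma>_def a_def b_def e_def transpose_def)
  obtain \<rho> where \<rho>: "\<rho> permutes {..<2 ^ n}"
    and B: "butterfly n \<theta> = mat (2 ^ n) (2 ^ n) (\<lambda>(i, j). K.A $$ (\<rho> i, j))"
    using kron_prod_row_permute[of n "\<lambda>j. rotation2 (\<theta> j)" "\<lambda>j. block (a j) (b j) (e j)" \<sigma>] sp idx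
    unfolding butterfly_kron_prod K.A_def by (auto simp: rotation2_block)
  have norms: "max_norm (butterfly n \<theta>) = max_norm K.A" "inf_norm (butterfly n \<theta>) = inf_norm K.A"
    using max_norm_permute[OF K.A_carrier \<rho> permutes_id] inf_norm_permute[OF K.A_carrier \<rho>] by (simp_all add: B)
  have rook: "rook_lu (2 ^ n) K.L K.U \<rho> (butterfly n \<theta>)"
  proof
    show "\<rho> permutes {..<2 ^ n}" by fact
    show "butterfly n \<theta> = mat (2 ^ n) (2 ^ n) (\<lambda>(i, j). (K.L * K.U) $$ (\<rho> i, j))" using B by (simp only: K.A_LU)
    show "\<bar>K.L $$ (i, j)\<bar> < 1" if "j < i" "i < 2 ^ n" for i j
    proof -
      have "\<bar>block_L (a j) (b j) (e j) $$ (p, q)\<bar> < 1" if "1 \<le> j" "j \<le> n" "p < 2" "q < 2" "p \<noteq> q" for j p q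
        using that ba[of j] by (auto elim!: less_2E simp: e_def)
      moreover have "block_L (a j) (b j) (e j) $$ (p, p) = 1" if "p < 2" for j p
        using that by (auto elim!: less_2E)
      ultimately show ?thesis
        using kron_prod_offdiag_less[of n "\<lambda>j. block_L (a j) (b j) (e j)" i j] that
        by (auto simp: K.L_def)
    qed
    show "\<bar>K.U $$ (i, j)\<bar> \<le> \<bar>K.U $$ (i, i)\<bar>" if "i < 2 ^ n" "j < 2 ^ n" for i j
      unfolding K.U_def
    proof (rule kron_prod_row_dominant)
      fix j p q assume "1 \<le> j" "j \<le> n" "p < (2::nat)" "q < (2::nat)"
      then show "\<bar>block_U (a j) (b j) (e j) $$ (p, q)\<bar> \<le> \<bar>block_U (a j) (b j) (e j) $$ (p, p)\<bar>"
        using ba[of j] by (auto elim!: less_2E)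
    qed (use that in auto)
  qed
  show thesis
  proof (rule that[OF rook])
    fix P Q assume "P * butterfly n \<theta> * Q = K.L * K.U"
    then have PBQ: "P * butterfly n \<theta> * Q = K.A" by (simp add: K.A_LU)
    have d: "dim_row (butterfly n \<theta>) = 2 ^ n" using butterfly_carrier by blast
    \<comment> \<open>Because |b_j| < |a_j|, the max-norm is the product of the |a_j|. This puts
      \<open>rho\<close> into the form 1 / (max-norm)^2, the value of the lower bound valid for all
      strategies.\<close>
    have "max_norm K.A = (\<Prod>j=1..n. \<bar>a j\<bar>)"
      unfolding K.A_def max_norm_kron_prod[OF block_carrier(1)]
    proof (rule prod.cong[OF refl])
      fix j assume j: "j \<in> {1..n}"
      then interpret C: block_params "a j" "b j" "e j" using K.params by simp
      have "C.t < 1" using ba[of j] j by (simp add: C.t_def)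
      then show "max_norm (block (a j) (b j) (e j)) = \<bar>a j\<bar>" by (simp add: C.max_norm_block)
    qed
    moreover have "(\<Prod>j=1..n. 1 + (K.t j)\<^sup>2) = (\<Prod>j=1..n. 1 / (\<bar>a j\<bar> * \<bar>a j\<bar>))"
    proof (rule prod.cong[OF refl])
      fix j assume j: "j \<in> {1..n}"
      then interpret C: block_params "a j" "b j" "e j" using K.params by simp
      show "1 + (K.t j)\<^sup>2 = 1 / (\<bar>a j\<bar> * \<bar>a j\<bar>)" using C.one_t by (simp only: C.t_def K.t_def)
    qed
    ultimately have m: "(\<Prod>j=1..n. 1 + (K.t j)\<^sup>2) = 1 / (max_norm (butterfly n \<theta>))\<^sup>2"
      by (simp add: norms prod_dividef prod.distrib power2_eq_square del: abs_mult_self_eq)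
    have "K.t j = t j" if "j \<in> {1..n}" for j using t that by auto
    then show "rho (butterfly n \<theta>) P Q = (\<Prod>j=1..n. 1 + (t j)\<^sup>2) \<and>
      rho_o (butterfly n \<theta>) P Q = (\<Prod>j=1..n. 1 + 2 * (t j)\<^sup>2 / (1 + t j)) \<and>
      rho_inf (butterfly n \<theta>) P Q = (\<Prod>j=1..n. 1 + max (t j) ((t j)\<^sup>2)) \<and>
      rho (butterfly n \<theta>) P Q = 1 / (max_norm (butterfly n \<theta>))\<^sup>2"
      using K.rho_blocks[OF PBQ d norms] K.rho_o_blocks[OF PBQ d norms] K.rho_inf_blocks[OF PBQ d norms] m by simp
  qed (use t in \<open>auto intro: less_imp_le\<close>)
qed

text \<open>Nonzero cosines keep the pivots of GENP away from 0; different magnitudes of sine and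
  cosine exclude ties in partial pivoting.\<close>

definition generic_angles :: "nat \<Rightarrow> (nat \<Rightarrow> real) \<Rightarrow> bool" where
  "generic_angles n \<theta> \<longleftrightarrow> (\<forall>j\<in>{1..n}. cos (\<theta> j) \<noteq> 0 \<and> \<bar>sin (\<theta> j)\<bar> \<noteq> \<bar>cos (\<theta> j)\<bar>)"

lemma growth_order:
  fixes t :: real
  assumes "0 \<le> t"
  shows "1 \<le> 1 + t\<^sup>2" "1 + t\<^sup>2 \<le> 1 + max t (t\<^sup>2)" "1 \<le> 1 + 2 * t\<^sup>2 / (1 + t)"
    "1 + 2 * t\<^sup>2 / (1 + t) \<le> 1 + max t (t\<^sup>2)"
    "t \<le> 1 \<Longrightarrow> 1 + t\<^sup>2 \<le> 1 + 2 * t\<^sup>2 / (1 + t)" "t \<le> 1 \<Longrightarrow> 1 + max t (t\<^sup>2) \<le> 2"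
proof -
  show "1 + 2 * t\<^sup>2 / (1 + t) \<le> 1 + max t (t\<^sup>2)"
  proof (cases "t \<le> 1")
    case True
    then have "t * t \<le> t * 1" using assms by (intro mult_left_mono)
    then have "2 * t\<^sup>2 / (1 + t) \<le> t" using assms by (simp add: divide_le_eq power2_eq_square algebra_simps)
    then show ?thesis by simp
  next
    case False
    then have "t\<^sup>2 * 1 \<le> t\<^sup>2 * t" by (intro mult_left_mono) auto
    then have "2 * t\<^sup>2 / (1 + t) \<le> t\<^sup>2" using assms by (simp add: divide_le_eq algebra_simps)
    then show ?thesis by simp
  qed
  show "1 + t\<^sup>2 \<le> 1 + 2 * t\<^sup>2 / (1 + t)" if "t \<le> 1"
  proof -
    have "t\<^sup>2 * t \<le> t\<^sup>2 * 1" using that by (intro mult_left_mono) auto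
    then show ?thesis using assms by (simp add: le_divide_eq algebra_simps)
  qed
  show "1 + max t (t\<^sup>2) \<le> 2" if "t \<le> 1"
    using that assms power_le_one[of t 2] by simp
qed (use assms in auto)

lemma gepp_butterfly:
  assumes g: "generic_angles n \<theta>"
  defines "t \<equiv> \<lambda>j. fold_ratio \<bar>tan (\<theta> j)\<bar>" and "B \<equiv> butterfly n \<theta>"
  shows "\<exists>L U. \<forall>R. permutation_mat (2 ^ n) R \<longrightarrow>
        (\<exists>P. gepp (R * B) P) \<and>
        (\<forall>P. gepp (R * B) P \<longrightarrow>
           permutation_mat (2 ^ n) P \<and> genp_ok (P * (R * B)) \<and>
           lu_factorization (P * (R * B)) L U \<and>
           genp_L (P * (R * B)) = L \<and> genp_U (P * (R * B)) = U)"
    and "\<And>P Q. gerp B P Q \<longleftrightarrow> gepp B P \<and> Q = 1\<^sub>m (2 ^ n)"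
    and "\<And>P. gepp B P \<Longrightarrow>
      rho B P (1\<^sub>m (2 ^ n)) = (\<Prod>j=1..n. 1 + (t j)\<^sup>2) \<and>
      rho_o B P (1\<^sub>m (2 ^ n)) = (\<Prod>j=1..n. 1 + 2 * (t j)\<^sup>2 / (1 + t j)) \<and>
      rho_inf B P (1\<^sub>m (2 ^ n)) = (\<Prod>j=1..n. 1 + max (t j) ((t j)\<^sup>2)) \<and>
      rho B P (1\<^sub>m (2 ^ n)) = 1 / (max_norm B)\<^sup>2"
    and "\<And>j. 1 \<le> j \<Longrightarrow> j \<le> n \<Longrightarrow> 0 \<le> t j \<and> t j \<le> 1"
proof -
  obtain L U \<rho> where rook: "rook_lu (2 ^ n) L U \<rho> B"
    and growth: "\<And>P Q. P * B * Q = L * U \<Longrightarrow>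
      rho B P Q = (\<Prod>j=1..n. 1 + (t j)\<^sup>2) \<and>
      rho_o B P Q = (\<Prod>j=1..n. 1 + 2 * (t j)\<^sup>2 / (1 + t j)) \<and>
      rho_inf B P Q = (\<Prod>j=1..n. 1 + max (t j) ((t j)\<^sup>2)) \<and>
      rho B P Q = 1 / (max_norm B)\<^sup>2"
    and t: "\<And>j. 1 \<le> j \<Longrightarrow> j \<le> n \<Longrightarrow> 0 \<le> t j \<and> t j \<le> 1"
    unfolding t_def B_def by (rule butterfly_rook_lu[of n \<theta>]) (use g in \<open>auto simp: generic_angles_def\<close>)
  interpret R: rook_lu "2 ^ n" L U \<rho> B by fact
  show "\<And>j. 1 \<le> j \<Longrightarrow> j \<le> n \<Longrightarrow> 0 \<le> t j \<and> t j \<le> 1" by fact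
  show "\<And>P Q. gerp B P Q \<longleftrightarrow> gepp B P \<and> Q = 1\<^sub>m (2 ^ n)" by (rule R.gerp_iff)
  show "rho B P (1\<^sub>m (2 ^ n)) = (\<Prod>j=1..n. 1 + (t j)\<^sup>2) \<and>
      rho_o B P (1\<^sub>m (2 ^ n)) = (\<Prod>j=1..n. 1 + 2 * (t j)\<^sup>2 / (1 + t j)) \<and>
      rho_inf B P (1\<^sub>m (2 ^ n)) = (\<Prod>j=1..n. 1 + max (t j) ((t j)\<^sup>2)) \<and>
      rho B P (1\<^sub>m (2 ^ n)) = 1 / (max_norm B)\<^sup>2" if "gepp B P" for P
  proof (rule growth)
    show "P * B * 1\<^sub>m (2 ^ n) = L * U"
      using that R.perm_mat_inv_mult right_mult_one_mat[OF R.LU_carrier] by (simp add: R.gepp_iff)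
  qed
  show "\<exists>L U. \<forall>R. permutation_mat (2 ^ n) R \<longrightarrow>
        (\<exists>P. gepp (R * B) P) \<and>
        (\<forall>P. gepp (R * B) P \<longrightarrow>
           permutation_mat (2 ^ n) P \<and> genp_ok (P * (R * B)) \<and>
           lu_factorization (P * (R * B)) L U \<and>
           genp_L (P * (R * B)) = L \<and> genp_U (P * (R * B)) = U)"
  proof (rule exI[of _ L], rule exI[of _ U], intro allI impI)
    fix S assume "permutation_mat (2 ^ n) S"
    then obtain r where r: "r permutes {..<2 ^ n}" "S = perm_mat (2 ^ n) r" by (rule permutation_matE)
    have "S * B = mat (2 ^ n) (2 ^ n) (\<lambda>(i, j). B $$ (r i, j))"
      unfolding r(2) by (rule perm_mat_mult[OF r(1)]) (simp add: B_def)
    also have "\<dots> = mat (2 ^ n) (2 ^ n) (\<lambda>(i, j). (L * U) $$ ((\<rho> \<circ> r) i, j))"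
      unfolding R.B_def using permutes_less[OF r(1)] by (intro eq_matI) auto
    finally have SB: "S * B = mat (2 ^ n) (2 ^ n) (\<lambda>(i, j). (L * U) $$ ((\<rho> \<circ> r) i, j))" .
    \<comment> \<open>Permuting the rows of \<open>B\<close> yields another row permutation of the
      same \<open>L * U\<close>: only \<rho> changes, so the factors do not depend on the order of
      the rows.\<close>
    interpret S: pivoted_lu "2 ^ n" L U "\<rho> \<circ> r" "S * B"
    proof unfold_locales
      show "\<rho> \<circ> r permutes {..<2 ^ n}" using r(1) R.\<rho> by (rule permutes_compose)
    qed (use R.L_less SB in auto)
    show "(\<exists>P. gepp (S * B) P) \<and> (\<forall>P. gepp (S * B) P \<longrightarrow>
           permutation_mat (2 ^ n) P \<and> genp_ok (P * (S * B)) \<and>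
           lu_factorization (P * (S * B)) L U \<and>
           genp_L (P * (S * B)) = L \<and> genp_U (P * (S * B)) = U)"
      unfolding S.gepp_iff
      using S.perm_mat_inv_mult permutation_mat_perm_mat[OF permutes_inv[OF S.\<rho>]]
        R.genp_ok_LU R.genp_L_LU R.genp_U_LU R.lu_factorization_LU by simp
  qed
qed

text \<open>Permuting rows and columns changes neither the max-norm nor the orthonormality of the
  rows, so the lower bound is the same number for all \<open>P\<close> and \<open>Q\<close>.\<close>

lemma rho_permuted_butterfly_ge:
  assumes "permutation_mat (2 ^ n) P" "permutation_mat (2 ^ n) Q" "genp_ok (P * butterfly n \<theta> * Q)"
  shows "rho (P * butterfly n \<theta> * Q) (1\<^sub>m (2 ^ n)) (1\<^sub>m (2 ^ n)) \<ge> 1 / (max_norm (butterfly n \<theta>))\<^sup>2"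
proof -
  let ?m = "2 ^ n :: nat" and ?B = "butterfly n \<theta>"
  obtain \<rho> where \<rho>: "\<rho> permutes {..<?m}" "P = perm_mat ?m \<rho>" using assms(1) by (rule permutation_matE)
  obtain \<sigma> where \<sigma>: "\<sigma> permutes {..<?m}" "Q = perm_mat ?m \<sigma>" using assms(2) by (rule permutation_matE)
  let ?s = "Hilbert_Choice.inv \<sigma>"
  have s: "?s permutes {..<?m}" by (rule permutes_inv[OF \<sigma>(1)])
  have "P * ?B * Q = mat ?m ?m (\<lambda>(i, j). (P * ?B) $$ (i, ?s j))"
    unfolding \<sigma>(2) by (rule mult_perm_mat[OF \<sigma>(1)]) (use \<rho> in \<open>auto intro!: mult_carrier_mat\<close>)
  also have "\<dots> = mat ?m ?m (\<lambda>(i, j). ?B $$ (\<rho> i, ?s j))"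
    unfolding \<rho>(2) perm_mat_mult[OF \<rho>(1) butterfly_carrier] using permutes_less[OF s] by (intro eq_matI) auto
  finally have eq: "P * ?B * Q = mat ?m ?m (\<lambda>(i, j). ?B $$ (\<rho> i, ?s j))" .
  have "max_norm (P * ?B * Q) = max_norm ?B"
    unfolding eq by (rule max_norm_permute[OF butterfly_carrier \<rho>(1) s])
  moreover have "orthonormal_rows ?m (P * ?B * Q)"
    unfolding eq by (rule orthonormal_rows_permute[OF orthonormal_rows_butterfly \<rho>(1) s])
  ultimately show ?thesis
    using rho_genp_orthonormal_ge[of "P * ?B * Q" ?m] assms(3) by (auto simp: eq)
qed

subsection \<open>Laws of the tangents\<close>

abbreviation unif :: "real measure" where
  "unif \<equiv> uniform_measure lborel {0..<2 * pi}"

lemma prob_space_unif: "prob_space unif"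
  by (rule prob_space_uniform_measure) auto

lemma nn_integral_reflect:
  fixes f :: "real \<Rightarrow> ennreal"
  assumes [measurable]: "f \<in> borel_measurable borel"
  shows "(\<integral>\<^sup>+x. f (s - x) \<partial>lborel) = (\<integral>\<^sup>+x. f x \<partial>lborel)"
  using nn_integral_real_affine[of f "-1" s] by simp

text \<open>Reflection about s / 2, whose midpoint is a null set. The values of s that occur are 2
  pi and pi for |tan|, and pi / 2 for the folded tangent.\<close>

lemma nn_integral_halve:
  fixes f :: "real \<Rightarrow> ennreal"
  assumes [measurable]: "f \<in> borel_measurable borel" and sym: "\<And>x. f (s - x) = f x" and s: "s > 0"
  shows "(\<integral>\<^sup>+x. f x * indicator {0<..<s} x \<partial>lborel) = 2 * (\<integral>\<^sup>+x. f x * indicator {0<..<s / 2} x \<partial>lborel)"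
proof -
  have "AE x in lborel. x \<noteq> s / 2" by (rule AE_lborel_singleton)
  then have "(\<integral>\<^sup>+x. f x * indicator {0<..<s} x \<partial>lborel) =
      (\<integral>\<^sup>+x. f x * indicator {0<..<s / 2} x + f x * indicator {s / 2<..<s} x \<partial>lborel)"
    using s by (intro nn_integral_cong_AE) (auto split: split_indicator)
  also have "\<dots> = (\<integral>\<^sup>+x. f x * indicator {0<..<s / 2} x \<partial>lborel) + (\<integral>\<^sup>+x. f x * indicator {s / 2<..<s} x \<partial>lborel)"
    by (rule nn_integral_add) auto
  also have "(\<integral>\<^sup>+x. f x * indicator {s / 2<..<s} x \<partial>lborel) = (\<integral>\<^sup>+x. f (s - x) * indicator {s / 2<..<s} (s - x) \<partial>lborel)"
    by (rule nn_integral_reflect[symmetric]) auto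
  also have "\<dots> = (\<integral>\<^sup>+x. f x * indicator {0<..<s / 2} x \<partial>lborel)"
    by (intro nn_integral_cong) (auto simp: sym split: split_indicator)
  finally show ?thesis by (simp add: mult_2)
qed

lemma nn_integral_even:
  fixes f :: "real \<Rightarrow> ennreal"
  assumes [measurable]: "f \<in> borel_measurable borel" and sym: "\<And>x. f (- x) = f x"
  shows "(\<integral>\<^sup>+x. f x \<partial>lborel) = 2 * (\<integral>\<^sup>+x. f x * indicator {0<..} x \<partial>lborel)"
proof -
  have "AE x in lborel. x \<noteq> (0::real)" by (rule AE_lborel_singleton)
  then have "(\<integral>\<^sup>+x. f x \<partial>lborel) =
      (\<integral>\<^sup>+x. f x * indicator {0<..} x + f x * indicator {..<0} x \<partial>lborel)"
    by (intro nn_integral_cong_AE) (auto split: split_indicator)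
  also have "\<dots> = (\<integral>\<^sup>+x. f x * indicator {0<..} x \<partial>lborel) + (\<integral>\<^sup>+x. f x * indicator {..<0} x \<partial>lborel)"
    by (rule nn_integral_add) auto
  also have "(\<integral>\<^sup>+x. f x * indicator {..<0} x \<partial>lborel) = (\<integral>\<^sup>+x. f (0 - x) * indicator {..<0} (0 - x) \<partial>lborel)"
    by (rule nn_integral_reflect[symmetric]) auto
  also have "\<dots> = (\<integral>\<^sup>+x. f x * indicator {0<..} x \<partial>lborel)"
    by (intro nn_integral_cong) (auto simp: sym split: split_indicator)
  finally show ?thesis by (simp add: mult_2)
qed

lemma borel_measurable_tan [measurable]: "(tan :: real \<Rightarrow> real) \<in> borel_measurable borel"
  unfolding tan_def by measurable

text \<open>The derivative of arctan is the Cauchy weight 1 / (1 + x^2). Stopping at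
  \<open>arctan y\<close> stays away from the pole of tan.\<close>

lemma nn_integral_tan_bounded:
  fixes g :: "real \<Rightarrow> ennreal"
  assumes [measurable]: "g \<in> borel_measurable borel" and y: "y > 0"
  shows "(\<integral>\<^sup>+x. g (tan x) * indicator {0<..<arctan y} x \<partial>lborel) =
    (\<integral>\<^sup>+x. g x * ennreal (1 / (1 + x\<^sup>2)) * indicator {0<..<y} x \<partial>lborel)"
proof -
  have ae: "AE x in lborel. x \<noteq> u \<and> x \<noteq> (v::real)" for u v
    using AE_lborel_singleton[of u] AE_lborel_singleton[of v] by eventually_elim auto
  have "(\<integral>\<^sup>+x. g (tan x) * indicator {0<..<arctan y} x \<partial>lborel) =
      (\<integral>\<^sup>+x. g (tan x) * indicator {arctan 0..arctan y} x \<partial>lborel)"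
  proof (rule nn_integral_cong_AE)
    show "AE x in lborel. g (tan x) * indicator {0<..<arctan y} x = g (tan x) * indicator {arctan 0..arctan y} x"
      using ae[of 0 "arctan y"] by eventually_elim (auto split: split_indicator)
  qed
  also have "\<dots> = (\<integral>\<^sup>+x. g (tan (arctan x)) * ennreal (1 / (1 + x\<^sup>2)) * indicator {0..y} x \<partial>lborel)"
  proof (rule nn_integral_substitution_aux)
    show "(arctan has_real_derivative 1 / (1 + x\<^sup>2)) (at x)" for x :: real
      using DERIV_arctan[of x] by (simp add: inverse_eq_divide)
    have "1 + x\<^sup>2 \<noteq> 0" for x :: real using zero_le_power2[of x] by linarith
    then show "continuous_on {0..y} (\<lambda>x. 1 / (1 + x\<^sup>2))" by (intro continuous_intros) simp
  qed (use y in \<open>auto simp: add_nonneg_nonneg\<close>)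
  also have "\<dots> = (\<integral>\<^sup>+x. g x * ennreal (1 / (1 + x\<^sup>2)) * indicator {0<..<y} x \<partial>lborel)"
  proof (rule nn_integral_cong_AE)
    show "AE x in lborel. g (tan (arctan x)) * ennreal (1 / (1 + x\<^sup>2)) * indicator {0..y} x =
        g x * ennreal (1 / (1 + x\<^sup>2)) * indicator {0<..<y} x"
      using ae[of 0 y] by eventually_elim (auto simp: tan_arctan split: split_indicator)
  qed
  finally show ?thesis .
qed

lemma nn_integral_tan:
  fixes g :: "real \<Rightarrow> ennreal"
  assumes g [measurable]: "g \<in> borel_measurable borel"
  shows "(\<integral>\<^sup>+x. g (tan x) * indicator {0<..<pi / 2} x \<partial>lborel) =
    (\<integral>\<^sup>+x. g x * ennreal (1 / (1 + x\<^sup>2)) * indicator {0<..} x \<partial>lborel)"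
proof -
  \<comment> \<open>Both integrals are read as measures of an interval, so that letting the endpoint
    grow becomes continuity from below along increasing unions.\<close>
  let ?D = "density lborel (\<lambda>x. g (tan x))" and ?E = "density lborel (\<lambda>x. g x * ennreal (1 / (1 + x\<^sup>2)))"
  have D: "emeasure ?D S = (\<integral>\<^sup>+x. g (tan x) * indicator S x \<partial>lborel)" if "S \<in> sets borel" for S
    using that by (intro emeasure_density) auto
  have E: "emeasure ?E S = (\<integral>\<^sup>+x. g x * ennreal (1 / (1 + x\<^sup>2)) * indicator S x \<partial>lborel)" if "S \<in> sets borel" for S
    using that by (intro emeasure_density) auto
  have U1: "(\<Union>k. {0<..<arctan (Suc k)}) = {0<..<pi / 2}"
  proof (intro equalityI subsetI)
    fix x assume "x \<in> (\<Union>k. {0<..<arctan (Suc k)})"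
    then obtain k where "0 < x" "x < arctan (Suc k)" by auto
    then show "x \<in> {0<..<pi / 2}" using arctan_ubound[of "Suc k"] by auto
  next
    fix x assume x: "x \<in> {0<..<pi / 2}"
    obtain k where "tan x < real k" using reals_Archimedean2 by blast
    then have "tan x < real (Suc k)" by simp
    then have "arctan (tan x) < arctan (Suc k)" by (simp only: arctan_less_iff)
    moreover have "arctan (tan x) = x" using x by (intro arctan_tan) auto
    ultimately show "x \<in> (\<Union>k. {0<..<arctan (Suc k)})" using x by auto
  qed
  have U2: "(\<Union>k. {0<..<real (Suc k)}) = {0<..}"
  proof (intro equalityI subsetI)
    fix x :: real assume x: "x \<in> {0<..}"
    obtain k where "x < real k" using reals_Archimedean2 by blast
    then show "x \<in> (\<Union>k. {0<..<real (Suc k)})" using x by (intro UN_I[of k]) auto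
  qed auto
  have "emeasure ?D {0<..<pi / 2} = (SUP k. emeasure ?D {0<..<arctan (Suc k)})"
    unfolding U1[symmetric]
  proof (rule SUP_emeasure_incseq[symmetric])
    show "incseq (\<lambda>k. {0<..<arctan (real (Suc k))})"
    proof (rule incseq_SucI)
      fix k
      have "arctan (real (Suc k)) \<le> arctan (real (Suc (Suc k)))" by (simp add: arctan_le_iff)
      then show "{0<..<arctan (real (Suc k))} \<subseteq> {0<..<arctan (real (Suc (Suc k)))}"
        by (auto simp del: of_nat_Suc)
    qed
  qed auto
  also have "\<dots> = (SUP k. emeasure ?E {0<..<real (Suc k)})"
    using nn_integral_tan_bounded[OF g] by (simp add: D E)
  also have "\<dots> = emeasure ?E {0<..}"
    unfolding U2[symmetric] by (rule SUP_emeasure_incseq) (auto simp: incseq_def)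
  finally show ?thesis by (simp add: D E)
qed

lemma emeasure_distr_unif:
  assumes [measurable]: "h \<in> borel_measurable borel" "S \<in> sets borel"
  shows "emeasure (distr unif borel h) S =
    ennreal (1 / (2 * pi)) * (\<integral>\<^sup>+x. indicator S (h x) * indicator {0<..<2 * pi} x \<partial>lborel)"
proof -
  have "emeasure (distr unif borel h) S = emeasure unif (h -` S)"
    by (subst emeasure_distr) auto
  also have "\<dots> = emeasure lborel ({0..<2 * pi} \<inter> h -` S) / ennreal (2 * pi)"
    using measurable_sets[OF assms] by (subst emeasure_uniform_measure) auto
  also have "emeasure lborel ({0..<2 * pi} \<inter> h -` S) = (\<integral>\<^sup>+x. indicator ({0..<2 * pi} \<inter> h -` S) x \<partial>lborel)"
    using measurable_sets[OF assms] by (intro nn_integral_indicator[symmetric]) auto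
  also have "\<dots> = (\<integral>\<^sup>+x. indicator S (h x) * indicator {0<..<2 * pi} x \<partial>lborel)"
  proof (rule nn_integral_cong_AE)
    show "AE x in lborel. (indicator ({0..<2 * pi} \<inter> h -` S) x :: ennreal) = indicator S (h x) * indicator {0<..<2 * pi} x"
      using AE_lborel_singleton[of 0] by eventually_elim (auto split: split_indicator)
  qed
  finally show ?thesis
    by (simp add: divide_ennreal_def inverse_ennreal mult.commute inverse_eq_divide)
qed

lemma abs_tan_reflect: "\<bar>tan (pi - x)\<bar> = \<bar>tan x\<bar>" "\<bar>tan (2 * pi - x)\<bar> = \<bar>tan (x::real)\<bar>"
  by (simp_all add: tan_def sin_diff cos_diff)

text \<open>Two halvings reduce (0, 2 pi) to (0, pi / 2), where tan is positive; the constant is 4 /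
  (2 pi). The map \<open>h\<close> is kept general to cover the plain and the folded
  tangent.\<close>

lemma emeasure_abs_tan:
  assumes [measurable]: "h \<in> borel_measurable borel" "S \<in> sets borel"
  shows "emeasure (distr unif borel (\<lambda>x. h \<bar>tan x\<bar>)) S =
    ennreal (2 / pi) * (\<integral>\<^sup>+x. indicator S (h (tan x)) * indicator {0<..<pi / 2} x \<partial>lborel)"
proof -
  let ?f = "\<lambda>x. indicator S (h \<bar>tan x\<bar>) :: ennreal"
  have "(\<integral>\<^sup>+x. ?f x * indicator {0<..<2 * pi} x \<partial>lborel) = 2 * (\<integral>\<^sup>+x. ?f x * indicator {0<..<2 * pi / 2} x \<partial>lborel)"
    by (rule nn_integral_halve) (simp_all only: abs_tan_reflect, auto)
  also have "2 * pi / 2 = pi" by simp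
  also have "(\<integral>\<^sup>+x. ?f x * indicator {0<..<pi} x \<partial>lborel) = 2 * (\<integral>\<^sup>+x. ?f x * indicator {0<..<pi / 2} x \<partial>lborel)"
    by (rule nn_integral_halve) (simp_all only: abs_tan_reflect, auto)
  also have "(\<integral>\<^sup>+x. ?f x * indicator {0<..<pi / 2} x \<partial>lborel) =
      (\<integral>\<^sup>+x. indicator S (h (tan x)) * indicator {0<..<pi / 2} x \<partial>lborel)" (is "_ = ?I")
    by (intro nn_integral_cong) (auto split: split_indicator simp: tan_gt_zero abs_of_pos)
  finally have "emeasure (distr unif borel (\<lambda>x. h \<bar>tan x\<bar>)) S = ennreal (1 / (2 * pi)) * (2 * (2 * ?I))"
    by (subst emeasure_distr_unif) simp_all
  also have "2 * (2 * ?I) = ennreal 4 * ?I" by (simp add: mult.assoc[symmetric])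
  also have "ennreal (1 / (2 * pi)) * \<dots> = (ennreal (1 / (2 * pi)) * ennreal 4) * ?I"
    by (rule mult.assoc[symmetric])
  also have "ennreal (1 / (2 * pi)) * ennreal 4 = ennreal (2 / pi)"
    by (simp add: ennreal_mult'[symmetric] del: ennreal_numeral)
  finally show ?thesis .
qed

lemma borel_measurable_fold_ratio [measurable]: "fold_ratio \<in> borel_measurable borel"
  unfolding fold_ratio_def by measurable

text \<open>Complementary angles have reciprocal tangents, which \<open>fold_ratio\<close> does not
  distinguish. One more halving leaves (0, pi / 4), where \<open>fold_ratio\<close> of the tangent
  is the tangent itself.\<close>

lemma emeasure_fold_ratio_tan:
  assumes [measurable]: "S \<in> sets borel"
  shows "emeasure (distr unif borel (\<lambda>x. fold_ratio \<bar>tan x\<bar>)) S =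
    ennreal (2 / pi) * (2 * (\<integral>\<^sup>+x. indicator S (tan x) * indicator {0<..<pi / 4} x \<partial>lborel))"
proof -
  let ?f = "\<lambda>x. indicator S (fold_ratio (tan x)) :: ennreal"
  have sym: "?f (pi / 2 - x) = ?f x" for x
  proof -
    have "tan (pi / 2 - x) = 1 / tan x"
      by (simp add: tan_def sin_diff cos_diff)
    then show ?thesis by (simp add: fold_ratio_def min.commute)
  qed
  have "(\<integral>\<^sup>+x. ?f x * indicator {0<..<pi / 2} x \<partial>lborel) = 2 * (\<integral>\<^sup>+x. ?f x * indicator {0<..<pi / 2 / 2} x \<partial>lborel)"
    by (rule nn_integral_halve) (simp_all only: sym, auto)
  also have "(\<integral>\<^sup>+x. ?f x * indicator {0<..<pi / 2 / 2} x \<partial>lborel) =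
      (\<integral>\<^sup>+x. indicator S (tan x) * indicator {0<..<pi / 4} x \<partial>lborel)"
  proof (rule nn_integral_cong)
    fix x :: real
    have "fold_ratio (tan x) = tan x" if "x \<in> {0<..<pi / 4}"
    proof -
      have "0 < tan x" using that by (intro tan_gt_zero) auto
      moreover have "tan x < 1"
        using tan_monotone[of x "pi / 4"] that by (simp add: tan_45)
      ultimately have "tan x * tan x < 1 * 1" by (intro mult_strict_mono) auto
      then show ?thesis using \<open>0 < tan x\<close> by (simp add: fold_ratio_def min_def field_simps)
    qed
    then show "?f x * indicator {0<..<pi / 2 / 2} x = indicator S (tan x) * indicator {0<..<pi / 4} x"
      by (cases "x \<in> {0<..<pi / 4}") auto
  qed
  finally show ?thesis by (subst emeasure_abs_tan) simp_all
qed

section \<open>The Cauchy law and its conditional law\<close>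

lemma emeasure_abs_cauchy:
  assumes X: "distributed M lborel X (\<lambda>x. ennreal (cauchy_density x))" and [measurable]: "S \<in> sets borel"
  shows "emeasure (distr M borel (\<lambda>\<omega>. \<bar>X \<omega>\<bar>)) S =
    ennreal (2 / pi) * (\<integral>\<^sup>+x. indicator S x * ennreal (1 / (1 + x\<^sup>2)) * indicator {0<..} x \<partial>lborel)"
proof -
  have [measurable]: "X \<in> borel_measurable M" using distributed_measurable[OF X] by simp
  have [measurable]: "cauchy_density \<in> borel_measurable borel" unfolding cauchy_density_def by measurable
  have abs: "(abs :: real \<Rightarrow> real) -` S \<in> sets borel"
    using measurable_sets[of "abs :: real \<Rightarrow> real" borel borel S] by simp
  have "emeasure (distr M borel (\<lambda>\<omega>. \<bar>X \<omega>\<bar>)) S = emeasure M (X -` (abs -` S) \<inter> space M)"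
    by (subst emeasure_distr) (auto intro!: arg_cong[where f = "emeasure M"])
  also have "\<dots> = (\<integral>\<^sup>+x. ennreal (cauchy_density x) * indicator (abs -` S) x \<partial>lborel)"
    using abs by (intro distributed_emeasure[OF X]) simp
  also have "\<dots> = 2 * (\<integral>\<^sup>+x. ennreal (cauchy_density x) * indicator (abs -` S) x * indicator {0<..} x \<partial>lborel)"
    using abs by (intro nn_integral_even) (auto simp: cauchy_density_def indicator_def)
  also have "(\<integral>\<^sup>+x. ennreal (cauchy_density x) * indicator (abs -` S) x * indicator {0<..} x \<partial>lborel) =
      (\<integral>\<^sup>+x. ennreal (1 / pi) * (indicator S x * ennreal (1 / (1 + x\<^sup>2)) * indicator {0<..} x) \<partial>lborel)"
    by (intro nn_integral_cong)
      (auto simp: cauchy_density_def ennreal_mult'[symmetric] add_nonneg_nonneg split: split_indicator)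
  also have "\<dots> = ennreal (1 / pi) * (\<integral>\<^sup>+x. indicator S x * ennreal (1 / (1 + x\<^sup>2)) * indicator {0<..} x \<partial>lborel)"
    by (rule nn_integral_cmult) measurable
  also have "2 * \<dots> = (ennreal 2 * ennreal (1 / pi)) * (\<integral>\<^sup>+x. indicator S x * ennreal (1 / (1 + x\<^sup>2)) * indicator {0<..} x \<partial>lborel)"
    by (simp add: mult.assoc)
  also have "ennreal 2 * ennreal (1 / pi) = ennreal (2 / pi)"
    by (simp add: ennreal_mult'[symmetric] del: ennreal_numeral)
  finally show ?thesis .
qed

lemma distr_abs_cauchy:
  assumes X: "distributed M lborel X (\<lambda>x. ennreal (cauchy_density x))"
  shows "distr M borel (\<lambda>\<omega>. \<bar>X \<omega>\<bar>) = distr unif borel (\<lambda>x. \<bar>tan x\<bar>)"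
proof (rule measure_eqI)
  fix S assume "S \<in> sets (distr M borel (\<lambda>\<omega>. \<bar>X \<omega>\<bar>))"
  then have S [measurable]: "S \<in> sets borel" by simp
  show "emeasure (distr M borel (\<lambda>\<omega>. \<bar>X \<omega>\<bar>)) S = emeasure (distr unif borel (\<lambda>x. \<bar>tan x\<bar>)) S"
    unfolding emeasure_abs_cauchy[OF X S] emeasure_abs_tan[OF measurable_ident_sets[OF refl] S]
    by (subst nn_integral_tan) auto
qed simp

text \<open>The event has probability 2 / pi * pi / 4 = 1 / 2, so conditioning doubles the law on
  (0, 1), the image of the angles below pi / 4. Folding doubles it as well, by adding the equal
  contribution of the angles between pi / 4 and pi / 2.\<close>

lemma distr_abs_cauchy_le_1:
  assumes X: "distributed M lborel X (\<lambda>x. ennreal (cauchy_density x))"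
  shows "distr (uniform_measure M {\<omega> \<in> space M. \<bar>X \<omega>\<bar> \<le> 1}) borel (\<lambda>\<omega>. \<bar>X \<omega>\<bar>) =
    distr unif borel (\<lambda>x. fold_ratio \<bar>tan x\<bar>)"
proof (rule measure_eqI)
  let ?A = "{\<omega> \<in> space M. \<bar>X \<omega>\<bar> \<le> 1}" and ?D = "distr M borel (\<lambda>\<omega>. \<bar>X \<omega>\<bar>)"
  have [measurable]: "X \<in> borel_measurable M" using distributed_measurable[OF X] by simp
  define K where "K S = (\<integral>\<^sup>+x. indicator S (tan x) * indicator {0<..<pi / 4} x \<partial>lborel)" for S
  have D: "emeasure ?D (S \<inter> {..1}) = ennreal (2 / pi) * K S" if S [measurable]: "S \<in> sets borel" for S
  proof -
    have "(\<integral>\<^sup>+x. indicator (S \<inter> {..1}) x * ennreal (1 / (1 + x\<^sup>2)) * indicator {0<..} x \<partial>lborel) =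
        (\<integral>\<^sup>+x. indicator S x * ennreal (1 / (1 + x\<^sup>2)) * indicator {0<..<1} x \<partial>lborel)"
    proof (rule nn_integral_cong_AE)
      show "AE x in lborel. indicator (S \<inter> {..1}) x * ennreal (1 / (1 + x\<^sup>2)) * indicator {0<..} x =
          indicator S x * ennreal (1 / (1 + x\<^sup>2)) * indicator {0<..<1} x"
        using AE_lborel_singleton[of 1] by eventually_elim (auto split: split_indicator)
    qed
    also have "\<dots> = K S"
      unfolding K_def using nn_integral_tan_bounded[of "indicator S" 1] by (simp add: arctan_one)
    finally show ?thesis by (subst emeasure_abs_cauchy[OF X]) simp_all
  qed
  have "K UNIV = emeasure lborel {0<..<pi / 4}"
    unfolding K_def by (simp add: nn_integral_indicator)
  then have "K UNIV = ennreal (pi / 4)" by simp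
  then have D1: "emeasure ?D {..1} = ennreal (1 / 2)"
    using D[of UNIV] by (simp add: ennreal_mult'[symmetric])
  have em: "emeasure ?D S = emeasure M {\<omega> \<in> space M. \<bar>X \<omega>\<bar> \<in> S}" if "S \<in> sets borel" for S
    using that by (subst emeasure_distr) (auto intro!: arg_cong[where f = "emeasure M"])
  fix S assume "S \<in> sets (distr (uniform_measure M ?A) borel (\<lambda>\<omega>. \<bar>X \<omega>\<bar>))"
  then have S [measurable]: "S \<in> sets borel" by simp
  have "emeasure (distr (uniform_measure M ?A) borel (\<lambda>\<omega>. \<bar>X \<omega>\<bar>)) S =
      emeasure (uniform_measure M ?A) {\<omega> \<in> space M. \<bar>X \<omega>\<bar> \<in> S}"
  proof (subst emeasure_distr)
    show "emeasure (uniform_measure M ?A) ((\<lambda>\<omega>. \<bar>X \<omega>\<bar>) -` S \<inter> space (uniform_measure M ?A)) =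
        emeasure (uniform_measure M ?A) {\<omega> \<in> space M. \<bar>X \<omega>\<bar> \<in> S}"
      by (rule arg_cong[where f = "emeasure (uniform_measure M ?A)"]) auto
  qed auto
  also have "\<dots> = emeasure M (?A \<inter> {\<omega> \<in> space M. \<bar>X \<omega>\<bar> \<in> S}) / emeasure M ?A"
    by (rule emeasure_uniform_measure) measurable
  also have "?A \<inter> {\<omega> \<in> space M. \<bar>X \<omega>\<bar> \<in> S} = {\<omega> \<in> space M. \<bar>X \<omega>\<bar> \<in> S \<inter> {..1}}" by auto
  also have "emeasure M \<dots> / emeasure M ?A = emeasure ?D (S \<inter> {..1}) / emeasure ?D {..1}"
    by (simp add: em)
  also have "\<dots> = ennreal (2 / pi) * K S * ennreal 2"
    unfolding D[OF S] D1 by (simp add: divide_ennreal_def inverse_ennreal del: ennreal_half)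
  also have "\<dots> = emeasure (distr unif borel (\<lambda>x. fold_ratio \<bar>tan x\<bar>)) S"
    unfolding emeasure_fold_ratio_tan[OF S] K_def by (simp add: ac_simps)
  finally show "emeasure (distr (uniform_measure M ?A) borel (\<lambda>\<omega>. \<bar>X \<omega>\<bar>)) S =
    emeasure (distr unif borel (\<lambda>x. fold_ratio \<bar>tan x\<bar>)) S" .
qed simp

text \<open>By independence the joint law of the first n variables is the product of their laws, and
  this product is also the image of n independent uniform angles under \<open>h\<close> in each
  coordinate. Both sides are images of it under the same function \<open>G\<close>.\<close>

lemma distr_prod_indep:
  fixes Z :: "nat \<Rightarrow> 'b \<Rightarrow> real"
  assumes M': "prob_space M'" and Z: "prob_space.indep_vars M' (\<lambda>_. borel) Z {1..}" and n: "n \<ge> 1"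
    and h [measurable]: "h \<in> borel_measurable borel" and f [measurable]: "f \<in> borel_measurable borel"
    and law: "\<And>j. j \<ge> 1 \<Longrightarrow> distr M' borel (Z j) = distr unif borel h"
  shows "distr (PiM {1..n} (\<lambda>_. unif)) borel (\<lambda>\<theta>. \<Prod>j=1..n. f (h (\<theta> j))) = distr M' borel (\<lambda>\<omega>. \<Prod>j=1..n. (f (Z j \<omega>) :: real))"
proof -
  interpret M': prob_space M' by fact
  interpret U: prob_space unif by (rule prob_space_unif)
  let ?I = "{1..n}" and ?B = "PiM {1..n} (\<lambda>_. borel :: real measure)"
  define G where "G v = (\<Prod>j=1..n. f (v j))" for v :: "nat \<Rightarrow> real"
  have G [measurable]: "G \<in> borel_measurable ?B"
    unfolding G_def by measurable
  have Zm: "Z j \<in> borel_measurable M'" if "j \<in> ?I" for j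
    using Z that by (auto simp: M'.indep_vars_def)
  have hu: "h \<in> borel_measurable unif" by simp
  let ?N = "distr unif borel h"
  have N: "prob_space ?N" by (rule U.prob_space_distr) (rule hu)
  have sets: "sets (PiM ?I (\<lambda>_. ?N)) = sets ?B" by (rule sets_PiM_cong) auto
  have comp: "compose ?I h \<in> measurable (PiM ?I (\<lambda>_. unif)) ?B"
    unfolding compose_def
  proof (rule measurable_restrict)
    fix i assume "i \<in> ?I"
    then have "(\<lambda>\<theta>. \<theta> i) \<in> measurable (PiM ?I (\<lambda>_. unif)) unif" by (rule measurable_component_singleton)
    then show "(\<lambda>\<theta>. h (\<theta> i)) \<in> borel_measurable (PiM ?I (\<lambda>_. unif))" using hu by (rule measurable_compose)
  qed
  have Zr: "(\<lambda>\<omega>. \<lambda>i\<in>?I. Z i \<omega>) \<in> measurable M' ?B"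
    by (intro measurable_restrict Zm)
  have "distr M' borel (\<lambda>\<omega>. \<Prod>j=1..n. f (Z j \<omega>)) = distr M' borel (G \<circ> (\<lambda>\<omega>. \<lambda>i\<in>?I. Z i \<omega>))"
    by (intro distr_cong refl) (simp add: G_def)
  also have "\<dots> = distr (distr M' ?B (\<lambda>\<omega>. \<lambda>i\<in>?I. Z i \<omega>)) borel G"
    by (rule distr_distr[symmetric, OF G Zr])
  also have "distr M' ?B (\<lambda>\<omega>. \<lambda>i\<in>?I. Z i \<omega>) = PiM ?I (\<lambda>i. distr M' borel (Z i))"
    using n by (intro M'.indep_vars_iff_distr_eq_PiM'[THEN iffD1] M'.indep_vars_subset[OF Z] Zm) auto
  also have "\<dots> = PiM ?I (\<lambda>_. ?N)"
    by (intro PiM_cong refl law) auto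
  also have "\<dots> = PiM ?I (\<lambda>_. distr unif ?N h)"
    by (intro PiM_cong refl distr_cong) auto
  also have "\<dots> = distr (PiM ?I (\<lambda>_. unif)) (PiM ?I (\<lambda>_. ?N)) (compose ?I h)"
    by (rule distr_PiM_finite_prob_space'[symmetric]) (auto simp: N prob_space_unif)
  also have "\<dots> = distr (PiM ?I (\<lambda>_. unif)) ?B (compose ?I h)"
    by (intro distr_cong refl sets)
  also have "distr \<dots> borel G = distr (PiM ?I (\<lambda>_. unif)) borel (G \<circ> compose ?I h)"
    by (rule distr_distr[OF G comp])
  also have "\<dots> = distr (PiM ?I (\<lambda>_. unif)) borel (\<lambda>\<theta>. \<Prod>j=1..n. f (h (\<theta> j)))"
    by (intro distr_cong refl) (simp add: G_def compose_def)
  finally show ?thesis ..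
qed

subsection \<open>Recovering the angles\<close>

lemma space_mat_borel: "space (mat_borel m) = carrier_mat m m"
  by (simp add: mat_borel_def)

lemma mat_entry_measurable:
  assumes "i < m" "j < m"
  shows "(\<lambda>A. A $$ (i, j)) \<in> borel_measurable (mat_borel m)"
proof -
  let ?I = "{..<m} \<times> {..<m}"
  have "(\<lambda>A. \<lambda>ij\<in>?I. A $$ ij) \<in> measurable (mat_borel m) (PiM ?I (\<lambda>_. borel :: real measure))"
    unfolding mat_borel_def by (rule measurable_vimage_algebra1) (auto simp: space_PiM)
  moreover have "(\<lambda>v. v (i, j)) \<in> borel_measurable (PiM ?I (\<lambda>_. borel :: real measure))"
    using assms by (intro measurable_component_singleton) auto
  ultimately have "(\<lambda>A. (\<lambda>ij\<in>?I. A $$ ij) (i, j)) \<in> borel_measurable (mat_borel m)"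
    by (rule measurable_compose)
  then show ?thesis using assms by simp
qed

lemma butterfly_cong: "(\<And>j. 1 \<le> j \<Longrightarrow> j \<le> n \<Longrightarrow> \<theta> j = \<phi> j) \<Longrightarrow> butterfly n \<theta> = butterfly n \<phi>"
  by (induction n) auto

lemma butterfly_Suc_index:
  assumes "i < 2 ^ Suc n" "j < 2 ^ Suc n"
  shows "butterfly (Suc n) \<theta> $$ (i, j) =
    block (cos (\<theta> (Suc n))) (sin (\<theta> (Suc n))) 1 $$ (i div 2 ^ n, j div 2 ^ n) * butterfly n \<theta> $$ (i mod 2 ^ n, j mod 2 ^ n)"
  using kron_index[OF block_carrier(1) butterfly_carrier, of i n j] assms by (simp add: rotation2_block)

lemma butterfly_index_0: "butterfly n \<theta> $$ (0, 0) = (\<Prod>j=1..n. cos (\<theta> j))"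
proof (induction n)
  case (Suc n)
  then show ?case by (subst butterfly_Suc_index) (simp_all add: mult.commute)
qed simp

text \<open>The column number has a single binary digit 1, in the place of factor j, so the entry is
  the product of all cosines with the j-th one replaced by the sine. Multiplying by the cosine
  avoids a division.\<close>

lemma butterfly_index_pow2:
  assumes "1 \<le> j" "j \<le> n"
  shows "butterfly n \<theta> $$ (0, 2 ^ (j - 1)) * cos (\<theta> j) = sin (\<theta> j) * (\<Prod>j=1..n. cos (\<theta> j))"
  using assms
proof (induction n)
  case (Suc n)
  have lt: "(2::nat) ^ (j - 1) < 2 ^ Suc n" using Suc.prems by (intro power_strict_increasing) auto
  show ?case
  proof (cases "j = Suc n")
    case True
    then show ?thesis using lt by (subst butterfly_Suc_index) (simp_all add: butterfly_index_0)
  next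
    case False
    then have "(2::nat) ^ (j - 1) < 2 ^ n" using Suc.prems by (intro power_strict_increasing) auto
    then show ?thesis using lt Suc False by (subst butterfly_Suc_index) (simp_all add: mult.assoc)
  qed
qed simp

text \<open>After division by the product of the cosines, every entry is a product of factors 1 and
  plus or minus tangents. The claim is this fact in cross-multiplied form.\<close>

lemma butterfly_scale:
  assumes "\<And>j. 1 \<le> j \<Longrightarrow> j \<le> n \<Longrightarrow> cos (\<theta> j) \<noteq> 0 \<and> cos (\<phi> j) \<noteq> 0 \<and> tan (\<theta> j) = tan (\<phi> j)"
    and "p < 2 ^ n" "q < 2 ^ n"
  shows "butterfly n \<theta> $$ (p, q) * (\<Prod>j=1..n. cos (\<phi> j)) = butterfly n \<phi> $$ (p, q) * (\<Prod>j=1..n. cos (\<theta> j))"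
  using assms
proof (induction n arbitrary: p q)
  case (Suc n)
  let ?m = "2 ^ n :: nat" and ?a = "\<theta> (Suc n)" and ?b = "\<phi> (Suc n)"
  have pq: "p < 2 * ?m" "q < 2 * ?m" using Suc.prems by auto
  note lt = div_less_mult[OF pq(1)] div_less_mult[OF pq(2)] mod_less_mult[OF pq(1)] mod_less_mult[OF pq(2)]
  have "cos ?a \<noteq> 0" "cos ?b \<noteq> 0" "tan ?a = tan ?b" using Suc.prems by auto
  then have "sin ?a * cos ?b = sin ?b * cos ?a" by (simp add: tan_def field_simps)
  then have bl: "block (cos ?a) (sin ?a) 1 $$ (p div ?m, q div ?m) * cos ?b = block (cos ?b) (sin ?b) 1 $$ (p div ?m, q div ?m) * cos ?a"
    using lt(1,2) by (auto elim!: less_2E simp: mult.commute)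
  have IH: "butterfly n \<theta> $$ (p mod ?m, q mod ?m) * (\<Prod>j=1..n. cos (\<phi> j)) = butterfly n \<phi> $$ (p mod ?m, q mod ?m) * (\<Prod>j=1..n. cos (\<theta> j))"
    using Suc.prems lt by (intro Suc.IH) auto
  have "butterfly (Suc n) \<theta> $$ (p, q) * (\<Prod>j=1..Suc n. cos (\<phi> j)) =
      (block (cos ?a) (sin ?a) 1 $$ (p div ?m, q div ?m) * cos ?b) * (butterfly n \<theta> $$ (p mod ?m, q mod ?m) * (\<Prod>j=1..n. cos (\<phi> j)))"
    using Suc.prems(2,3) by (subst butterfly_Suc_index) simp_all
  also have "\<dots> = butterfly (Suc n) \<phi> $$ (p, q) * (\<Prod>j=1..Suc n. cos (\<theta> j))"
    unfolding bl IH using Suc.prems(2,3) by (subst butterfly_Suc_index) simp_all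
  finally show ?case .
qed simp

text \<open>The ratios of the first row are the tangents; they determine the matrix up to its sign,
  which the last angle absorbs. Since these angles depend measurably on the matrix, they
  carry statements that hold for almost all angles over to a matrix that merely has the
  Haar-butterfly law.\<close>

definition angle_of :: "nat \<Rightarrow> real mat \<Rightarrow> nat \<Rightarrow> real" where
  "angle_of n A j = arctan (A $$ (0, 2 ^ (j - 1)) / A $$ (0, 0)) + (if j = n \<and> A $$ (0, 0) < 0 then pi else 0)"

lemma cos_arctan_tan: "cos x \<noteq> 0 \<Longrightarrow> cos (arctan (tan x)) = \<bar>cos (x::real)\<bar>"
proof -
  assume c: "cos x \<noteq> 0"
  have "1 + (tan x)\<^sup>2 = 1 / (cos x)\<^sup>2"
    using tan_sec[OF c] by (simp add: power_inverse inverse_eq_divide power_divide)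
  then show ?thesis by (simp add: cos_arctan real_sqrt_divide)
qed

context
  fixes n :: nat and \<theta> :: "nat \<Rightarrow> real"
  assumes c: "\<And>j. 1 \<le> j \<Longrightarrow> j \<le> n \<Longrightarrow> cos (\<theta> j) \<noteq> 0"
begin

lemma butterfly_ratio:
  assumes j: "1 \<le> j" "j \<le> n"
  shows "butterfly n \<theta> $$ (0, 2 ^ (j - 1)) / butterfly n \<theta> $$ (0, 0) = tan (\<theta> j)"
proof -
  have "(\<Prod>j=1..n. cos (\<theta> j)) \<noteq> 0" using c by auto
  then show ?thesis
    using butterfly_index_pow2[OF j, of \<theta>] c[OF j] by (simp add: butterfly_index_0 tan_def field_simps)
qed

lemma tan_angle_of:
  assumes j: "1 \<le> j" "j \<le> n"
  shows "cos (angle_of n (butterfly n \<theta>) j) \<noteq> 0" "tan (angle_of n (butterfly n \<theta>) j) = tan (\<theta> j)"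
  using cos_arctan_not_zero[of "tan (\<theta> j)"] butterfly_ratio[OF j]
  by (auto simp: angle_of_def tan_arctan tan_periodic_pi)

lemma butterfly_angle_of:
  assumes n: "n \<ge> 1"
  shows "butterfly n (angle_of n (butterfly n \<theta>)) = butterfly n \<theta>"
proof -
  let ?A = "butterfly n \<theta>" and ?p = "\<Prod>j=1..n. cos (\<theta> j)"
  have p0: "?p \<noteq> 0" using c by auto
  \<comment> \<open>Values of arctan have positive cosine, so the recovered cosines are the original
    ones up to sign; the shift by pi in the last angle restores the sign of their product.\<close>
  have "cos (angle_of n ?A j) = \<bar>cos (\<theta> j)\<bar> * (if j = n then (if ?p < 0 then - 1 else 1) else 1)"
    if j: "j \<in> {1..n}" for j
    using cos_arctan_tan[OF c[of j]] butterfly_ratio[of j] j by (auto simp: angle_of_def butterfly_index_0)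
  then have "(\<Prod>j=1..n. cos (angle_of n ?A j)) =
      (\<Prod>j=1..n. \<bar>cos (\<theta> j)\<bar> * (if j = n then (if ?p < 0 then - 1 else 1) else 1))"
    by (intro prod.cong refl)
  also have "\<dots> = \<bar>?p\<bar> * (if ?p < 0 then - 1 else 1)"
    using n by (simp only: prod.distrib abs_prod prod.delta finite_atLeastAtMost) simp
  also have "\<dots> = ?p" by simp
  finally have prod: "(\<Prod>j=1..n. cos (angle_of n ?A j)) = ?p" .
  show ?thesis
  proof (rule eq_matI)
    fix p q assume "p < dim_row ?A" "q < dim_col ?A"
    then have pq: "p < 2 ^ n" "q < 2 ^ n" using carrier_matD[OF butterfly_carrier[of n \<theta>]] by auto
    \<comment> \<open>Equal tangents make the two matrices proportional, and equal products of
      cosines make the ratio 1.\<close>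
    have "butterfly n (angle_of n ?A) $$ (p, q) * ?p = ?A $$ (p, q) * ?p"
      using butterfly_scale[OF _ pq, of "angle_of n ?A" \<theta>] c tan_angle_of unfolding prod by blast
    then show "butterfly n (angle_of n ?A) $$ (p, q) = ?A $$ (p, q)" using p0 by simp
  qed (simp_all add: carrier_matD[OF butterfly_carrier])
qed

end

lemma abs_sin_neq_cos_iff: "cos x \<noteq> 0 \<Longrightarrow> \<bar>sin x\<bar> \<noteq> \<bar>cos x\<bar> \<longleftrightarrow> \<bar>tan (x::real)\<bar> \<noteq> 1"
  by (auto simp: tan_def field_simps)

lemma generic_angles_angle_of:
  assumes "generic_angles n \<theta>"
  shows "generic_angles n (angle_of n (butterfly n \<theta>))"
  using assms tan_angle_of[of n \<theta>] abs_sin_neq_cos_iff unfolding generic_angles_def by (metis atLeastAtMost_iff)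

lemma angle_of_measurable:
  assumes "1 \<le> j" "j \<le> n"
  shows "(\<lambda>A. angle_of n A j) \<in> borel_measurable (mat_borel (2 ^ n))"
proof -
  have "(2::nat) ^ (j - 1) < 2 ^ n" using assms by (intro power_strict_increasing) auto
  then have [measurable]: "(\<lambda>A. A $$ (0, 2 ^ (j - 1))) \<in> borel_measurable (mat_borel (2 ^ n))"
    "(\<lambda>A. A $$ (0, 0)) \<in> borel_measurable (mat_borel (2 ^ n))"
    by (auto intro!: mat_entry_measurable)
  have [measurable]: "arctan \<in> borel_measurable borel"
    by (intro borel_measurable_continuous_onI continuous_intros)
  show ?thesis unfolding angle_of_def by measurable
qed

text \<open>Needed to pass the almost sure statement through an image measure. Measurability comes
  from reducing the matrix equation to finitely many entries.\<close>

lemma sets_generic_butterfly: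
  "{A \<in> space (mat_borel (2 ^ n)). butterfly n (angle_of n A) = A \<and> generic_angles n (angle_of n A)} \<in> sets (mat_borel (2 ^ n))"
proof -
  let ?M = "mat_borel (2 ^ n)"
  note angle_of_measurable[measurable]
  \<comment> \<open>The product space consists of functions restricted to the index set; the
    restriction does not change the butterfly matrix, which reads only these angles.\<close>
  have "(\<lambda>A. \<lambda>j\<in>{1..n}. angle_of n A j) \<in> measurable ?M (PiM {1..n} (\<lambda>_. unif))"
  proof (rule measurable_restrict)
    fix j assume "j \<in> {1..n}"
    then show "(\<lambda>A. angle_of n A j) \<in> measurable ?M unif"
      using angle_of_measurable[of j n] by (simp cong: measurable_cong_sets)
  qed
  from measurable_compose[OF this butterfly_measurable]
  have "(\<lambda>A. butterfly n (\<lambda>j\<in>{1..n}. angle_of n A j)) \<in> measurable ?M ?M" .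
  moreover have "butterfly n (\<lambda>j\<in>{1..n}. angle_of n A j) = butterfly n (angle_of n A)" for A
    by (rule butterfly_cong) simp
  ultimately have m: "(\<lambda>A. butterfly n (angle_of n A)) \<in> measurable ?M ?M" by simp
  have entry: "(\<lambda>A. A $$ (p, q)) \<in> borel_measurable ?M" "(\<lambda>A. butterfly n (angle_of n A) $$ (p, q)) \<in> borel_measurable ?M"
    if "p \<in> {..<2 ^ n}" "q \<in> {..<2 ^ n}" for p q
    using that mat_entry_measurable[of p "2 ^ n" q] measurable_compose[OF m mat_entry_measurable[of p "2 ^ n" q]] by auto
  have "{A \<in> space ?M. butterfly n (angle_of n A) = A \<and> generic_angles n (angle_of n A)} =
    {A \<in> space ?M. (\<forall>p\<in>{..<2 ^ n}. \<forall>q\<in>{..<2 ^ n}. butterfly n (angle_of n A) $$ (p, q) = A $$ (p, q)) \<and>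
      (\<forall>j\<in>{1..n}. cos (angle_of n A j) \<noteq> 0 \<and> \<bar>sin (angle_of n A j)\<bar> \<noteq> \<bar>cos (angle_of n A j)\<bar>)}"
    using butterfly_carrier[of n]
    by (auto simp: space_mat_borel generic_angles_def intro!: eq_matI) (simp_all add: carrier_matD[OF butterfly_carrier])
  also have "\<dots> \<in> sets ?M"
  proof (intro sets.sets_Collect_conj sets.sets_Collect_finite_All finite_lessThan finite_atLeastAtMost)
    fix p q :: nat assume "p \<in> {..<2 ^ n}" "q \<in> {..<2 ^ n}"
    note [measurable] = entry[OF this]
    show "{A \<in> space ?M. butterfly n (angle_of n A) $$ (p, q) = A $$ (p, q)} \<in> sets ?M" by measurable
  next
    fix j assume "j \<in> {1..n}"
    then have [measurable]: "(\<lambda>A. angle_of n A j) \<in> borel_measurable ?M" using angle_of_measurable by simp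
    show "{A \<in> space ?M. cos (angle_of n A j) \<noteq> 0} \<in> sets ?M" by measurable
    show "{A \<in> space ?M. \<bar>sin (angle_of n A j)\<bar> \<noteq> \<bar>cos (angle_of n A j)\<bar>} \<in> sets ?M" by measurable
  qed
  finally show ?thesis .
qed

section \<open>From almost all angles to the random matrix\<close>

lemma AE_generic_angles: "AE \<theta> in PiM {1..n} (\<lambda>_. unif). generic_angles n \<theta>"
proof -
  have "AE x in unif. cos x \<noteq> 0 \<and> \<bar>sin x\<bar> \<noteq> \<bar>cos x\<bar>"
  proof (rule AE_uniform_measureI)
    \<comment> \<open>The exceptions are the zeros of cos x and of cos (2 x), the latter being the
      points where |sin x| = |cos x|. They lie among the multiples of pi / 2 and pi / 4, a countable
      set.\<close>
    let ?Z = "range (\<lambda>i::int. of_int i * (pi / 2)) \<union> range (\<lambda>i::int. of_int i * (pi / 4)) :: real set"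
    have "?Z \<in> null_sets lborel" by (intro countable_imp_null_set_lborel) auto
    from AE_not_in[OF this] show "AE x in lborel. x \<in> {0..<2 * pi} \<longrightarrow> cos x \<noteq> 0 \<and> \<bar>sin x\<bar> \<noteq> \<bar>cos x\<bar>"
    proof eventually_elim
      case (elim x)
      have "cos x \<noteq> 0" using elim by (auto simp: cos_zero_iff_int)
      moreover have "cos (2 * x) \<noteq> 0"
      proof
        assume "cos (2 * x) = 0"
        then obtain i :: int where "2 * x = of_int i * (pi / 2)" unfolding cos_zero_iff_int by blast
        then have "x = of_int i * (pi / 4)" by simp
        then show False using elim by blast
      qed
      then have "(cos x)\<^sup>2 \<noteq> (sin x)\<^sup>2" by (simp add: cos_double)
      then have "\<bar>sin x\<bar> \<noteq> \<bar>cos x\<bar>" by (metis power2_abs)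
      ultimately show ?case by simp
    qed
  qed simp
  then have "AE \<theta> in PiM {1..n} (\<lambda>_. unif). cos (\<theta> j) \<noteq> 0 \<and> \<bar>sin (\<theta> j)\<bar> \<noteq> \<bar>cos (\<theta> j)\<bar>" if "j \<in> {1..n}" for j
    using that by (intro AE_PiM_component prob_space_unif) auto
  then show ?thesis unfolding generic_angles_def by (intro AE_finite_allI) auto
qed

locale haar_butterfly_rv =
  fixes n :: nat and M :: "'a measure" and B :: "'a \<Rightarrow> real mat"
  assumes n: "n \<ge> 1" and B: "B \<in> measurable M (mat_borel (2 ^ n))"
    and law: "distr M (mat_borel (2 ^ n)) B = haar_butterfly n"
begin

lemma AE_butterfly: "AE \<omega> in M. butterfly n (angle_of n (B \<omega>)) = B \<omega> \<and> generic_angles n (angle_of n (B \<omega>))"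
proof (rule AE_distrD[OF B], unfold law haar_butterfly_def, subst AE_distr_iff[OF butterfly_measurable sets_generic_butterfly])
  show "AE \<theta> in PiM {1..n} (\<lambda>_. unif). butterfly n (angle_of n (butterfly n \<theta>)) = butterfly n \<theta> \<and>
      generic_angles n (angle_of n (butterfly n \<theta>))"
    using AE_generic_angles
  proof eventually_elim
    case (elim \<theta>)
    then show ?case
      using butterfly_angle_of[of n \<theta>] n generic_angles_angle_of[OF elim] by (auto simp: generic_angles_def)
  qed
qed

text \<open>Almost surely the matrix is the butterfly matrix of generic angles, so a deterministic
  fact about these carries over. \<open>P\<close> may be any predicate, such as one that quantifies
  over all runs: the exceptional set is that of \<open>AE_butterfly\<close>.\<close>

lemma AE_transfer:
  assumes "\<And>\<theta>. generic_angles n \<theta> \<Longrightarrow> P (butterfly n \<theta>)"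
  shows "AE \<omega> in M. P (B \<omega>)"
  using AE_butterfly by eventually_elim (metis assms)

text \<open>\<open>R\<close> may depend on an arbitrary choice of permutations, so measurability is
  only obtained for the completion: \<open>R\<close> agrees almost surely with a measurable function
  of \<open>B\<close>, whose law is computed on the angle space. The function \<open>H\<close> is
  the identity for GENP and \<open>fold_ratio\<close> otherwise, and \<open>f\<close> is one factor
  of the product.\<close>

lemma eq_in_dist_prod:
  fixes Z :: "nat \<Rightarrow> 'b \<Rightarrow> real" and f H :: "real \<Rightarrow> real"
  assumes M': "prob_space M'" and Z: "prob_space.indep_vars M' (\<lambda>_. borel) Z {1..}"
    and H [measurable]: "H \<in> borel_measurable borel" and f [measurable]: "f \<in> borel_measurable borel"
    and lawZ: "\<And>j. j \<ge> 1 \<Longrightarrow> distr M' borel (Z j) = distr unif borel (\<lambda>x. H \<bar>tan x\<bar>)"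
    and R: "AE \<omega> in M. R \<omega> = (\<Prod>j=1..n. f (H \<bar>tan (angle_of n (B \<omega>) j)\<bar>))"
  shows "eq_in_dist M R M' (\<lambda>\<omega>. \<Prod>j=1..n. f (Z j \<omega>))"
proof -
  let ?N = "mat_borel (2 ^ n)" and ?P = "PiM {1..n} (\<lambda>_. unif)"
  define F where "F A = (\<Prod>j=1..n. f (H \<bar>tan (angle_of n A j)\<bar>))" for A
  have F: "F \<in> borel_measurable ?N"
    unfolding F_def
  proof (rule borel_measurable_prod)
    fix j assume "j \<in> {1..n}"
    then have [measurable]: "(\<lambda>A. angle_of n A j) \<in> borel_measurable ?N" using angle_of_measurable by simp
    show "(\<lambda>A. f (H \<bar>tan (angle_of n A j)\<bar>)) \<in> borel_measurable ?N" by measurable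
  qed
  have FB: "F \<circ> B \<in> borel_measurable M" using B F by (rule measurable_comp)
  have FB': "F \<circ> B \<in> borel_measurable (completion M)" using FB by (rule measurable_completion)
  have RF: "AE \<omega> in completion M. R \<omega> = (F \<circ> B) \<omega>" using R by (intro AE_completion) (simp add: F_def)
  have Rm: "R \<in> borel_measurable (completion M)"
  proof (rule measurableI)
    fix S :: "real set" assume S: "S \<in> sets borel"
    show "R -` S \<inter> space (completion M) \<in> sets (completion M)"
    proof (rule completion.in_sets_AE)
      show "AE \<omega> in completion M. \<omega> \<in> (F \<circ> B) -` S \<inter> space (completion M) \<longleftrightarrow> \<omega> \<in> R -` S \<inter> space (completion M)"
        using RF by eventually_elim auto
      show "(F \<circ> B) -` S \<inter> space (completion M) \<in> sets (completion M)"
        using measurable_sets[OF FB' S] .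
    qed auto
  qed auto
  have Zm: "Z j \<in> borel_measurable M'" if "j \<in> {1..n}" for j
    using Z that by (auto simp: prob_space.indep_vars_def[OF M'])
  have "distr (completion M) borel R = distr (completion M) borel (F \<circ> B)"
    by (rule distr_cong_AE[OF refl refl RF Rm FB'])
  also have "\<dots> = distr M borel (F \<circ> B)" by (rule distr_completion[OF FB])
  also have "\<dots> = distr (haar_butterfly n) borel F"
    unfolding law[symmetric] by (rule distr_distr[symmetric, OF F B])
  also have "\<dots> = distr ?P borel (F \<circ> butterfly n)"
    unfolding haar_butterfly_def by (rule distr_distr[OF F butterfly_measurable])
  \<comment> \<open>The recovered angles may differ from the original ones, but only their tangents
    enter, and these agree.\<close>
  also have "\<dots> = distr ?P borel (\<lambda>\<theta>. \<Prod>j=1..n. f (H \<bar>tan (\<theta> j)\<bar>))"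
  proof (rule distr_cong_AE[OF refl refl])
    show "AE \<theta> in ?P. (F \<circ> butterfly n) \<theta> = (\<Prod>j=1..n. f (H \<bar>tan (\<theta> j)\<bar>))"
      using AE_generic_angles
    proof eventually_elim
      case (elim \<theta>)
      then show ?case
        using tan_angle_of[of n \<theta>] by (auto simp: F_def generic_angles_def intro!: prod.cong)
    qed
    show "F \<circ> butterfly n \<in> borel_measurable ?P" using butterfly_measurable F by (rule measurable_comp)
    show "(\<lambda>\<theta>. \<Prod>j=1..n. f (H \<bar>tan (\<theta> j)\<bar>)) \<in> borel_measurable ?P"
    proof (rule borel_measurable_prod)
      fix j assume "j \<in> {1..n}"
      then have "(\<lambda>\<theta>. \<theta> j) \<in> measurable ?P unif" by (rule measurable_component_singleton)
      moreover have "(\<lambda>x. f (H \<bar>tan x\<bar>)) \<in> borel_measurable unif" by simp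
      ultimately show "(\<lambda>\<theta>. f (H \<bar>tan (\<theta> j)\<bar>)) \<in> borel_measurable ?P" by (rule measurable_compose)
    qed
  qed
  also have "\<dots> = distr M' borel (\<lambda>\<omega>. \<Prod>j=1..n. f (Z j \<omega>))"
    by (rule distr_prod_indep[OF M' Z n _ f lawZ]) auto
  finally show ?thesis
    unfolding eq_in_dist_def using Rm Zm by (auto intro!: borel_measurable_prod measurable_compose[OF _ f])
qed

text \<open>The strategy enters only through \<open>H\<close> and the deterministic identities in
  \<open>growth\<close>; measurability and independence are settled once for all three.\<close>

lemma growth_lawsI:
  fixes Z :: "nat \<Rightarrow> 'b \<Rightarrow> real"
  assumes M': "prob_space M'" and Z: "prob_space.indep_vars M' (\<lambda>_. borel) Z {1..}"
    and H: "H \<in> borel_measurable borel"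
    and lawZ: "\<And>j. j \<ge> 1 \<Longrightarrow> distr M' borel (Z j) = distr unif borel (\<lambda>x. H \<bar>tan x\<bar>)"
    and growth: "\<And>\<theta> P Q. generic_angles n \<theta> \<Longrightarrow> ge_produces S (butterfly n \<theta>) P Q \<Longrightarrow>
      rho (butterfly n \<theta>) P Q = (\<Prod>j=1..n. 1 + (H \<bar>tan (\<theta> j)\<bar>)\<^sup>2) \<and>
      rho_o (butterfly n \<theta>) P Q = (\<Prod>j=1..n. 1 + 2 * (H \<bar>tan (\<theta> j)\<bar>)\<^sup>2 / (1 + H \<bar>tan (\<theta> j)\<bar>)) \<and>
      rho_inf (butterfly n \<theta>) P Q = (\<Prod>j=1..n. 1 + max (H \<bar>tan (\<theta> j)\<bar>) ((H \<bar>tan (\<theta> j)\<bar>)\<^sup>2))"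
  shows "growth_laws S n M B M' Z"
  unfolding growth_laws_def
proof (intro allI impI conjI)
  fix P Q assume "AE \<omega> in M. ge_produces S (B \<omega>) (P \<omega>) (Q \<omega>)"
  with AE_butterfly have *: "AE \<omega> in M. rho (B \<omega>) (P \<omega>) (Q \<omega>) = (\<Prod>j=1..n. 1 + (H \<bar>tan (angle_of n (B \<omega>) j)\<bar>)\<^sup>2) \<and>
      rho_o (B \<omega>) (P \<omega>) (Q \<omega>) =
        (\<Prod>j=1..n. 1 + 2 * (H \<bar>tan (angle_of n (B \<omega>) j)\<bar>)\<^sup>2 / (1 + H \<bar>tan (angle_of n (B \<omega>) j)\<bar>)) \<and>
      rho_inf (B \<omega>) (P \<omega>) (Q \<omega>) =
        (\<Prod>j=1..n. 1 + max (H \<bar>tan (angle_of n (B \<omega>) j)\<bar>) ((H \<bar>tan (angle_of n (B \<omega>) j)\<bar>)\<^sup>2))"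
  proof eventually_elim
    case (elim \<omega>)
    then show ?case using growth[of "angle_of n (B \<omega>)" "P \<omega>" "Q \<omega>"] by simp
  qed
  show "eq_in_dist M (\<lambda>\<omega>. rho (B \<omega>) (P \<omega>) (Q \<omega>)) M' (\<lambda>\<omega>. \<Prod>j=1..n. 1 + (Z j \<omega>)\<^sup>2)"
    by (rule eq_in_dist_prod[OF M' Z H _ lawZ, where f = "\<lambda>y. 1 + y\<^sup>2"]) (use * in \<open>auto elim: eventually_mono\<close>)
  show "eq_in_dist M (\<lambda>\<omega>. rho_o (B \<omega>) (P \<omega>) (Q \<omega>)) M' (\<lambda>\<omega>. \<Prod>j=1..n. 1 + 2 * (Z j \<omega>)\<^sup>2 / (1 + Z j \<omega>))"
    by (rule eq_in_dist_prod[OF M' Z H _ lawZ, where f = "\<lambda>y. 1 + 2 * y\<^sup>2 / (1 + y)"]) (use * in \<open>auto elim: eventually_mono\<close>)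
  show "eq_in_dist M (\<lambda>\<omega>. rho_inf (B \<omega>) (P \<omega>) (Q \<omega>)) M' (\<lambda>\<omega>. \<Prod>j=1..n. 1 + max (Z j \<omega>) ((Z j \<omega>)\<^sup>2))"
    by (rule eq_in_dist_prod[OF M' Z H _ lawZ, where f = "\<lambda>y. 1 + max y (y\<^sup>2)"]) (use * in \<open>auto elim: eventually_mono\<close>)
qed

end

theorem theorem2p3:
  fixes M :: "'a measure" and M\<^sub>X :: "'b measure" and M\<^sub>Y :: "'c measure"
    and n N :: nat and B :: "'a \<Rightarrow> real mat"
    and X :: "nat \<Rightarrow> 'b \<Rightarrow> real" and Y :: "nat \<Rightarrow> 'c \<Rightarrow> real"
  assumes "n \<ge> 1" and "N = 2 ^ n"
    and "prob_space M"
    and "B \<in> measurable M (mat_borel N)"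
    and "distr M (mat_borel N) B = haar_butterfly n"
    and "prob_space M\<^sub>X"
    and "prob_space.indep_vars M\<^sub>X (\<lambda>_. borel) X {1..}"
    and "\<And>j. j \<ge> 1 \<Longrightarrow> distributed M\<^sub>X lborel (X j) (\<lambda>x. ennreal (cauchy_density x))"
    and "prob_space M\<^sub>Y"
    and "prob_space.indep_vars M\<^sub>Y (\<lambda>_. borel) Y {1..}"
    and "\<And>j. j \<ge> 1 \<Longrightarrow> distr M\<^sub>Y borel (Y j) =
           distr (uniform_measure M\<^sub>X {\<omega> \<in> space M\<^sub>X. \<bar>X j \<omega>\<bar> \<le> 1}) borel (\<lambda>\<omega>. \<bar>X j \<omega>\<bar>)"
  shows
    "(AE \<omega> in M. genp_ok (B \<omega>) \<and> lu_factorization (B \<omega>) (genp_L (B \<omega>)) (genp_U (B \<omega>)))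
   \<and> (AE \<omega> in M. \<exists>L U. \<forall>R. permutation_mat N R \<longrightarrow>
        (\<exists>P. gepp (R * B \<omega>) P) \<and>
        (\<forall>P. gepp (R * B \<omega>) P \<longrightarrow>
           permutation_mat N P \<and> genp_ok (P * (R * B \<omega>)) \<and>
           lu_factorization (P * (R * B \<omega>)) L U \<and>
           genp_L (P * (R * B \<omega>)) = L \<and> genp_U (P * (R * B \<omega>)) = U))
   \<and> (AE \<omega> in M. \<forall>P Q. gerp (B \<omega>) P Q \<longleftrightarrow> gepp (B \<omega>) P \<and> Q = 1\<^sub>m N)
   \<and> growth_laws GENP n M B M\<^sub>X (\<lambda>j \<omega>. \<bar>X j \<omega>\<bar>)
   \<and> growth_laws GEPP n M B M\<^sub>Y Y
   \<and> growth_laws GERP n M B M\<^sub>Y Y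
   \<and> (AE \<omega> in M. \<forall>P Q. ge_produces GENP (B \<omega>) P Q \<longrightarrow>
        1 \<le> rho (B \<omega>) P Q \<and> rho (B \<omega>) P Q \<le> rho_inf (B \<omega>) P Q \<and>
        1 \<le> rho_o (B \<omega>) P Q \<and> rho_o (B \<omega>) P Q \<le> rho_inf (B \<omega>) P Q)
   \<and> (AE \<omega> in M. \<forall>S \<in> {GEPP, GERP}. \<forall>P Q. ge_produces S (B \<omega>) P Q \<longrightarrow>
        1 \<le> rho (B \<omega>) P Q \<and> rho (B \<omega>) P Q \<le> rho_o (B \<omega>) P Q \<and>
        rho_o (B \<omega>) P Q \<le> rho_inf (B \<omega>) P Q \<and> rho_inf (B \<omega>) P Q \<le> real N)
   \<and> (\<forall>P Q :: 'a \<Rightarrow> real mat.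
        (AE \<omega> in M. permutation_mat N (P \<omega>) \<and> permutation_mat N (Q \<omega>)) \<longrightarrow>
        (AE \<omega> in M. genp_ok (P \<omega> * B \<omega> * Q \<omega>)) \<longrightarrow>
        (AE \<omega> in M. \<forall>P'. gepp (B \<omega>) P' \<longrightarrow>
           rho (P \<omega> * B \<omega> * Q \<omega>) (1\<^sub>m N) (1\<^sub>m N) \<ge> rho (B \<omega>) P' (1\<^sub>m N)))"
proof (intro conjI allI impI)
  note N = \<open>N = 2 ^ n\<close>
  interpret haar_butterfly_rv n M B
    using assms(1,4,5) unfolding N by unfold_locales
  interpret X: prob_space M\<^sub>X by fact
  have dim: "dim_row (butterfly n \<theta>) = 2 ^ n" "dim_col (butterfly n \<theta>) = 2 ^ n" for \<theta>
    using carrier_matD[OF butterfly_carrier] by auto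
  have genp: "genp_ok (butterfly n \<theta>)" if "generic_angles n \<theta>" for \<theta>
    using that by (intro butterfly_genp) (auto simp: generic_angles_def)
  show "AE \<omega> in M. genp_ok (B \<omega>) \<and> lu_factorization (B \<omega>) (genp_L (B \<omega>)) (genp_U (B \<omega>))"
    by (rule AE_transfer) (auto intro: genp genp_ok_imp_lu_factorization[OF butterfly_carrier])
  show "AE \<omega> in M. \<exists>L U. \<forall>R. permutation_mat N R \<longrightarrow>
        (\<exists>P. gepp (R * B \<omega>) P) \<and>
        (\<forall>P. gepp (R * B \<omega>) P \<longrightarrow>
           permutation_mat N P \<and> genp_ok (P * (R * B \<omega>)) \<and>
           lu_factorization (P * (R * B \<omega>)) L U \<and>
           genp_L (P * (R * B \<omega>)) = L \<and> genp_U (P * (R * B \<omega>)) = U)"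
    unfolding N by (rule AE_transfer) (rule gepp_butterfly(1))
  show "AE \<omega> in M. \<forall>P Q. gerp (B \<omega>) P Q \<longleftrightarrow> gepp (B \<omega>) P \<and> Q = 1\<^sub>m N"
    unfolding N by (rule AE_transfer) (simp add: gepp_butterfly(2))
  have genp_growth: "rho (butterfly n \<theta>) P Q = (\<Prod>j=1..n. 1 + \<bar>tan (\<theta> j)\<bar>\<^sup>2) \<and>
      rho_o (butterfly n \<theta>) P Q = (\<Prod>j=1..n. 1 + 2 * \<bar>tan (\<theta> j)\<bar>\<^sup>2 / (1 + \<bar>tan (\<theta> j)\<bar>)) \<and>
      rho_inf (butterfly n \<theta>) P Q = (\<Prod>j=1..n. 1 + max \<bar>tan (\<theta> j)\<bar> (\<bar>tan (\<theta> j)\<bar>\<^sup>2))"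
    if "generic_angles n \<theta>" "ge_produces GENP (butterfly n \<theta>) P Q" for \<theta> P Q
    using that butterfly_genp[of n \<theta>] by (auto simp: ge_produces_def dim generic_angles_def)
  have gepp: "gepp (butterfly n \<theta>) P \<and> Q = 1\<^sub>m (2 ^ n)"
    if "generic_angles n \<theta>" "ge_produces S (butterfly n \<theta>) P Q" "S \<in> {GEPP, GERP}" for \<theta> P Q S
    using that gepp_butterfly(2)[of n \<theta>] by (auto simp: ge_produces_def dim)
  have gepp_growth: "rho (butterfly n \<theta>) P Q = (\<Prod>j=1..n. 1 + (fold_ratio \<bar>tan (\<theta> j)\<bar>)\<^sup>2) \<and>
      rho_o (butterfly n \<theta>) P Q = (\<Prod>j=1..n. 1 + 2 * (fold_ratio \<bar>tan (\<theta> j)\<bar>)\<^sup>2 / (1 + fold_ratio \<bar>tan (\<theta> j)\<bar>)) \<and>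
      rho_inf (butterfly n \<theta>) P Q = (\<Prod>j=1..n. 1 + max (fold_ratio \<bar>tan (\<theta> j)\<bar>) ((fold_ratio \<bar>tan (\<theta> j)\<bar>)\<^sup>2))"
    if "generic_angles n \<theta>" "ge_produces S (butterfly n \<theta>) P Q" "S \<in> {GEPP, GERP}" for \<theta> P Q S
    using gepp[OF that] gepp_butterfly(3)[OF that(1)] by blast
  show "growth_laws GENP n M B M\<^sub>X (\<lambda>j \<omega>. \<bar>X j \<omega>\<bar>)"
  proof (rule growth_lawsI[where H = "\<lambda>x. x"])
    show "X.indep_vars (\<lambda>_. borel) (\<lambda>j \<omega>. \<bar>X j \<omega>\<bar>) {1..}"
      using X.indep_vars_compose2[OF assms(7), of "\<lambda>_. abs" "\<lambda>_. borel"] by simp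
  qed (auto simp: distr_abs_cauchy[OF assms(8)] genp_growth assms(6))
  have Y: "distr M\<^sub>Y borel (Y j) = distr unif borel (\<lambda>x. fold_ratio \<bar>tan x\<bar>)" if "j \<ge> 1" for j
    using assms(11)[OF that] distr_abs_cauchy_le_1[OF assms(8)[OF that]] by simp
  show "growth_laws GEPP n M B M\<^sub>Y Y" "growth_laws GERP n M B M\<^sub>Y Y"
    by (rule growth_lawsI[OF assms(9,10) borel_measurable_fold_ratio Y]; (erule(1) gepp_growth)?; simp)+
  have order: "1 \<le> (\<Prod>j=1..n. 1 + (t j)\<^sup>2) \<and> (\<Prod>j=1..n. 1 + (t j)\<^sup>2) \<le> (\<Prod>j=1..n. 1 + max (t j) ((t j)\<^sup>2)) \<and>
      1 \<le> (\<Prod>j=1..n. 1 + 2 * (t j)\<^sup>2 / (1 + t j)) \<and>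
      (\<Prod>j=1..n. 1 + 2 * (t j)\<^sup>2 / (1 + t j)) \<le> (\<Prod>j=1..n. 1 + max (t j) ((t j)\<^sup>2))"
    if "\<And>j. 1 \<le> j \<Longrightarrow> j \<le> n \<Longrightarrow> 0 \<le> t j" for t :: "nat \<Rightarrow> real"
    using that growth_order order_trans[OF zero_le_one growth_order(1)] order_trans[OF zero_le_one growth_order(3)]
    by (auto intro!: prod_ge_1 prod_mono)
  show "AE \<omega> in M. \<forall>P Q. ge_produces GENP (B \<omega>) P Q \<longrightarrow>
        1 \<le> rho (B \<omega>) P Q \<and> rho (B \<omega>) P Q \<le> rho_inf (B \<omega>) P Q \<and>
        1 \<le> rho_o (B \<omega>) P Q \<and> rho_o (B \<omega>) P Q \<le> rho_inf (B \<omega>) P Q"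
  proof (rule AE_transfer, intro allI impI)
    fix \<theta> P Q assume "generic_angles n \<theta>" "ge_produces GENP (butterfly n \<theta>) P Q"
    then show "1 \<le> rho (butterfly n \<theta>) P Q \<and> rho (butterfly n \<theta>) P Q \<le> rho_inf (butterfly n \<theta>) P Q \<and>
        1 \<le> rho_o (butterfly n \<theta>) P Q \<and> rho_o (butterfly n \<theta>) P Q \<le> rho_inf (butterfly n \<theta>) P Q"
      using genp_growth order[of "\<lambda>j. \<bar>tan (\<theta> j)\<bar>"] by simp
  qed
  show "AE \<omega> in M. \<forall>S \<in> {GEPP, GERP}. \<forall>P Q. ge_produces S (B \<omega>) P Q \<longrightarrow>
        1 \<le> rho (B \<omega>) P Q \<and> rho (B \<omega>) P Q \<le> rho_o (B \<omega>) P Q \<and>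
        rho_o (B \<omega>) P Q \<le> rho_inf (B \<omega>) P Q \<and> rho_inf (B \<omega>) P Q \<le> real N"
  proof (rule AE_transfer, intro ballI allI impI)
    fix \<theta> S P Q assume g: "generic_angles n \<theta>" and S: "S \<in> {GEPP, GERP}" "ge_produces S (butterfly n \<theta>) P Q"
    define t where "t j = fold_ratio \<bar>tan (\<theta> j)\<bar>" for j
    have t: "0 \<le> t j" "t j \<le> 1" if "j \<in> {1..n}" for j using gepp_butterfly(4)[OF g, of j] that by (auto simp: t_def)
    \<comment> \<open>As t^2 \<le> t \<le> 1, each factor is at most 2, and n factors give the bound
      N = 2^n.\<close>
    have "(\<Prod>j=1..n. 1 + max (t j) ((t j)\<^sup>2)) \<le> (\<Prod>j=1..n. 2)"
    proof (rule prod_mono)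
      fix j assume j: "j \<in> {1..n}"
      show "0 \<le> 1 + max (t j) ((t j)\<^sup>2) \<and> 1 + max (t j) ((t j)\<^sup>2) \<le> 2"
        using growth_order(1,2)[OF t(1)[OF j]] growth_order(6)[OF t[OF j]] by (intro conjI) linarith+
    qed
    moreover have "(\<Prod>j=1..n. 1 + (t j)\<^sup>2) \<le> (\<Prod>j=1..n. 1 + 2 * (t j)\<^sup>2 / (1 + t j))"
      using t by (intro prod_mono conjI growth_order(5)) auto
    ultimately show "1 \<le> rho (butterfly n \<theta>) P Q \<and> rho (butterfly n \<theta>) P Q \<le> rho_o (butterfly n \<theta>) P Q \<and>
        rho_o (butterfly n \<theta>) P Q \<le> rho_inf (butterfly n \<theta>) P Q \<and> rho_inf (butterfly n \<theta>) P Q \<le> real N"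
      using gepp_growth[OF g S(2,1)] order[of t] t by (simp add: t_def N)
  qed
  fix P Q :: "'a \<Rightarrow> real mat"
  assume "AE \<omega> in M. permutation_mat N (P \<omega>) \<and> permutation_mat N (Q \<omega>)" "AE \<omega> in M. genp_ok (P \<omega> * B \<omega> * Q \<omega>)"
  with AE_butterfly show "AE \<omega> in M. \<forall>P'. gepp (B \<omega>) P' \<longrightarrow>
      rho (P \<omega> * B \<omega> * Q \<omega>) (1\<^sub>m N) (1\<^sub>m N) \<ge> rho (B \<omega>) P' (1\<^sub>m N)"
  proof eventually_elim
    case (elim \<omega>)
    let ?\<theta> = "angle_of n (B \<omega>)"
    \<comment> \<open>The two growth factors are compared through 1 / (max-norm)^2, a lower bound
      for any permuted matrix and the exact value for partial pivoting.\<close>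
    have "rho (P \<omega> * butterfly n ?\<theta> * Q \<omega>) (1\<^sub>m N) (1\<^sub>m N) \<ge> 1 / (max_norm (butterfly n ?\<theta>))\<^sup>2"
      using elim unfolding N by (intro rho_permuted_butterfly_ge) auto
    moreover have "rho (B \<omega>) P' (1\<^sub>m N) = 1 / (max_norm (B \<omega>))\<^sup>2" if "gepp (B \<omega>) P'" for P'
      using gepp_butterfly(3)[of n ?\<theta> P'] elim that unfolding N by metis
    ultimately show ?case using elim by simp
  qed
qed

end
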